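(* Let $A_{1,0},A_{0,1},B_{1,0},B_{0,1}$ be independent normal random variables with mean $0$ and standard deviation $1$, and consider the random planar linear vector field $$F_1(x,y)=(A_{1,0}x+A_{0,1}y)\frac{\partial}{\partial x}+(B_{1,0}x+B_{0,1}y)\frac{\partial}{\partial y}.$$ The phase portraits of $F_1$ (modulo time orientation) which occur with positive probability are exactly three, namely $L_1$ (saddle), $L_2$ (node with two different eigenvalues) and $L_3$ (focus). They are completely determined by the couple $(i,l)$, where $i$ is the index of the vector field at the origin and $l$ is the number of invariant straight lines through the origin: $L_1$ corresponds to $(i,l)=(-1,2)$, $L_2$ to $(i,l)=(1,2)$ and $L_3$ to $(i,l)=(1,0)$. Moreover, writing $P(L_j)$ for the probability that the phase portrait of $F_1$ is $L_j$, $$P(L_1)=\frac12,\qquad P(L_2)=\frac{\sqrt2}{2}-\frac12\simeq 0.20711,\qquad P(L_3)=1-\frac{\sqrt2}{2}\simeq 0.29289.$$ Finally, the probability that the origin is a global attractor of $F_1$ is $1/4$, and the probability that it is a global repeller is also $1/4$.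
   Context: Phase portraits are considered in the Poincaré disk (the closed disk obtained by the Poincaré compactification of the plane, to which the flow of a polynomial vector field, after a positive rescaling of time, extends, with the boundary circle, "infinity", invariant). Two vector fields have the same phase portrait modulo time orientation if there is a homeomorphism of the closed Poincaré disk, preserving the boundary circle, carrying orbits of one to orbits of the other and either preserving the time orientation of all orbits or reversing the time orientation of all orbits. $P(W)$ denotes the probability that a phase portrait of type $W$ occurs, modulo time orientation. The index of a planar vector field $f$ at an isolated zero $\mathbf 0$ is the degree of the map $f/\|f\|$ from a small circle around $\mathbf 0$ (enclosing no other zero) to the unit circle. The origin is a global attractor (resp. global repeller) if every solution $(x(t),y(t))$ tends to $\mathbf 0$ as $t\to+\infty$ (resp. $t\to-\infty$). *)

theory Defs
  imports "HOL-Probability.Probability" "HOL-Complex_Analysis.Complex_Analysis"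
begin

section \<open>Planar vector fields\<close>

type_synonym vf = "real^2 \<Rightarrow> real^2"

text \<open>Solutions are required to live on the whole real line. Linear fields, and the
  compactified fields below restricted to the invariant closed disk, are complete, so for
  them these are exactly the maximal solutions.\<close>

definition solution :: "vf \<Rightarrow> (real \<Rightarrow> real^2) \<Rightarrow> bool" where
  "solution f x \<longleftrightarrow> (\<forall>t. (x has_vector_derivative f (x t)) (at t))"

definition global_attractor :: "vf \<Rightarrow> bool" where
  "global_attractor f \<longleftrightarrow> (\<forall>x. solution f x \<longrightarrow> (x \<longlongrightarrow> 0) at_top)"

definition global_repeller :: "vf \<Rightarrow> bool" where
  "global_repeller f \<longleftrightarrow> (\<forall>x. solution f x \<longrightarrow> (x \<longlongrightarrow> 0) at_bot)"

definition invariant_lines :: "vf \<Rightarrow> (real^2) set set" where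
  "invariant_lines f =
     {L. (\<exists>v. v \<noteq> 0 \<and> L = span {v}) \<and>
         (\<forall>x. solution f x \<longrightarrow> x 0 \<in> L \<longrightarrow> (\<forall>t. x t \<in> L))}"

text \<open>The degree of a map of the unit circle into itself is the winding number about 0 of
  the image of the circle traversed once counterclockwise.\<close>

definition circle_point :: "real \<Rightarrow> real^2" where
  "circle_point t = vector [cos (2 * pi * t), sin (2 * pi * t)]"

definition to_complex :: "real^2 \<Rightarrow> complex" where
  "to_complex v = Complex (v $ 1) (v $ 2)"

definition has_index :: "vf \<Rightarrow> real^2 \<Rightarrow> int \<Rightarrow> bool" where
  "has_index f p k \<longleftrightarrow>
     f p = 0 \<and>
     (\<exists>e>0. continuous_on (cball p e) f \<and> (\<forall>z\<in>cball p e - {p}. f z \<noteq> 0) \<and>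
        (\<forall>r. 0 < r \<and> r \<le> e \<longrightarrow>
           winding_number (\<lambda>t. to_complex (sgn (f (p + r *\<^sub>R circle_point t)))) 0 = of_int k))"

text \<open>Finiteness is explicit because the cardinality of an infinite set is 0.\<close>

definition has_index_and_lines :: "vf \<Rightarrow> int \<Rightarrow> nat \<Rightarrow> bool" where
  "has_index_and_lines f i l \<longleftrightarrow>
     has_index f 0 i \<and> finite (invariant_lines f) \<and> card (invariant_lines f) = l"


section \<open>Phase portraits of linear fields in the Poincar\'e disk\<close>

text \<open>The plane is identified with the open unit disk by central projection to the upper
  hemisphere followed by orthogonal projection. The push-forward of a polynomial field of
  degree d, multiplied by the positive factor (1 - |u|^2) powr ((d - 1) / 2), extends to the
  closed disk. For d = 1 the factor is 1 and the result is the field below, by the two lemmas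
  following the definitions.\<close>

definition disk_map :: "real^2 \<Rightarrow> real^2" where
  "disk_map p = (1 / sqrt (1 + p \<bullet> p)) *\<^sub>R p"

definition disk_field :: "vf \<Rightarrow> vf" where
  "disk_field f u = f u - (u \<bullet> f u) *\<^sub>R u"

lemma solution_disk_field:
  assumes "linear f" "solution f x"
  shows "solution (disk_field f) (\<lambda>t. disk_map (x t))"
  unfolding solution_def
proof
  fix t
  define s where "s = sqrt (1 + x t \<bullet> x t)"
  have pos: "1 + x t \<bullet> x t > 0"
    by (simp add: add_pos_nonneg)
  then have s: "s > 0" "s * s = 1 + x t \<bullet> x t"
    by (simp_all add: s_def)
  have x: "(x has_vector_derivative f (x t)) (at t)"
    using assms(2) by (simp add: solution_def)
  have "((\<lambda>t. x t \<bullet> x t) has_real_derivative 2 * (x t \<bullet> f (x t))) (at t)"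
    using has_derivative_inner[OF x[unfolded has_vector_derivative_def] x[unfolded has_vector_derivative_def]]
    by (simp add: has_field_derivative_def inner_commute algebra_simps mult_commute_abs)
  then have "((\<lambda>t. 1 / sqrt (1 + x t \<bullet> x t)) has_real_derivative - (x t \<bullet> f (x t)) / s ^ 3) (at t)"
    using pos s unfolding s_def
    by (auto intro!: derivative_eq_intros simp: field_simps power3_eq_cube)
  from has_vector_derivative_scaleR[OF this x]
  have "((\<lambda>t. disk_map (x t)) has_vector_derivative
      (1 / s) *\<^sub>R f (x t) + (- (x t \<bullet> f (x t)) / s ^ 3) *\<^sub>R x t) (at t)"
    by (simp add: disk_map_def s_def)
  moreover have "disk_field f (disk_map (x t)) =
      (1 / s) *\<^sub>R f (x t) + (- (x t \<bullet> f (x t)) / s ^ 3) *\<^sub>R x t"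
    by (simp add: disk_field_def disk_map_def s_def[symmetric] linear_scale[OF assms(1)]
        power3_eq_cube)
  ultimately show "((\<lambda>t. disk_map (x t)) has_vector_derivative
      disk_field f (disk_map (x t))) (at t)"
    by simp
qed

lemma disk_field_tangent_boundary:
  assumes "u \<in> sphere 0 1"
  shows "u \<bullet> disk_field f u = 0"
  using assms by (simp add: disk_field_def inner_diff_right dot_square_norm)

definition disk_solution :: "vf \<Rightarrow> (real \<Rightarrow> real^2) \<Rightarrow> bool" where
  "disk_solution f x \<longleftrightarrow> solution (disk_field f) x \<and> range x \<subseteq> cball 0 1"

text \<open>A map carries an orbit onto an orbit preserving (reversing) the time orientation if it
  carries a parametrizing solution to a solution precomposed with an increasing (decreasing)
  bijection of the time line.\<close>

definition carries_orbits_preserving :: "(real^2 \<Rightarrow> real^2) \<Rightarrow> vf \<Rightarrow> vf \<Rightarrow> bool" where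
  "carries_orbits_preserving h f g \<longleftrightarrow>
     (\<forall>x. disk_solution f x \<longrightarrow>
        (\<exists>y \<tau>. disk_solution g y \<and> strict_mono \<tau> \<and> surj \<tau> \<and> (\<forall>t. h (x t) = y (\<tau> t))))"

definition carries_orbits_reversing :: "(real^2 \<Rightarrow> real^2) \<Rightarrow> vf \<Rightarrow> vf \<Rightarrow> bool" where
  "carries_orbits_reversing h f g \<longleftrightarrow>
     (\<forall>x. disk_solution f x \<longrightarrow>
        (\<exists>y \<tau>. disk_solution g y \<and> strict_antimono_on UNIV \<tau> \<and> surj \<tau> \<and> (\<forall>t. h (x t) = y (\<tau> t))))"

definition same_portrait :: "vf \<Rightarrow> vf \<Rightarrow> bool" where
  "same_portrait f g \<longleftrightarrow>
     (\<exists>h k. homeomorphism (cball 0 1) (cball 0 1) h k \<and> h ` sphere 0 1 = sphere 0 1 \<and>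
        (carries_orbits_preserving h f g \<or> carries_orbits_reversing h f g))"

definition phase_portrait :: "vf \<Rightarrow> vf set" where
  "phase_portrait f = {g. linear g \<and> same_portrait f g}"


section \<open>Saddles, nodes and foci\<close>

definition is_eigenvalue :: "vf \<Rightarrow> complex \<Rightarrow> bool" where
  "is_eigenvalue f a \<longleftrightarrow>
     (\<exists>v::complex^2. v \<noteq> 0 \<and> (\<chi> i j. complex_of_real (matrix f $ i $ j)) *v v = a *s v)"

definition saddles :: "vf set" where
  "saddles = {f. linear f \<and>
     (\<exists>a b :: real. a < 0 \<and> 0 < b \<and> is_eigenvalue f a \<and> is_eigenvalue f b)}"

definition distinct_nodes :: "vf set" where
  "distinct_nodes = {f. linear f \<and>
     (\<exists>a b :: real. a \<noteq> b \<and> 0 < a * b \<and> is_eigenvalue f a \<and> is_eigenvalue f b)}"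

definition foci :: "vf set" where
  "foci = {f. linear f \<and> (\<exists>a. Re a \<noteq> 0 \<and> Im a \<noteq> 0 \<and> is_eigenvalue f a)}"


section \<open>Random fields\<close>

definition portrait_event :: "'w measure \<Rightarrow> ('w \<Rightarrow> vf) \<Rightarrow> vf set \<Rightarrow> 'w set" where
  "portrait_event M F W = {\<omega> \<in> space M. phase_portrait (F \<omega>) = W}"

definition portrait_prob :: "'w measure \<Rightarrow> ('w \<Rightarrow> vf) \<Rightarrow> vf set \<Rightarrow> real" where
  "portrait_prob M F W = measure M (portrait_event M F W)"

end

theory Submission
  imports Defs
begin

text \<open>A planar linear field is classified by its trace \<open>T\<close>, its determinant \<open>\<Delta>\<close> and the discriminant
\<open>T^2 - 4 \<Delta>\<close>: it is a saddle iff \<open>\<Delta> < 0\<close>, a node with two different eigenvalues iff \<open>\<Delta> > 0\<close> and the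
discriminant is positive, a focus iff the discriminant is negative and \<open>T \<noteq> 0\<close>. Almost surely
\<open>T\<close>, \<open>\<Delta>\<close> and the discriminant are all nonzero, and then exactly one of the three cases holds. So it
remains to see that each of the three classes is one full equivalence class of phase portraits,
and to compute Gaussian measures.

\<^bold>\<open>Equivalences.\<close> Every solution in the closed disk is \<open>Y / sqrt (c + |Y|^2)\<close> for a solution \<open>Y\<close>
of the linear equation and a constant \<open>c \<ge> 0\<close>, which is 0 exactly on the boundary circle
(\<open>disk_lift\<close>). Hence every invertible linear map acts on the closed disk
(\<open>projective_action\<close>), and a field may be replaced by a real normal form
(\<open>same_portrait_conjugate\<close>). For a diagonal field, the squares \<open>u1^2\<close>, \<open>u2^2\<close>, \<open>1 - |u|^2\<close> of the
homogeneous coordinates map a quadrant of the disk onto a triangle, and the flow multiplies these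
barycentric coordinates by exponentials of three different rates. Write \<open>p\<close>, \<open>q\<close>, \<open>m\<close> for the coordinates
with the lowest, highest and middle rate. A suitable \<open>p^b q^(1-b) / m\<close> is constant on orbits, and
\<open>q - p\<close> increases along them. Matching points of two such triangles that have the same \<open>q - p\<close> and the same
constant is a homeomorphism that carries orbits to orbits and fixes the boundary of the triangle, so that the
four quadrants fit together (\<open>same_portrait_adapted\<close>). Saddles and nodes differ only in which
coordinate has the middle rate: \<open>1 - |u|^2\<close> for a saddle, the slow eigendirection for a node. For
foci a radial rescaling \<open>r \<mapsto> r^k\<close> together with a linear change of time suffices
(\<open>same_portrait_normal_foci\<close>). Reversing time makes repelling fields out of attracting ones.

\<^bold>\<open>Invariants.\<close> An equivalence maps the equilibria in the open disk and those on the circle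
bijectively, and it preserves the property that all interior orbits tend to the origin in one
time direction. There is just one interior equilibrium iff \<open>\<Delta> \<noteq> 0\<close>; the circle carries four equilibria iff
the discriminant is positive, none iff it is negative; the third property means \<open>T \<noteq> 0\<close> and
\<open>\<Delta> > 0\<close>. Together they recognise each class (\<open>same_portrait_invariants\<close>).

\<^bold>\<open>Index and lines.\<close> Identifying the plane with the complex numbers, the field is \<open>z \<mapsto> m z + n cnj z\<close> with
\<open>|m|^2 - |n|^2 = \<Delta>\<close>, so the dominant term determines the winding number (\<open>has_index_linear\<close>). The invariant
lines are the eigenlines.

\<^bold>\<open>Probabilities.\<close> Negating the first row of the matrix reverses the sign of \<open>\<Delta>\<close>, and negating the whole matrix
reverses the sign of \<open>T\<close> while \<open>\<Delta>\<close> stays; this gives \<open>1/2\<close> and \<open>1/4\<close>. For a matrix with rows \<open>(a, b)\<close> and \<open>(c, d)\<close> the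
discriminant is \<open>(a - d)^2 + (b + c)^2 - (b - c)^2\<close>, so after rotations by 45 degrees in the \<open>(a, d)\<close> and
\<open>(b, c)\<close> planes it is nonpositive on a cone \<open>u^2 + s^2 \<le> t^2\<close> for three independent standard
normal variables. That cone has probability \<open>1 - sqrt 2 / 2\<close> (\<open>gauss4_cone\<close>).\<close>

no_notation fps_nth (infixl "$" 75)

section \<open>Planar linear maps in coordinates\<close>

definition lin2 :: "real \<Rightarrow> real \<Rightarrow> real \<Rightarrow> real \<Rightarrow> vf" where
  "lin2 a b c d p = vector [a * p $ 1 + b * p $ 2, c * p $ 1 + d * p $ 2]"

definition trace_of :: "vf \<Rightarrow> real" where "trace_of f = trace (matrix f)"
definition det_of :: "vf \<Rightarrow> real" where "det_of f = det (matrix f)"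
definition discriminant :: "vf \<Rightarrow> real" where "discriminant f = (trace_of f)\<^sup>2 - 4 * det_of f"

lemma lin2_nth [simp]:
  "lin2 a b c d p $ 1 = a * p $ 1 + b * p $ 2" "lin2 a b c d p $ 2 = c * p $ 1 + d * p $ 2"
  by (simp_all add: lin2_def)

lemma vec2_eq_iff: "(u::'a^2) = v \<longleftrightarrow> u $ 1 = v $ 1 \<and> u $ 2 = v $ 2"
  by (simp add: vec_eq_iff forall_2)

lemma inner2: "(u::real^2) \<bullet> v = u $ 1 * v $ 1 + u $ 2 * v $ 2"
  by (simp add: inner_vec_def sum_2)

lemma linear_lin2 [simp]: "linear (lin2 a b c d)"
  by (rule linearI) (simp_all add: vec2_eq_iff algebra_simps)

lemma linear_imp_lin2:
  assumes "linear f" obtains a b c d where "f = lin2 a b c d"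
proof -
  have "f p = matrix f *v p" for p
    using assms by (simp add: matrix_works)
  then have "f = lin2 (matrix f $1$1) (matrix f $1$2) (matrix f $2$1) (matrix f $2$2)"
    by (auto simp: fun_eq_iff vec2_eq_iff matrix_vector_mult_def sum_2)
  then show thesis by (rule that)
qed

lemma matrix_lin2:
  "matrix (lin2 a b c d) $ 1 $ 1 = a" "matrix (lin2 a b c d) $ 1 $ 2 = b"
  "matrix (lin2 a b c d) $ 2 $ 1 = c" "matrix (lin2 a b c d) $ 2 $ 2 = d"
  by (simp_all add: matrix_def axis_def)

lemma invariants_lin2 [simp]:
  "trace_of (lin2 a b c d) = a + d" "det_of (lin2 a b c d) = a * d - b * c"
  "discriminant (lin2 a b c d) = (a - d)\<^sup>2 + 4 * b * c"
  by (simp_all add: trace_of_def det_of_def discriminant_def trace_def sum_2 det_2 matrix_lin2 power2_eq_square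
      algebra_simps)

lemma invariants_uminus:
  assumes "linear f"
  shows "trace_of (\<lambda>p. - f p) = - trace_of f" "det_of (\<lambda>p. - f p) = det_of f" "discriminant (\<lambda>p. - f p) = discriminant f"
proof -
  obtain a b c d where f: "f = lin2 a b c d" using linear_imp_lin2[OF assms] .
  have "(\<lambda>p. - f p) = lin2 (-a) (-b) (-c) (-d)"
    by (auto simp: f fun_eq_iff vec2_eq_iff)
  then show "trace_of (\<lambda>p. - f p) = - trace_of f" "det_of (\<lambda>p. - f p) = det_of f" "discriminant (\<lambda>p. - f p) = discriminant f"
    by (simp_all add: f power2_commute)
qed

text \<open>The Cayley-Hamilton theorem in the form used below: it gives explicit solutions, a Lyapunov
function and the fact that eigenvalues are roots of the characteristic polynomial.\<close>

lemma cayley_hamilton2: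
  assumes "linear f" shows "f (f p) = trace_of f *\<^sub>R f p - det_of f *\<^sub>R p"
proof -
  obtain a b c d where f: "f = lin2 a b c d" using linear_imp_lin2[OF assms] .
  show ?thesis by (simp add: f vec2_eq_iff algebra_simps)
qed

lemma eigenvalue_root:
  assumes "linear f" "f v = l *\<^sub>R v" "v \<noteq> 0"
  shows "l\<^sup>2 - trace_of f * l + det_of f = 0"
proof -
  have "(l\<^sup>2 - trace_of f * l + det_of f) *\<^sub>R v = 0"
    using cayley_hamilton2[OF assms(1), of v] assms(2)
    by (simp add: linear_scale[OF assms(1)] algebra_simps power2_eq_square)
  then show ?thesis using assms(3) by simp
qed

lemma kernel2:
  assumes "linear f" "det_of f = 0"
  obtains v where "v \<noteq> 0" "f v = 0"
proof -
  obtain a b c d where f: "f = lin2 a b c d" using linear_imp_lin2[OF assms(1)] .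
  have *: "a * d = b * c" using assms(2) by (simp add: f)
  consider "(a, b) \<noteq> (0, 0)" | "(c, d) \<noteq> (0, 0)" | "a = 0" "b = 0" "c = 0" "d = 0" by auto
  then show thesis
  proof cases
    case 1 then show thesis using * by (intro that[of "vector [- b, a]"]) (auto simp: f vec2_eq_iff algebra_simps)
  next
    case 2 then show thesis using * by (intro that[of "vector [- d, c]"]) (auto simp: f vec2_eq_iff algebra_simps)
  next
    case 3 then show thesis by (intro that[of "vector [1, 0]"]) (auto simp: f vec2_eq_iff)
  qed
qed

lemma det_nonzero_imp_inj:
  assumes "linear f" "det_of f \<noteq> 0" "f v = 0" shows "v = 0"
  using eigenvalue_root[OF assms(1), of v 0] assms by auto

lemma root_eigenvalue:
  assumes "linear f" "l\<^sup>2 - trace_of f * l + det_of f = 0"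
  obtains v where "v \<noteq> 0" "f v = l *\<^sub>R v"
proof -
  obtain a b c d where f: "f = lin2 a b c d" using linear_imp_lin2[OF assms(1)] .
  define g where "g = lin2 (a - l) b c (d - l)"
  have "det_of g = 0" using assms(2) by (simp add: g_def f power2_eq_square algebra_simps)
  then obtain v where v: "v \<noteq> 0" "g v = 0" using kernel2[of g] by (auto simp: g_def)
  then have "f v = l *\<^sub>R v" by (simp add: f g_def vec2_eq_iff algebra_simps)
  with v(1) show thesis by (rule that)
qed

lemma real_roots:
  assumes "l\<^sup>2 - t * l + d = 0" "m\<^sup>2 - t * m + d = 0" "l \<noteq> m"
  shows "t = l + m" "d = l * (m::real)" "t\<^sup>2 - 4 * d > 0"
proof -
  have "(l - m) * (l + m - t) = 0" using assms(1,2) by (simp add: power2_eq_square algebra_simps)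
  then show t: "t = l + m" using assms(3) by simp
  show d: "d = l * m" using assms(1) by (simp add: t power2_eq_square algebra_simps)
  have "(l - m)\<^sup>2 > 0" using assms(3) by simp
  then show "t\<^sup>2 - 4 * d > 0" by (simp add: t d power2_eq_square algebra_simps)
qed

lemma quadratic_real_roots:
  assumes "(t::real)\<^sup>2 - 4 * d \<ge> 0"
  shows "((t - sqrt (t\<^sup>2 - 4 * d)) / 2)\<^sup>2 - t * ((t - sqrt (t\<^sup>2 - 4 * d)) / 2) + d = 0"
    "((t + sqrt (t\<^sup>2 - 4 * d)) / 2)\<^sup>2 - t * ((t + sqrt (t\<^sup>2 - 4 * d)) / 2) + d = 0"
  using assms real_sqrt_pow2[OF assms]
  by (simp_all add: power2_eq_square field_simps)

lemma distinct_eigenvectors: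
  assumes "linear f" "discriminant f > 0"
  obtains l m v w where "l < m" "v \<noteq> 0" "w \<noteq> 0" "f v = l *\<^sub>R v" "f w = m *\<^sub>R w"
    "trace_of f = l + m" "det_of f = l * m"
proof -
  define l m where "l = (trace_of f - sqrt (discriminant f)) / 2" and "m = (trace_of f + sqrt (discriminant f)) / 2"
  have lm: "l < m" using assms(2) by (simp add: l_def m_def)
  have r: "l\<^sup>2 - trace_of f * l + det_of f = 0" "m\<^sup>2 - trace_of f * m + det_of f = 0"
    using quadratic_real_roots[of "trace_of f" "det_of f"] assms(2) by (simp_all add: l_def m_def discriminant_def)
  obtain v where "v \<noteq> 0" "f v = l *\<^sub>R v" using root_eigenvalue[OF assms(1) r(1)] .
  moreover obtain w where "w \<noteq> 0" "f w = m *\<^sub>R w" using root_eigenvalue[OF assms(1) r(2)] .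
  ultimately show thesis using lm real_roots[OF r] by (intro that) auto
qed

section \<open>Eigenvalues of saddles, nodes and foci\<close>

lemma is_eigenvalue_iff:
  assumes "linear f"
  shows "is_eigenvalue f z \<longleftrightarrow> z\<^sup>2 - complex_of_real (trace_of f) * z + complex_of_real (det_of f) = 0"
proof -
  obtain a b c d where f: "f = lin2 a b c d" using linear_imp_lin2[OF assms] .
  let ?c = "z\<^sup>2 - complex_of_real (trace_of f) * z + complex_of_real (det_of f)"
  let ?E = "\<lambda>v::complex^2. of_real a * v$1 + of_real b * v$2 = z * v$1 \<and> of_real c * v$1 + of_real d * v$2 = z * v$2"
  have eq: "is_eigenvalue f z \<longleftrightarrow> (\<exists>v. v \<noteq> 0 \<and> ?E v)"
    by (auto simp: is_eigenvalue_def f matrix_lin2 vec2_eq_iff matrix_vector_mult_def sum_2)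
  have c: "?c = (of_real a - z) * (of_real d - z) - of_real b * of_real c"
    by (simp add: f power2_eq_square algebra_simps)
  show ?thesis
  proof
    assume "is_eigenvalue f z"
    then obtain v where v: "v \<noteq> 0" "?E v" using eq by blast
    have "?c * v$1 = 0" "?c * v$2 = 0" unfolding c using v(2) by (algebra, algebra)
    then show "?c = 0" using v(1) by (auto simp: vec2_eq_iff)
  next
    assume 0: "?c = 0"
    consider "(of_real a - z, complex_of_real b) \<noteq> (0, 0)" | "(complex_of_real c, of_real d - z) \<noteq> (0, 0)"
      | "of_real a - z = 0" "b = 0" "c = 0" "of_real d - z = 0" by auto
    then show "is_eigenvalue f z"
    proof cases
      case 1
      then have "vector [- of_real b, of_real a - z] \<noteq> (0::complex^2) \<and> ?E (vector [- of_real b, of_real a - z])"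
        using 0 unfolding c by (auto simp: vec2_eq_iff algebra_simps)
      then show ?thesis unfolding eq by blast
    next
      case 2
      then have "vector [- (of_real d - z), of_real c] \<noteq> (0::complex^2) \<and> ?E (vector [- (of_real d - z), of_real c])"
        using 0 unfolding c by (auto simp: vec2_eq_iff algebra_simps)
      then show ?thesis unfolding eq by blast
    next
      case 3
      then have "vector [1, 0] \<noteq> (0::complex^2) \<and> ?E (vector [1, 0])"
        by (auto simp: vec2_eq_iff)
      then show ?thesis unfolding eq by blast
    qed
  qed
qed

lemma is_eigenvalue_real_iff:
  assumes "linear f"
  shows "is_eigenvalue f (complex_of_real l) \<longleftrightarrow> l\<^sup>2 - trace_of f * l + det_of f = 0"
proof -
  have "(complex_of_real l)\<^sup>2 - complex_of_real (trace_of f) * of_real l + complex_of_real (det_of f)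
     = of_real (l\<^sup>2 - trace_of f * l + det_of f)" by simp
  then show ?thesis unfolding is_eigenvalue_iff[OF assms] by (simp only: of_real_eq_0_iff)
qed

text \<open>In the definitions of saddles and nodes the first eigenvalue is compared in the order of the
complex numbers, where comparable numbers have equal imaginary parts. So a bound by 0 makes it real, and the
following two characterisations may speak of real numbers only.\<close>

lemma complex_less_0_iff: "(a::complex) < 0 \<longleftrightarrow> (\<exists>r::real. a = of_real r \<and> r < 0)"
  by (auto simp: less_complex_def complex_eq_iff)

lemma saddles_alt: "f \<in> saddles \<longleftrightarrow> linear f \<and>
    (\<exists>(a::real) (b::real). a < 0 \<and> 0 < b \<and>
       is_eigenvalue f (complex_of_real a) \<and> is_eigenvalue f (complex_of_real b))"
proof -
  have "0 < complex_of_real b \<longleftrightarrow> 0 < b" for b by (simp add: less_complex_def)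
  then show ?thesis unfolding saddles_def complex_less_0_iff by auto
qed

lemma distinct_nodes_alt: "f \<in> distinct_nodes \<longleftrightarrow> linear f \<and>
    (\<exists>(a::real) (b::real). a \<noteq> b \<and> 0 < a * b \<and>
       is_eigenvalue f (complex_of_real a) \<and> is_eigenvalue f (complex_of_real b))"
proof -
  have "(0 < a * complex_of_real b) \<longleftrightarrow> (\<exists>r::real. a = of_real r \<and> 0 < r * b)" for a b
    by (auto simp: less_complex_def complex_eq_iff)
  then show ?thesis unfolding distinct_nodes_def by (auto 4 4) (metis of_real_eq_iff)
qed

lemma saddles_iff: "f \<in> saddles \<longleftrightarrow> linear f \<and> det_of f < 0"
proof (cases "linear f")
  case True
  show ?thesis
  proof
    assume "f \<in> saddles"
    then obtain a b where ab: "a < 0" "0 < b" "is_eigenvalue f (complex_of_real a)" "is_eigenvalue f (complex_of_real b)"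
      unfolding saddles_alt by blast
    then have "det_of f = a * b" using real_roots(2)[of a "trace_of f" "det_of f" b] by (simp add: is_eigenvalue_real_iff[OF True])
    then show "linear f \<and> det_of f < 0" using ab True by (simp add: mult_neg_pos)
  next
    assume A: "linear f \<and> det_of f < 0"
    then have "discriminant f > 0" using zero_le_power2[of "trace_of f"] unfolding discriminant_def by linarith
    then obtain l m v w where *: "l < m" "v \<noteq> 0" "w \<noteq> 0" "f v = l *\<^sub>R v" "f w = m *\<^sub>R w"
       "trace_of f = l + m" "det_of f = l * m" using distinct_eigenvectors[OF True] by metis
    then have "l < 0" "0 < m" using A by (auto simp: mult_less_0_iff)
    moreover have "is_eigenvalue f (complex_of_real l)" "is_eigenvalue f (complex_of_real m)"
      using eigenvalue_root[OF True] * by (auto simp: is_eigenvalue_real_iff[OF True])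
    ultimately show "f \<in> saddles" using True unfolding saddles_alt by blast
  qed
qed (simp add: saddles_def)

lemma distinct_nodes_iff: "f \<in> distinct_nodes \<longleftrightarrow> linear f \<and> det_of f > 0 \<and> discriminant f > 0"
proof (cases "linear f")
  case True
  show ?thesis
  proof
    assume "f \<in> distinct_nodes"
    then obtain a b where ab: "a \<noteq> b" "0 < a * b" "is_eigenvalue f (complex_of_real a)" "is_eigenvalue f (complex_of_real b)"
      unfolding distinct_nodes_alt by blast
    then show "linear f \<and> det_of f > 0 \<and> discriminant f > 0" 
      using real_roots(2,3)[of a "trace_of f" "det_of f" b] True by (simp add: is_eigenvalue_real_iff[OF True] discriminant_def)
  next
    assume A: "linear f \<and> det_of f > 0 \<and> discriminant f > 0"
    then obtain l m v w where *: "l < m" "v \<noteq> 0" "w \<noteq> 0" "f v = l *\<^sub>R v" "f w = m *\<^sub>R w"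
       "trace_of f = l + m" "det_of f = l * m" using distinct_eigenvectors[OF True] by metis
    moreover have "is_eigenvalue f (complex_of_real l)" "is_eigenvalue f (complex_of_real m)"
      using eigenvalue_root[OF True] * by (auto simp: is_eigenvalue_real_iff[OF True])
    moreover have "l \<noteq> m" "0 < l * m" using * A by auto
    ultimately show "f \<in> distinct_nodes" using True unfolding distinct_nodes_alt by blast
  qed
qed (simp add: distinct_nodes_def)

lemma foci_iff: "f \<in> foci \<longleftrightarrow> linear f \<and> discriminant f < 0 \<and> trace_of f \<noteq> 0"
proof (cases "linear f")
  case True
  have eq: "is_eigenvalue f z \<longleftrightarrow> (Re z)\<^sup>2 - (Im z)\<^sup>2 - trace_of f * Re z + det_of f = 0 \<and> Im z * (2 * Re z - trace_of f) = 0" for z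
    unfolding is_eigenvalue_iff[OF True] complex_eq_iff by (auto simp: power2_eq_square algebra_simps)
  show ?thesis
  proof
    assume "f \<in> foci"
    then obtain z where z: "Re z \<noteq> 0" "Im z \<noteq> 0" "is_eigenvalue f z" by (auto simp: foci_def)
    then have t: "trace_of f = 2 * Re z" and e: "(Re z)\<^sup>2 - (Im z)\<^sup>2 - trace_of f * Re z + det_of f = 0"
      unfolding eq by auto
    from e have "det_of f = (Re z)\<^sup>2 + (Im z)\<^sup>2"
      unfolding t by (simp add: power2_eq_square)
    then have "discriminant f = - 4 * (Im z)\<^sup>2" by (simp add: discriminant_def t power2_eq_square)
    then show "linear f \<and> discriminant f < 0 \<and> trace_of f \<noteq> 0" using True z t by simp
  next
    assume A: "linear f \<and> discriminant f < 0 \<and> trace_of f \<noteq> 0"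
    define z where "z = Complex (trace_of f / 2) (sqrt (- discriminant f) / 2)"
    have "is_eigenvalue f z" unfolding eq using A
      by (simp add: z_def power_divide) (simp add: discriminant_def field_simps power2_eq_square)
    moreover have "Re z \<noteq> 0" "Im z \<noteq> 0" using A by (auto simp: z_def)
    ultimately show "f \<in> foci" using True unfolding foci_def by blast
  qed
qed (simp add: foci_def)

section \<open>Solutions of planar linear equations\<close>

lemma has_vector_derivative_vec2_iff:
  fixes x :: "real \<Rightarrow> real^2"
  shows "(x has_vector_derivative v) (at t) \<longleftrightarrow>
    ((\<lambda>t. x t $ 1) has_real_derivative v $ 1) (at t) \<and> ((\<lambda>t. x t $ 2) has_real_derivative v $ 2) (at t)"
proof
  assume *: "(x has_vector_derivative v) (at t)"
  show "((\<lambda>t. x t $ 1) has_real_derivative v $ 1) (at t) \<and> ((\<lambda>t. x t $ 2) has_real_derivative v $ 2) (at t)"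
    using bounded_linear.has_vector_derivative[OF bounded_linear_vec_nth *]
    by (simp add: has_real_derivative_iff_has_vector_derivative)
next
  assume *: "((\<lambda>t. x t $ 1) has_real_derivative v $ 1) (at t) \<and> ((\<lambda>t. x t $ 2) has_real_derivative v $ 2) (at t)"
  have eq: "u = u $ 1 *\<^sub>R vector [1, 0] + u $ 2 *\<^sub>R vector [0, 1]" for u :: "real^2"
    by (simp add: vec2_eq_iff)
  have "((\<lambda>t. x t $ 1 *\<^sub>R vector [1, 0] + x t $ 2 *\<^sub>R vector [0, 1]) has_vector_derivative
    v $ 1 *\<^sub>R vector [1, 0] + v $ 2 *\<^sub>R (vector [0, 1]::real^2)) (at t)"
    using * by (auto intro!: derivative_eq_intros)
  then show "(x has_vector_derivative v) (at t)" by (simp flip: eq)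
qed

lemma solution_uminus:
  assumes "solution f x" shows "solution (\<lambda>p. - f p) (\<lambda>t. x (- t))"
  unfolding solution_def
proof
  fix t
  have "(x has_vector_derivative f (x (- t))) (at (- t))" using assms by (simp add: solution_def)
  moreover have "((\<lambda>t. - t) has_real_derivative - 1) (at t)" by (auto intro!: derivative_eq_intros)
  ultimately have "((x \<circ> (\<lambda>t. - t)) has_vector_derivative (-1) *\<^sub>R f (x (- t))) (at t)"
    by (intro vector_diff_chain_at) (auto simp: has_real_derivative_iff_has_vector_derivative)
  then show "((\<lambda>t. x (- t)) has_vector_derivative - f (x (- t))) (at t)" by (simp add: o_def)
qed

lemma solution_shift:
  assumes "solution f x" shows "solution f (\<lambda>t. x (t + s))"
  unfolding solution_def
proof
  fix t
  have "(x has_vector_derivative f (x (t + s))) (at (t + s))" using assms by (simp add: solution_def)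
  moreover have "((\<lambda>t. t + s) has_real_derivative 1) (at t)" by (auto intro!: derivative_eq_intros)
  ultimately have "((x \<circ> (\<lambda>t. t + s)) has_vector_derivative 1 *\<^sub>R f (x (t + s))) (at t)"
    by (intro vector_diff_chain_at) (auto simp: has_real_derivative_iff_has_vector_derivative)
  then show "((\<lambda>t. x (t + s)) has_vector_derivative f (x (t + s))) (at t)" by (simp add: o_def)
qed

lemma solution_scaleR:
  assumes "linear f" "solution f x" shows "solution f (\<lambda>t. r *\<^sub>R x t)"
  using assms by (auto simp: solution_def linear_scale intro!: derivative_eq_intros)

lemma solution_diff:
  assumes "linear f" "solution f x" "solution f y" shows "solution f (\<lambda>t. x t - y t)"
  using assms by (auto simp: solution_def linear_diff intro!: derivative_eq_intros)

lemma solution_eigenvector: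
  assumes "linear f" "f v = l *\<^sub>R v" shows "solution f (\<lambda>t. exp (l * t) *\<^sub>R v)"
  using assms by (auto simp: solution_def linear_scale mult.commute intro!: derivative_eq_intros)

lemma solution_inner_derivative:
  assumes "solution f x"
  shows "((\<lambda>t. x t \<bullet> x t) has_real_derivative 2 * (x t \<bullet> f (x t))) (at t)"
proof -
  have x: "(x has_vector_derivative f (x t)) (at t)" using assms by (simp add: solution_def)
  show ?thesis
    using has_derivative_inner[OF x[unfolded has_vector_derivative_def] x[unfolded has_vector_derivative_def]]
    by (simp add: has_field_derivative_def inner_commute algebra_simps mult_commute_abs)
qed

text \<open>Gronwall's argument: if \<open>|f v| \<le> K |v|\<close>, then \<open>exp (- 2 K t) |z t|^2\<close> does not increase.\<close>

lemma solution_zero_forward: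
  assumes "linear f" "solution f z" "z s = 0" "s \<le> t"
  shows "z t = 0"
proof -
  obtain K where K: "\<And>v. norm (f v) \<le> K * norm v" using linear_bounded[OF assms(1)] by blast
  define \<phi> where "\<phi> t = exp (- 2 * K * t) * (z t \<bullet> z t)" for t
  have "\<phi> t \<le> \<phi> s"
  proof (rule DERIV_nonpos_imp_nonincreasing[OF assms(4)])
    fix u
    have "(\<phi> has_real_derivative exp (- 2 * K * u) * (2 * (z u \<bullet> f (z u)) - 2 * K * (z u \<bullet> z u))) (at u)"
      unfolding \<phi>_def by (auto intro!: derivative_eq_intros solution_inner_derivative[OF assms(2)] simp: algebra_simps)
    moreover have "z u \<bullet> f (z u) \<le> K * (z u \<bullet> z u)"
    proof -
      have "z u \<bullet> f (z u) \<le> norm (z u) * norm (f (z u))" by (rule norm_cauchy_schwarz)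
      also have "\<dots> \<le> norm (z u) * (K * norm (z u))" by (intro mult_left_mono K) simp
      finally show ?thesis by (simp add: dot_square_norm power2_eq_square algebra_simps)
    qed
    ultimately show "\<exists>y. (\<phi> has_real_derivative y) (at u) \<and> y \<le> 0"
      by (intro exI conjI) (auto simp: mult_le_0_iff)
  qed
  then have "z t \<bullet> z t \<le> 0" using assms(3) by (simp add: \<phi>_def mult_le_0_iff)
  then show ?thesis using inner_ge_zero[of "z t"] inner_eq_zero_iff[of "z t"] by linarith
qed

lemma linear_uminus_field: "linear f \<Longrightarrow> linear (\<lambda>p. - f p :: real^2)"
  by (simp add: linear_compose_neg)

lemma solution_zero:
  assumes "linear f" "solution f z" "z s = 0" shows "z t = 0"
proof (cases "s \<le> t")
  case True then show ?thesis using solution_zero_forward assms by blast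
next
  case False
  then show ?thesis
    using solution_zero_forward[OF linear_uminus_field[OF assms(1)] solution_uminus[OF assms(2)], of "- s" "- t"] assms
    by simp
qed

lemma solution_unique:
  assumes "linear f" "solution f x" "solution f y" "x s = y s" shows "x t = y t"
  using solution_zero[OF assms(1) solution_diff[OF assms(1-3)], of s t] assms(4) by simp

text \<open>A common name for the functions cosh and sinh, 1 and t, or cos and sin, according to the sign of
\<open>k\<close>; with them one formula solves every planar linear equation.\<close>

lemma generalized_cosh_sinh:
  obtains C S :: "real \<Rightarrow> real" where "C 0 = 1" "S 0 = 0"
    "\<And>t. (C has_real_derivative k * S t) (at t)" "\<And>t. (S has_real_derivative C t) (at t)"
proof (cases k "0::real" rule: linorder_cases)
  case less
  define w where "w = sqrt (- k)"
  have w: "w \<noteq> 0" "k = - (w * w)" using less by (auto simp: w_def)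
  show thesis
    by (rule that[of "\<lambda>t. cos (w * t)" "\<lambda>t. sin (w * t) / w"])
       (use w in \<open>auto intro!: derivative_eq_intros\<close>)
next
  case equal
  show thesis
    by (rule that[of "\<lambda>t. 1" "\<lambda>t. t"]) (use equal in \<open>auto intro!: derivative_eq_intros\<close>)
next
  case greater
  define w where "w = sqrt k"
  have w: "w \<noteq> 0" "w * w = k" using greater by (auto simp: w_def)
  show thesis
    by (rule that[of "\<lambda>t. cosh (w * t)" "\<lambda>t. sinh (w * t) / w"])
       (use w in \<open>auto intro!: derivative_eq_intros simp: field_simps\<close>)
qed

lemma solution_exists:
  assumes "linear f" obtains x where "solution f x" "x s = v"
proof -
  obtain C S where CS: "C 0 = 1" "S 0 = (0::real)"
    "\<And>t. (C has_real_derivative (discriminant f / 4) * S t) (at t)" "\<And>t. (S has_real_derivative C t) (at t)"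
    using generalized_cosh_sinh[of "discriminant f / 4"] by metis
  \<comment> \<open>By Cayley-Hamilton \<open>f - T / 2\<close> squares to a quarter of the discriminant.\<close>
  define n where "n = f v - (trace_of f / 2) *\<^sub>R v"
  have fv: "f v = (trace_of f / 2) *\<^sub>R v + n" by (simp add: n_def)
  have fn: "f n = (trace_of f / 2) *\<^sub>R n + (discriminant f / 4) *\<^sub>R v"
    by (simp add: n_def linear_diff[OF assms] linear_scale[OF assms] cayley_hamilton2[OF assms]
        discriminant_def vec2_eq_iff power2_eq_square field_simps)
  define x where "x t = exp (trace_of f / 2 * t) *\<^sub>R (C t *\<^sub>R v + S t *\<^sub>R n)" for t
  have "solution f x"
    unfolding solution_def
  proof
    fix t
    have "(x has_vector_derivative exp (trace_of f / 2 * t) *\<^sub>R ((discriminant f / 4 * S t) *\<^sub>R v + C t *\<^sub>R n) +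
        (exp (trace_of f / 2 * t) * (trace_of f / 2)) *\<^sub>R (C t *\<^sub>R v + S t *\<^sub>R n)) (at t)"
      unfolding x_def by (auto intro!: derivative_eq_intros CS(3,4))
    moreover have "exp (trace_of f / 2 * t) *\<^sub>R ((discriminant f / 4 * S t) *\<^sub>R v + C t *\<^sub>R n) +
        (exp (trace_of f / 2 * t) * (trace_of f / 2)) *\<^sub>R (C t *\<^sub>R v + S t *\<^sub>R n) = f (x t)"
      unfolding x_def by (simp add: linear_scale[OF assms] linear_add[OF assms] fv fn algebra_simps)
    ultimately show "(x has_vector_derivative f (x t)) (at t)" by simp
  qed
  from solution_shift[OF this, of "- s"] show thesis
    by (rule that) (simp add: x_def CS)
qed

section \<open>Solutions in the Poincare disk\<close>

text \<open>For \<open>c > 0\<close> this is the central projection of a solution at height \<open>sqrt c\<close>; for \<open>c = 0\<close> it is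
the induced solution on the circle at infinity. Both cases are needed, because equivalences act on the closed disk.\<close>

lemma disk_solution_of_linear:
  assumes "linear f" "solution f y" "c \<ge> 0" "\<And>t. c + y t \<bullet> y t > 0"
  shows "disk_solution f (\<lambda>t. (1 / sqrt (c + y t \<bullet> y t)) *\<^sub>R y t)"
  unfolding disk_solution_def
proof
  show "solution (disk_field f) (\<lambda>t. (1 / sqrt (c + y t \<bullet> y t)) *\<^sub>R y t)"
    unfolding solution_def
  proof
    fix t
    define s where "s = sqrt (c + y t \<bullet> y t)"
    have s: "s > 0" using assms(4) by (simp add: s_def)
    have y: "(y has_vector_derivative f (y t)) (at t)"
      using assms(2) by (simp add: solution_def)
    have "((\<lambda>t. 1 / sqrt (c + y t \<bullet> y t)) has_real_derivative - (y t \<bullet> f (y t)) / s ^ 3) (at t)"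
      using assms(4)[of t] s unfolding s_def
      by (auto intro!: derivative_eq_intros solution_inner_derivative[OF assms(2)]
          simp: field_simps power3_eq_cube)
    from has_vector_derivative_scaleR[OF this y]
    have "((\<lambda>t. (1 / sqrt (c + y t \<bullet> y t)) *\<^sub>R y t) has_vector_derivative
        (1 / s) *\<^sub>R f (y t) + (- (y t \<bullet> f (y t)) / s ^ 3) *\<^sub>R y t) (at t)"
      by (simp add: s_def)
    moreover have "disk_field f ((1 / s) *\<^sub>R y t) =
        (1 / s) *\<^sub>R f (y t) + (- (y t \<bullet> f (y t)) / s ^ 3) *\<^sub>R y t"
      by (simp add: disk_field_def linear_scale[OF assms(1)] power3_eq_cube)
    ultimately show "((\<lambda>t. (1 / sqrt (c + y t \<bullet> y t)) *\<^sub>R y t) has_vector_derivative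
        disk_field f ((1 / sqrt (c + y t \<bullet> y t)) *\<^sub>R y t)) (at t)"
      by (simp add: s_def)
  qed
  show "range (\<lambda>t. (1 / sqrt (c + y t \<bullet> y t)) *\<^sub>R y t) \<subseteq> cball 0 1"
  proof clarsimp
    fix t
    have "norm (y t) \<le> sqrt (c + y t \<bullet> y t)"
      using assms(3) by (simp add: norm_eq_sqrt_inner)
    then show "norm (y t) / \<bar>sqrt (c + y t \<bullet> y t)\<bar> \<le> 1"
      using assms(4)[of t] by (simp add: divide_le_eq)
  qed
qed

text \<open>Conversely, a solution \<open>x\<close> in the disk becomes linear after multiplication by the scalar \<open>m\<close> that
satisfies \<open>m' = (x \<bullet> f x) m\<close>, since the nonlinear term of the disk field is \<open>- (x \<bullet> f x) x\<close>. The
quantity \<open>m^2 (1 - |x|^2)\<close> is then constant. Existence, uniqueness and explicit formulas for the disk field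
all reduce to linear equations in this way.\<close>

lemma disk_lift:
  assumes "linear f" "disk_solution f x"
  obtains y where "solution f y" "y s = x s"
    "\<And>t. 1 - x s \<bullet> x s + y t \<bullet> y t > 0"
    "\<And>t. x t = (1 / sqrt (1 - x s \<bullet> x s + y t \<bullet> y t)) *\<^sub>R y t"
proof -
  have sol: "solution (disk_field f) x" using assms(2) by (simp add: disk_solution_def)
  have dx: "(x has_vector_derivative f (x t) - (x t \<bullet> f (x t)) *\<^sub>R x t) (at t)" for t
    using sol by (simp add: solution_def disk_field_def)
  define g where "g t = x t \<bullet> f (x t)" for t
  have cx: "continuous_on UNIV x"
    using dx by (meson continuous_at_imp_continuous_on has_vector_derivative_continuous)
  then have "continuous_on UNIV (f \<circ> x)"
    by (rule continuous_on_compose) (use assms(1) linear_continuous_on linear_conv_bounded_linear in blast)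
  then have cg: "continuous_on UNIV g"
    unfolding g_def using cx by (auto intro!: continuous_intros simp: o_def)
  obtain G0 where G0: "\<And>t. (G0 has_vector_derivative g t) (at t)"
    using einterval_antiderivative[of "-\<infinity>" "\<infinity>" g] cg
    by (auto simp: continuous_on_eq_continuous_at)
  define m where "m t = exp (G0 t - G0 s)" for t
  have dm: "(m has_real_derivative g t * m t) (at t)" for t
    unfolding m_def using G0[of t, unfolded has_real_derivative_iff_has_vector_derivative[symmetric]]
    by (auto intro!: derivative_eq_intros)
  have mpos: "m t > 0" and ms: "m s = 1" for t by (simp_all add: m_def)
  define y where "y t = m t *\<^sub>R x t" for t
  have "solution f y"
    unfolding solution_def
  proof
    fix t
    have "(y has_vector_derivative m t *\<^sub>R (f (x t) - g t *\<^sub>R x t) + (g t * m t) *\<^sub>R x t) (at t)"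
      unfolding y_def using dm[of t] dx[of t] by (auto intro!: derivative_eq_intros simp: g_def)
    then show "(y has_vector_derivative f (y t)) (at t)"
      by (simp add: y_def linear_scale[OF assms(1)] algebra_simps)
  qed
  have "((\<lambda>t. (m t)\<^sup>2 * (1 - x t \<bullet> x t)) has_real_derivative 0) (at t)" for t
  proof -
    have "((\<lambda>t. x t \<bullet> x t) has_real_derivative 2 * (g t * (1 - x t \<bullet> x t))) (at t)"
      using solution_inner_derivative[OF sol, of t]
      by (simp add: disk_field_def inner_diff_right g_def algebra_simps)
    then show ?thesis
      using dm[of t] by (auto intro!: derivative_eq_intros simp: power2_eq_square algebra_simps)
  qed
  then have "(m t)\<^sup>2 * (1 - x t \<bullet> x t) = (m s)\<^sup>2 * (1 - x s \<bullet> x s)" for t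
    by (intro DERIV_isconst_all) auto
  then have eq: "1 - x s \<bullet> x s + y t \<bullet> y t = (m t)\<^sup>2" for t
    by (simp add: y_def ms power2_eq_square algebra_simps)
  show thesis
  proof (rule that[of y])
    show "solution f y" by fact
    show "y s = x s" by (simp add: y_def ms)
    show "1 - x s \<bullet> x s + y t \<bullet> y t > 0" for t using mpos[of t] by (simp add: eq)
    show "x t = (1 / sqrt (1 - x s \<bullet> x s + y t \<bullet> y t)) *\<^sub>R y t" for t
      using mpos[of t] unfolding eq by (simp add: y_def)
  qed
qed

lemma disk_solution_unique:
  assumes "linear f" "disk_solution f x" "disk_solution f y" "x s = y s"
  shows "x t = y t"
proof -
  obtain X where X: "solution f X" "X s = x s"
    "\<And>t. x t = (1 / sqrt (1 - x s \<bullet> x s + X t \<bullet> X t)) *\<^sub>R X t"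
    using disk_lift[OF assms(1,2), of s] by metis
  obtain Y where Y: "solution f Y" "Y s = y s"
    "\<And>t. y t = (1 / sqrt (1 - y s \<bullet> y s + Y t \<bullet> Y t)) *\<^sub>R Y t"
    using disk_lift[OF assms(1,3), of s] by metis
  have "X t = Y t" using solution_unique[OF assms(1) X(1) Y(1), of s t] X(2) Y(2) assms(4) by simp
  then show ?thesis using X(3)[of t] Y(3)[of t] assms(4) by simp
qed

lemma mem_disk_iff: "u \<in> cball 0 1 \<longleftrightarrow> u \<bullet> u \<le> 1" "u \<in> ball 0 1 \<longleftrightarrow> u \<bullet> u < 1"
  "u \<in> sphere 0 1 \<longleftrightarrow> u \<bullet> u = 1" for u :: "real^2"
  by (simp_all add: norm_eq_sqrt_inner)
  
lemma disk_solution_formula: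
  assumes "linear f" "v \<in> cball 0 1" "solution f y" "y s = v"
  shows "1 - v \<bullet> v + y t \<bullet> y t > 0"
    "disk_solution f (\<lambda>t. (1 / sqrt (1 - v \<bullet> v + y t \<bullet> y t)) *\<^sub>R y t)"
    "(1 / sqrt (1 - v \<bullet> v + y s \<bullet> y s)) *\<^sub>R y s = v"
proof -
  have v: "v \<bullet> v \<le> 1" using assms(2) mem_disk_iff(1) by blast
  have pos: "1 - v \<bullet> v + y t \<bullet> y t > 0" for t
  proof (cases "y t = 0")
    case True
    then have "v = 0" using solution_zero[OF assms(1,3), of t s] assms(4) by simp
    then show ?thesis by (simp add: add_pos_nonneg)
  next
    case False
    then have "y t \<bullet> y t > 0" by simp
    then show ?thesis using v by linarith
  qed
  show "1 - v \<bullet> v + y t \<bullet> y t > 0" by (rule pos)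
  show "disk_solution f (\<lambda>t. (1 / sqrt (1 - v \<bullet> v + y t \<bullet> y t)) *\<^sub>R y t)"
    using disk_solution_of_linear[OF assms(1,3) _ pos] v by simp
  show "(1 / sqrt (1 - v \<bullet> v + y s \<bullet> y s)) *\<^sub>R y s = v" using assms(4) by simp
qed

lemma disk_solution_exists:
  assumes "linear f" "v \<in> cball 0 1" obtains x where "disk_solution f x" "x s = v"
proof -
  obtain y where y: "solution f y" "y s = v" using solution_exists[OF assms(1)] .
  show thesis using disk_solution_formula(2,3)[OF assms y] by (rule that)
qed

lemma disk_solution_shift:
  assumes "disk_solution f x" shows "disk_solution f (\<lambda>t. x (t + s))"
  using assms solution_shift[of "disk_field f" x s] by (auto simp: disk_solution_def)

lemma disk_solution_uminus:
  assumes "disk_solution f x" shows "disk_solution (\<lambda>p. - f p) (\<lambda>t. x (- t))"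
proof -
  have "disk_field (\<lambda>p. - f p) = (\<lambda>p. - disk_field f p)" by (auto simp: disk_field_def)
  then show ?thesis using assms solution_uminus[of "disk_field f" x] by (auto simp: disk_solution_def)
qed

lemma disk_solution_mem: "disk_solution f x \<Longrightarrow> x t \<in> cball 0 1"
  by (simp add: disk_solution_def image_subset_iff)

section \<open>Equality of phase portraits is an equivalence relation on linear fields\<close>

text \<open>The sign \<open>e\<close> treats orientation preserving and reversing equivalences at once: \<open>e = 1\<close> is the
former, \<open>e = - 1\<close> the latter.\<close>

definition carries_orbits :: "real \<Rightarrow> (real^2 \<Rightarrow> real^2) \<Rightarrow> vf \<Rightarrow> vf \<Rightarrow> bool" where
  "carries_orbits e h f g \<longleftrightarrow>
     (\<forall>x. disk_solution f x \<longrightarrow>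
        (\<exists>y \<tau>. disk_solution g y \<and> strict_mono (\<lambda>t. e * \<tau> t) \<and> surj \<tau> \<and> (\<forall>t. h (x t) = y (\<tau> t))))"

lemma strict_antimono_iff: "strict_antimono_on UNIV \<tau> \<longleftrightarrow> strict_mono (\<lambda>t. - 1 * \<tau> t)"
  for \<tau> :: "real \<Rightarrow> real"
  by (auto simp: strict_mono_def monotone_on_def)

lemma same_portrait_iff:
  "same_portrait f g \<longleftrightarrow> (\<exists>h k e. homeomorphism (cball 0 1) (cball 0 1) h k \<and>
     h ` sphere 0 1 = sphere 0 1 \<and> (e = 1 \<or> e = -1) \<and> carries_orbits e h f g)"
proof -
  have "carries_orbits_preserving h f g \<longleftrightarrow> carries_orbits 1 h f g" for h
    by (simp add: carries_orbits_preserving_def carries_orbits_def)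
  moreover have "carries_orbits_reversing h f g \<longleftrightarrow> carries_orbits (-1) h f g" for h
    by (simp add: carries_orbits_reversing_def carries_orbits_def strict_antimono_iff)
  ultimately show ?thesis unfolding same_portrait_def by blast
qed

lemma same_portraitI:
  assumes "homeomorphism (cball 0 1) (cball 0 1) h k" "h ` sphere 0 1 = sphere 0 1"
    "e = 1 \<or> e = -1" "carries_orbits e h f g"
  shows "same_portrait f g"
  using assms same_portrait_iff by blast

lemma same_portrait_refl: "same_portrait f f"
proof (rule same_portraitI[of id id 1])
  show "homeomorphism (cball 0 1) (cball 0 1) id id" by (rule homeomorphism_ident[unfolded id_def[symmetric]])
  show "carries_orbits 1 id f f"
    unfolding carries_orbits_def
    by (intro allI impI exI[of _ "\<lambda>t::real. t"] exI conjI) (auto simp: strict_mono_def)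
qed auto

lemma strict_mono_sign_less_iff:
  assumes "e = 1 \<or> e = (-1::real)" "strict_mono (\<lambda>t::real. e * \<tau> t :: real)"
  shows "\<tau> s < \<tau> t \<longleftrightarrow> e * s < e * t"
  using assms(1) strict_mono_less[OF assms(2), of s t] strict_mono_less[OF assms(2), of t s] by auto

lemma strict_mono_signI:
  assumes "e = 1 \<or> e = (-1::real)" "\<And>s t. e * s < e * t \<Longrightarrow> \<tau> s < \<tau> t"
  shows "strict_mono (\<lambda>t::real. e * \<tau> t :: real)"
  using assms by (auto simp: strict_mono_def)

lemma carries_orbits_compose:
  assumes e: "e = 1 \<or> e = -1" "e' = 1 \<or> e' = -1"
    and h: "carries_orbits e h f g" and h': "carries_orbits e' h' g l"
  shows "carries_orbits (e * e') (h' \<circ> h) f l"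
  unfolding carries_orbits_def
proof (intro allI impI)
  fix x assume "disk_solution f x"
  then obtain y \<tau> where y: "disk_solution g y" "strict_mono (\<lambda>t. e * \<tau> t)" "surj \<tau>" "\<And>t. h (x t) = y (\<tau> t)"
    using h unfolding carries_orbits_def by metis
  obtain z \<tau>' where z: "disk_solution l z" "strict_mono (\<lambda>t. e' * \<tau>' t)" "surj \<tau>'" "\<And>t. h' (y t) = z (\<tau>' t)"
    using h' y(1) unfolding carries_orbits_def by metis
  have "strict_mono (\<lambda>t. (e * e') * (\<tau>' \<circ> \<tau>) t)"
    using e strict_mono_sign_less_iff[OF e(1) y(2)] strict_mono_sign_less_iff[OF e(2) z(2)]
    by (intro strict_mono_signI) auto
  moreover have "surj (\<tau>' \<circ> \<tau>)" using y(3) z(3) by (rule comp_surj)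
  ultimately show "\<exists>z \<tau>. disk_solution l z \<and> strict_mono (\<lambda>t. e * e' * \<tau> t) \<and> surj \<tau> \<and>
      (\<forall>t. (h' \<circ> h) (x t) = z (\<tau> t))"
    using z(1) y(4) z(4) by (intro exI[of _ z] exI[of _ "\<tau>' \<circ> \<tau>"]) simp
qed

lemma same_portrait_trans:
  assumes "same_portrait f g" "same_portrait g l" shows "same_portrait f l"
proof -
  obtain h k e where 1: "homeomorphism (cball 0 1) (cball 0 1) h k" "h ` sphere 0 1 = sphere 0 1"
     "e = 1 \<or> e = -1" "carries_orbits e h f g" using assms(1) unfolding same_portrait_iff by metis
  obtain h' k' e' where 2: "homeomorphism (cball 0 1) (cball 0 1) h' k'" "h' ` sphere 0 1 = sphere 0 1"
     "e' = 1 \<or> e' = -1" "carries_orbits e' h' g l" using assms(2) unfolding same_portrait_iff by metis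
  show ?thesis
  proof (rule same_portraitI)
    show "homeomorphism (cball 0 1) (cball 0 1) (h' \<circ> h) (k \<circ> k')"
      using 1(1) 2(1) by (rule homeomorphism_compose)
    show "(h' \<circ> h) ` sphere 0 1 = sphere 0 1" using 1(2) 2(2) by (simp only: image_comp[symmetric])
    show "e * e' = 1 \<or> e * e' = -1" using 1(3) 2(3) by auto
    show "carries_orbits (e * e') (h' \<circ> h) f l" by (rule carries_orbits_compose[OF 1(3) 2(3) 1(4) 2(4)])
  qed
qed

text \<open>An equivalence carries each orbit into an orbit by definition. Uniqueness of solutions of the
target shows that every orbit of the target is reached with its full parametrisation, so that the inverse is an equivalence as well.\<close>

lemma carries_orbits_inverse:
  assumes "linear f" "linear g" "homeomorphism (cball 0 1) (cball 0 1) h k"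
    and e: "e = 1 \<or> e = -1" and car: "carries_orbits e h f g"
  shows "carries_orbits e k g f"
  unfolding carries_orbits_def
proof (intro allI impI)
  fix y assume y: "disk_solution g y"
  have "k (y 0) \<in> cball 0 1"
    using disk_solution_mem[OF y, of 0] homeomorphism_image2[OF assms(3)] by blast
  then obtain x where x: "disk_solution f x" "x 0 = k (y 0)" using disk_solution_exists[OF assms(1)] by metis
  obtain y' \<tau> where y': "disk_solution g y'" "strict_mono (\<lambda>t. e * \<tau> t)" "surj \<tau>" "\<And>t. h (x t) = y' (\<tau> t)"
    using car x(1) unfolding carries_orbits_def by metis
  have "y' (0 + \<tau> 0) = y 0"
    using y'(4)[of 0] x(2) homeomorphism_apply2[OF assms(3) disk_solution_mem[OF y, of 0]] by simp
  then have shift: "y' (s + \<tau> 0) = y s" for s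
    by (rule disk_solution_unique[OF assms(2) disk_solution_shift[OF y'(1)] y])
  define \<tau>' where "\<tau>' s = inv \<tau> (s + \<tau> 0)" for s
  have inv: "\<tau> (\<tau>' s) = s + \<tau> 0" for s using y'(3) by (simp add: \<tau>'_def surj_f_inv_f)
  note less = strict_mono_sign_less_iff[OF e y'(2)]
  have inj: "s = t" if "\<tau> s = \<tau> t" for s t
    using less[of s t] less[of t s] that e by (metis less_irrefl linorder_neqE_linordered_idom mult_minus1 mult_1 neg_less_iff_less)
  show "\<exists>x \<tau>. disk_solution f x \<and> strict_mono (\<lambda>t. e * \<tau> t) \<and> surj \<tau> \<and> (\<forall>t. k (y t) = x (\<tau> t))"
  proof (intro exI conjI allI)
    show "disk_solution f x" by fact
    show "strict_mono (\<lambda>t. e * \<tau>' t)"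
    proof (rule strict_monoI)
      fix s t :: real assume "s < t"
      then show "e * \<tau>' s < e * \<tau>' t" using less[of "\<tau>' s" "\<tau>' t"] by (simp add: inv)
    qed
    show "surj \<tau>'"
    proof (rule surjI)
      show "\<tau>' (\<tau> t - \<tau> 0) = t" for t by (rule inj) (simp add: inv)
    qed
    show "k (y t) = x (\<tau>' t)" for t
    proof -
      have "h (x (\<tau>' t)) = y t" using y'(4)[of "\<tau>' t"] by (simp add: inv shift)
      then show ?thesis
        using homeomorphism_apply1[OF assms(3) disk_solution_mem[OF x(1), of "\<tau>' t"]] by simp
    qed
  qed
qed

lemma homeomorphism_sphere_inverse:
  assumes "homeomorphism (cball 0 1) (cball 0 1) h k" "h ` sphere 0 1 = sphere (0::real^2) 1"
  shows "k ` sphere 0 1 = sphere 0 1"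
proof -
  have "k (h u) = u" if "u \<in> sphere 0 1" for u
    using homeomorphism_apply1[OF assms(1)] that sphere_cball by blast
  then have "(\<lambda>u. k (h u)) ` sphere 0 1 = (\<lambda>u. u) ` sphere 0 1" by (intro image_cong) auto
  then have "k ` (h ` sphere 0 1) = sphere 0 1" by (simp only: image_image image_ident)
  then show ?thesis by (simp add: assms(2))
qed

lemma same_portrait_sym:
  assumes "linear f" "linear g" "same_portrait f g" shows "same_portrait g f"
proof -
  obtain h k e where 1: "homeomorphism (cball 0 1) (cball 0 1) h k" "h ` sphere 0 1 = sphere 0 1"
     "e = 1 \<or> e = -1" "carries_orbits e h f g" using assms(3) unfolding same_portrait_iff by metis
  show ?thesis
    by (rule same_portraitI[OF homeomorphism_symD[OF 1(1)] homeomorphism_sphere_inverse[OF 1(1,2)] 1(3)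
         carries_orbits_inverse[OF assms(1,2) 1(1,3,4)]])
qed

lemma same_portrait_uminus: "same_portrait f (\<lambda>p. - f p)"
proof (rule same_portraitI[of id id "-1"])
  show "homeomorphism (cball 0 1) (cball 0 1) id id" by (rule homeomorphism_ident[unfolded id_def[symmetric]])
  show "carries_orbits (-1) id f (\<lambda>p. - f p)"
    unfolding carries_orbits_def
  proof (intro allI impI)
    fix x assume "disk_solution f x"
    moreover have "surj (\<lambda>t::real. - t)" by (rule surjI[of _ "\<lambda>t. - t"]) simp
    ultimately show "\<exists>y \<tau>. disk_solution (\<lambda>p. - f p) y \<and> strict_mono (\<lambda>t. - 1 * \<tau> t) \<and> surj \<tau> \<and> (\<forall>t. id (x t) = y (\<tau> t))"
      using disk_solution_uminus[of f x]
      by (intro exI[of _ "\<lambda>t. x (- t)"] exI[of _ "\<lambda>t::real. - t"]) (auto simp: strict_mono_def)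
  qed
qed auto

section \<open>Linear conjugacy\<close>

text \<open>On the upper half sphere \<open>(u, z)\<close> with \<open>z = sqrt (1 - |u|^2)\<close>, the linear map \<open>(u, z) \<mapsto> (S u, z)\<close>
followed by normalisation; \<open>u\<close> is the coordinate of the disk.\<close>

definition projective_action :: "vf \<Rightarrow> vf" where
  "projective_action S u = (1 / sqrt (1 - u \<bullet> u + S u \<bullet> S u)) *\<^sub>R S u"

lemma projective_action_eq:
  assumes "linear S" "c + y \<bullet> y > 0"
  shows "projective_action S ((1 / sqrt (c + y \<bullet> y)) *\<^sub>R y) = (1 / sqrt (c + S y \<bullet> S y)) *\<^sub>R S y"
proof -
  define n where "n = sqrt (c + y \<bullet> y)"
  have n: "n > 0" "n\<^sup>2 = c + y \<bullet> y" using assms(2) by (simp_all add: n_def)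
  have "1 - ((1/n) *\<^sub>R y) \<bullet> ((1/n) *\<^sub>R y) + S ((1/n) *\<^sub>R y) \<bullet> S ((1/n) *\<^sub>R y) = (n\<^sup>2 - y \<bullet> y + S y \<bullet> S y) / n\<^sup>2"
    using n(1) by (simp add: linear_scale[OF assms(1)] field_simps power2_eq_square)
  also have "\<dots> = (c + S y \<bullet> S y) / n\<^sup>2" using n(2) by simp
  finally have eq: "1 - ((1/n) *\<^sub>R y) \<bullet> ((1/n) *\<^sub>R y) + S ((1/n) *\<^sub>R y) \<bullet> S ((1/n) *\<^sub>R y) = (c + S y \<bullet> S y) / n\<^sup>2" .
  have "sqrt (1 - ((1/n) *\<^sub>R y) \<bullet> ((1/n) *\<^sub>R y) + S ((1/n) *\<^sub>R y) \<bullet> S ((1/n) *\<^sub>R y)) = sqrt (c + S y \<bullet> S y) / n"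
    unfolding eq using n(1) by (simp add: real_sqrt_divide)
  then show ?thesis
    unfolding projective_action_def n_def[symmetric] using n by (simp add: linear_scale[OF assms(1)])
qed

lemma projective_action_mem:
  assumes "u \<in> cball 0 1" shows "projective_action S u \<in> cball 0 1"
proof -
  have "norm (S u) \<le> sqrt (1 - u \<bullet> u + S u \<bullet> S u)"
    using assms unfolding mem_disk_iff by (simp add: norm_eq_sqrt_inner)
  then show ?thesis
    by (cases "sqrt (1 - u \<bullet> u + S u \<bullet> S u) = 0") (auto simp: projective_action_def divide_le_eq)
qed

lemma projective_action_sphere:
  assumes "u \<in> sphere 0 1" "S u \<noteq> 0" shows "projective_action S u \<in> sphere 0 1"
  using assms unfolding mem_disk_iff by (simp add: projective_action_def)

lemma homeomorphism_projective_action: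
  assumes "linear S" "linear T" and inv: "\<And>u. T (S u) = u" "\<And>u. S (T u) = u"
  shows "homeomorphism (cball 0 1) (cball 0 1) (projective_action S) (projective_action T)"
    and "projective_action S ` sphere 0 1 = sphere 0 1"
proof -
  have pos: "1 - u \<bullet> u + S u \<bullet> S u > 0"
    if "u \<in> cball 0 1" "linear S" "linear T" "\<And>u. T (S u) = u" for S T :: vf and u
  proof (cases "u = 0")
    case False
    then have "S u \<noteq> 0" using that(4)[of u] linear_0[OF that(3)] by auto
    then have "S u \<bullet> S u > 0" by simp
    then show ?thesis using that(1) unfolding mem_disk_iff by linarith
  qed (use linear_0[OF that(2)] in auto)
  have cont: "continuous_on (cball 0 1) (projective_action S)"
    if "linear S" "linear T" "\<And>u. T (S u) = u" for S T :: vf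
  proof -
    have "continuous_on (cball 0 1) S" using that(1) linear_continuous_on linear_conv_bounded_linear by blast
    moreover have "1 - u \<bullet> u + S u \<bullet> S u \<noteq> 0" if "u \<in> cball 0 1" for u
      using pos[OF that \<open>linear S\<close> \<open>linear T\<close>] \<open>\<And>u. T (S u) = u\<close> by (metis less_irrefl)
    ultimately show ?thesis unfolding projective_action_def
      by (intro continuous_intros) auto
  qed
  have left: "projective_action T (projective_action S u) = u"
    if "u \<in> cball 0 1" "linear S" "linear T" "\<And>u. T (S u) = u" for S T :: vf and u
  proof -
    have "projective_action T (projective_action S u) =
       (1 / sqrt ((1 - u \<bullet> u) + T (S u) \<bullet> T (S u))) *\<^sub>R T (S u)"
      unfolding projective_action_def[of S]
      using pos[OF that] by (intro projective_action_eq) (use that in auto)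
    then show ?thesis using that(4) by simp
  qed
  show "homeomorphism (cball 0 1) (cball 0 1) (projective_action S) (projective_action T)"
    using cont[of S T] cont[of T S] left[of _ S T] left[of _ T S] assms projective_action_mem
    by (intro homeomorphismI) auto
  have sph: "projective_action S ` sphere 0 1 \<subseteq> sphere 0 1"
    if "linear S" "linear T" "\<And>u. T (S u) = u" for S T :: vf
  proof clarify
    fix u :: "real^2" assume u: "u \<in> sphere 0 1"
    then have "S u \<noteq> 0" using that(3)[of u] linear_0[OF that(2)] by auto
    then show "projective_action S u \<in> sphere 0 1" using projective_action_sphere u by blast
  qed
  show "projective_action S ` sphere 0 1 = sphere 0 1"
  proof
    show "projective_action S ` sphere 0 1 \<subseteq> sphere 0 1" using sph assms by metis
    show "sphere 0 1 \<subseteq> projective_action S ` sphere 0 1"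
    proof
      fix u :: "real^2" assume u: "u \<in> sphere 0 1"
      then have "projective_action T u \<in> sphere 0 1" using sph[of T S] assms by blast
      moreover have "projective_action S (projective_action T u) = u"
        using left[of u T S] u assms sphere_cball by blast
      ultimately show "u \<in> projective_action S ` sphere 0 1" by (metis image_eqI)
    qed
  qed
qed

lemma same_portrait_conjugate:
  assumes "linear f" "linear g" "linear S" "\<And>v. S v = 0 \<Longrightarrow> v = 0"
    and conj: "\<And>p. g (S p) = S (f p)"
  shows "same_portrait f g"
proof -
  have "inj S" using assms(3,4) linear_injective_0 by blast
  then obtain T where T: "linear T" "\<And>u. T (S u) = u" "\<And>u. S (T u) = u"
    using linear_injective_isomorphism[OF assms(3)] by auto
  show ?thesis
  proof (rule same_portraitI[of _ _ 1])
    show "carries_orbits 1 (projective_action S) f g"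
      unfolding carries_orbits_def
    proof (intro allI impI)
      fix x assume x: "disk_solution f x"
      obtain y where y: "solution f y" "y 0 = x 0" "\<And>t. 1 - x 0 \<bullet> x 0 + y t \<bullet> y t > 0"
        "\<And>t. x t = (1 / sqrt (1 - x 0 \<bullet> x 0 + y t \<bullet> y t)) *\<^sub>R y t"
        using disk_lift[OF assms(1) x, of 0] by metis
      define c where "c = 1 - x 0 \<bullet> x 0"
      have c: "c \<ge> 0" using disk_solution_mem[OF x, of 0] unfolding mem_disk_iff c_def by simp
      have "solution g (\<lambda>t. S (y t))"
        unfolding solution_def conj
        using y(1) bounded_linear.has_vector_derivative[of S] assms(3)
        unfolding solution_def linear_conv_bounded_linear by blast
      moreover have "c + S (y t) \<bullet> S (y t) > 0" for t
      proof (cases "y t = 0")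
        case False
        then have "S (y t) \<bullet> S (y t) > 0" using assms(4) by auto
        then show ?thesis using c by linarith
      qed (use y(3)[of t] linear_0[OF assms(3)] c_def in auto)
      ultimately have "disk_solution g (\<lambda>t. (1 / sqrt (c + S (y t) \<bullet> S (y t))) *\<^sub>R S (y t))"
        using disk_solution_of_linear[OF assms(2) _ c] by blast
      moreover have "projective_action S (x t) = (1 / sqrt (c + S (y t) \<bullet> S (y t))) *\<^sub>R S (y t)" for t
        unfolding y(4)[of t] c_def by (rule projective_action_eq[OF assms(3) y(3)])
      ultimately show "\<exists>y \<tau>. disk_solution g y \<and> strict_mono (\<lambda>t. 1 * \<tau> t) \<and> surj \<tau> \<and>
          (\<forall>t. projective_action S (x t) = y (\<tau> t))"
        by (intro exI[of _ "\<lambda>t::real. t"] exI conjI) (auto simp: strict_mono_def)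
    qed
  qed (use homeomorphism_projective_action[OF assms(3) T] in auto)
qed

section \<open>Flows on the triangle\<close>

text \<open>A weighted geometric mean. For \<open>0 < b < 1\<close> it is continuous for nonnegative \<open>p\<close>, \<open>q\<close> and vanishes
exactly where one of them does.\<close>

definition weight :: "real \<Rightarrow> real \<Rightarrow> real \<Rightarrow> real" where
  "weight b p q = p powr b * q powr (1 - b)"

definition simplex3 :: "real \<Rightarrow> real \<Rightarrow> real \<Rightarrow> bool" where
  "simplex3 p q m \<longleftrightarrow> 0 \<le> p \<and> 0 \<le> q \<and> 0 \<le> m \<and> p + q + m = 1"

text \<open>Points of two triangles correspond if they have equal \<open>q - p\<close> and equal labels
\<open>weight b p q / m\<close>. The quotients are multiplied out so that the relation is closed and makes
sense on the whole boundary.\<close>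

definition matched :: "real \<Rightarrow> real \<Rightarrow> real \<Rightarrow> real \<Rightarrow> real \<Rightarrow> real \<Rightarrow> real \<Rightarrow> real \<Rightarrow> bool" where
  "matched b b' p q m p' q' m' \<longleftrightarrow> simplex3 p q m \<and> simplex3 p' q' m' \<and> q - p = q' - p' \<and>
     weight b p q * m' = weight b' p' q' * m"

lemma weight_nonneg [simp]: "0 \<le> weight b p q"
  by (simp add: weight_def)

lemma weight_eq_0_iff: "weight b p q = 0 \<longleftrightarrow> p = 0 \<or> q = 0"
  by (simp add: weight_def)

lemma weight_strict_mono:
  assumes "0 < b" "b < 1" "0 \<le> p" "p < p'" "0 \<le> q" "q < q'"
  shows "weight b p q < weight b p' q'"
  unfolding weight_def using assms by (intro mult_strict_mono') (auto intro: powr_less_mono2)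

lemma continuous_on_weight:
  assumes "0 < b" "b < 1" "continuous_on S f" "continuous_on S g"
    "\<And>x. x \<in> S \<Longrightarrow> 0 \<le> f x" "\<And>x. x \<in> S \<Longrightarrow> 0 \<le> g x"
  shows "continuous_on S (\<lambda>x. weight b (f x) (g x))"
  unfolding weight_def using assms
  by (intro continuous_on_mult continuous_on_powr' continuous_on_const) auto

lemma weight_flow:
  assumes "k > 0" "p \<ge> 0" "q \<ge> 0"
  shows "weight b (k * exp (l * t) * p) (k * exp (h * t) * q) = k * exp ((b * l + (1 - b) * h) * t) * weight b p q"
proof -
  have "k powr b * k powr (1 - b) = k" using assms(1) by (simp flip: powr_add)
  moreover have "exp (l * t) powr b * exp (h * t) powr (1 - b) = exp ((b * l + (1 - b) * h) * t)"
    by (simp add: exp_powr_real algebra_simps flip: exp_add)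
  moreover have "weight b (k * exp (l * t) * p) (k * exp (h * t) * q) =
     (k powr b * k powr (1 - b)) * (exp (l * t) powr b * exp (h * t) powr (1 - b)) * weight b p q"
    using assms by (simp add: weight_def powr_mult)
  ultimately show ?thesis by simp
qed

lemma matched_sym: "matched b b' p q m p' q' m' \<Longrightarrow> matched b' b p' q' m' p q m"
  by (auto simp: matched_def)

text \<open>On a segment where \<open>q' - p'\<close> is constant, the label falls from \<open>\<infinity>\<close> to 0 as \<open>m'\<close> grows from 0 to its
largest value, so every label is attained.\<close>

lemma matched_exists:
  assumes "0 < b'" "b' < 1" and s: "simplex3 p q m"
  obtains p' q' m' where "matched b b' p q m p' q' m'"
proof -
  define d where "d = q - p"
  define P Q where "P x = (1 - x - d) / 2" and "Q x = (1 - x + d) / 2" for x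
  \<comment> \<open>\<open>(P x, Q x, x)\<close> runs through the points of the triangle whose second coordinate exceeds the first by \<open>d\<close>;
    a zero of \<open>F\<close> is a partner.\<close>
  define F where "F x = weight b p q * x - weight b' (P x) (Q x) * m" for x
  have nn: "0 \<le> P x" "0 \<le> Q x" if "x \<in> {0..1 - \<bar>d\<bar>}" for x using that by (auto simp: P_def Q_def)
  have s': "0 \<le> m" "0 \<le> 1 - \<bar>d\<bar>" using s by (auto simp: simplex3_def d_def)
  have "\<exists>x\<ge>0. x \<le> 1 - \<bar>d\<bar> \<and> F x = 0"
  proof (rule IVT')
    show "F 0 \<le> 0" using s' by (simp add: F_def)
    have "P (1 - \<bar>d\<bar>) = 0 \<or> Q (1 - \<bar>d\<bar>) = 0" by (auto simp: P_def Q_def abs_if)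
    then have "weight b' (P (1 - \<bar>d\<bar>)) (Q (1 - \<bar>d\<bar>)) = 0" by (simp add: weight_eq_0_iff)
    then show "0 \<le> F (1 - \<bar>d\<bar>)" using s' by (simp add: F_def)
    show "continuous_on {0..1 - \<bar>d\<bar>} F"
      unfolding F_def using nn
      by (intro continuous_intros continuous_on_weight[OF assms(1,2)]) (auto simp: P_def Q_def intro!: continuous_intros)
  qed (use s' in auto)
  then obtain x where x: "0 \<le> x" "x \<le> 1 - \<bar>d\<bar>" "F x = 0" by blast
  show thesis
  proof (rule that[of "P x" "Q x" x])
    have "P x + Q x + x = 1" "Q x - P x = d" by (simp_all add: P_def Q_def field_simps)
    then show "matched b b' p q m (P x) (Q x) x"
      using x nn[of x] s by (auto simp: matched_def simplex3_def F_def d_def)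
  qed
qed

text \<open>If \<open>p\<close> shrinks at fixed \<open>q - p\<close>, then \<open>q\<close> shrinks and \<open>m\<close> grows, so the label falls strictly. The only exception would
be a point with \<open>weight b p q = m = 0\<close>, which is a vertex where nothing can move.\<close>

lemma matched_not_less:
  assumes b: "0 < b'" "b' < 1"
    and 1: "matched b b' p q m p' q' m'" and 2: "matched b b' p q m p'' q'' m''"
  shows "\<not> p'' < p'"
proof
  assume "p'' < p'"
  then have less: "p'' < p'" "q'' < q'" "m' < m''" using 1 2 by (auto simp: matched_def simplex3_def)
  have s: "simplex3 p q m" "simplex3 p' q' m'" "simplex3 p'' q'' m''" using 1 2 by (auto simp: matched_def)
  have W: "weight b' p'' q'' < weight b' p' q'"
    using s less b by (intro weight_strict_mono) (auto simp: simplex3_def)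
  have e: "weight b p q * m' = weight b' p' q' * m" "weight b p q * m'' = weight b' p'' q'' * m"
    using 1 2 by (auto simp: matched_def)
  have "weight b p q * m' \<le> weight b p q * m''" using less by (intro mult_left_mono) auto
  moreover have "weight b' p'' q'' * m \<le> weight b' p' q' * m"
    using W s by (intro mult_right_mono) (auto simp: simplex3_def)
  ultimately have "weight b p q * m' = weight b p q * m''" "weight b' p'' q'' * m = weight b' p' q' * m"
    using e by auto
  then have "weight b p q = 0" "m = 0" using less W by auto
  then have "p = 0 \<and> q = 1 \<or> p = 1 \<and> q = 0" using s by (auto simp: weight_eq_0_iff simplex3_def)
  then show False using 1 2 less by (auto simp: matched_def simplex3_def)
qed

lemma matched_unique:
  assumes "0 < b'" "b' < 1" "matched b b' p q m p' q' m'" "matched b b' p q m p'' q'' m''"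
  shows "p' = p'' \<and> q' = q'' \<and> m' = m''"
proof -
  have "p' = p''"
    using matched_not_less[OF assms(1-4)] matched_not_less[OF assms(1,2,4,3)] by simp
  then show ?thesis using assms(3,4) by (auto simp: matched_def simplex3_def)
qed

text \<open>The correspondence is the identity on the boundary of the triangle; hence the maps built from it on the four quadrants
of the disk agree on common sides.\<close>

lemma matched_face:
  assumes "0 < b'" "b' < 1" "matched b b' p q m p' q' m'" "p = 0 \<or> q = 0 \<or> m = 0"
  shows "p' = p \<and> q' = q \<and> m' = m"
proof -
  have "matched b b' p q m p q m"
    using assms(3,4) by (auto simp: matched_def weight_eq_0_iff) (auto simp: weight_def)
  from matched_unique[OF assms(1-3) this] show ?thesis by auto
qed

lemma matched_zero_iff:
  assumes "0 < b" "b < 1" "0 < b'" "b' < 1" "matched b b' p q m p' q' m'"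
  shows "p' = 0 \<longleftrightarrow> p = 0" "q' = 0 \<longleftrightarrow> q = 0" "m' = 0 \<longleftrightarrow> m = 0"
proof -
  note f = matched_face[OF assms(3-5)] and f' = matched_face[OF assms(1,2) matched_sym[OF assms(5)]]
  show "p' = 0 \<longleftrightarrow> p = 0" "q' = 0 \<longleftrightarrow> q = 0" "m' = 0 \<longleftrightarrow> m = 0"
    using f f' by metis+
qed

text \<open>The flow multiplies \<open>p\<close>, \<open>m\<close>, \<open>q\<close> by factors \<open>A < B < C\<close> whose mean with the weights \<open>p\<close>, \<open>m\<close>, \<open>q\<close>
is 1. Unless the point is a vertex, this forces \<open>A < 1 < C\<close>.\<close>

lemma simplex_flow_monotone:
  assumes s: "simplex3 p q m" "simplex3 p' q' m'" and k: "k > 0" and r: "r > 0" "l < n" "n < h"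
    and e: "p' = k * exp (l * r) * p" "q' = k * exp (h * r) * q" "m' = k * exp (n * r) * m"
    and nv: "\<not> (p = 0 \<and> q = 0)" "\<not> (p = 0 \<and> m = 0)" "\<not> (q = 0 \<and> m = 0)"
  shows "q - p < q' - p'"
proof -
  define A B C where "A = k * exp (l * r)" "B = k * exp (n * r)" "C = k * exp (h * r)"
  have ABC: "A < B" "B < C" using k r by (auto simp: A_B_C_def)
  have pos: "0 \<le> p" "0 \<le> q" "0 \<le> m" and sum: "p + q + m = 1" "A * p + C * q + B * m = 1"
    using s by (auto simp: simplex3_def e A_B_C_def)
  have A: "A < 1"
  proof (rule ccontr)
    assume "\<not> A < 1"
    then have "p \<le> A * p" "q \<le> C * q" "m \<le> B * m" "q > 0 \<Longrightarrow> q < C * q" "m > 0 \<Longrightarrow> m < B * m"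
      using pos ABC by (auto simp: mult_le_cancel_right1)
    then show False using sum nv pos by linarith
  qed
  have C: "C > 1"
  proof (rule ccontr)
    assume "\<not> C > 1"
    then have "A * p \<le> p" "C * q \<le> q" "B * m \<le> m" "p > 0 \<Longrightarrow> A * p < p" "m > 0 \<Longrightarrow> B * m < m"
      using pos ABC by (auto simp: mult_le_cancel_right2)
    then show False using sum nv pos by linarith
  qed
  have "A * p \<le> p" "q \<le> C * q" "p > 0 \<Longrightarrow> A * p < p" "q > 0 \<Longrightarrow> q < C * q"
    using pos A C by (auto simp: mult_le_cancel_right1 mult_le_cancel_right2)
  then have "q - p < C * q - A * p" using nv(1) pos by linarith
  then show ?thesis by (simp add: e A_B_C_def)
qed

lemma flow_ratio:
  fixes u v :: real
  assumes "l < h" "u > 0" "v > 0" "u' > 0" "v' > 0"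
  obtains t k where "k > 0" "u' = k * exp (l * t) * u" "v' = k * exp (h * t) * v"
proof -
  \<comment> \<open>The quotient of the two coordinates grows with rate \<open>h - l\<close>.\<close>
  define t where "t = ln ((v' / v) / (u' / u)) / (h - l)"
  define k where "k = u' / (exp (l * t) * u)"
  have "(h - l) * t = ln ((v' / v) / (u' / u))" using assms(1) by (simp add: t_def)
  then have "exp ((h - l) * t) = (v' / v) / (u' / u)" using assms by simp
  then have "exp (h * t) = exp (l * t) * ((v' / v) / (u' / u))"
    by (simp add: exp_diff left_diff_distrib field_simps)
  then show thesis using assms by (intro that[of k t]) (auto simp: k_def)
qed

lemma convex_rate:
  assumes "l < (h::real)" "b = (h - n) / (h - l)" shows "b * l + (1 - b) * h = n"
proof -
  have "b * (h - l) = h - n" using assms by simp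
  then show ?thesis by (simp add: algebra_simps)
qed

text \<open>Points with the same zero coordinates and the same label lie on one orbit: two of the nonzero
coordinates determine the time, and the label takes care of the third one.\<close>

lemma simplex_orbit:
  assumes s: "simplex3 p q m" "simplex3 p' q' m'" and r: "l < n" "n < h"
    and b: "b = (h - n) / (h - l)"
    and z: "p' = 0 \<longleftrightarrow> p = 0" "q' = 0 \<longleftrightarrow> q = 0" "m' = 0 \<longleftrightarrow> m = 0"
    and w: "weight b p q * m' = weight b p' q' * m"
  obtains t k where "k > 0" "p' = k * exp (l * t) * p" "q' = k * exp (h * t) * q" "m' = k * exp (n * t) * m"
proof -
  have bn: "b * l + (1 - b) * h = n" using r b by (intro convex_rate) auto
  have pos: "0 \<le> p" "0 \<le> q" "0 \<le> m" "0 \<le> p'" "0 \<le> q'" "0 \<le> m'" using s by (auto simp: simplex3_def)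
  consider "p > 0" "q > 0" | "p = 0" "q > 0" "m > 0" | "p = 0" "q > 0" "m = 0"
    | "q = 0" "p > 0" "m > 0" | "q = 0" "p > 0" "m = 0" | "p = 0" "q = 0" using pos by linarith
  then show thesis
  proof cases
    case 1
    moreover have "p' > 0" "q' > 0" using z pos 1 by auto
    ultimately obtain k t where kt: "k > 0" "p' = k * exp (l * t) * p" "q' = k * exp (h * t) * q"
      using flow_ratio[of l h p q p' q'] r by (metis less_trans)
    have "weight b p' q' = k * exp (n * t) * weight b p q"
      using weight_flow[OF kt(1) pos(1,2), of b l t h] by (simp add: kt(2,3) bn)
    moreover have "weight b p q \<noteq> 0" using 1 by (simp add: weight_eq_0_iff)
    ultimately have "m' = k * exp (n * t) * m" using w by simp
    with kt show thesis by (rule that)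
  next
    case 2
    moreover have "q' > 0" "m' > 0" using z pos 2 by auto
    ultimately obtain k t where "k > 0" "m' = k * exp (n * t) * m" "q' = k * exp (h * t) * q"
      using flow_ratio[of n h m q m' q'] r by metis
    then show thesis using 2 z by (intro that[of k t]) auto
  next
    case 4
    moreover have "p' > 0" "m' > 0" using z pos 4 by auto
    ultimately obtain k t where "k > 0" "p' = k * exp (l * t) * p" "m' = k * exp (n * t) * m"
      using flow_ratio[of l n p m p' m'] r by metis
    then show thesis using 4 z by (intro that[of k t]) auto
  qed (use s z in \<open>auto intro!: that[of 1 0] simp: simplex3_def\<close>)
qed

section \<open>Saddles and nodes in diagonal form\<close>

text \<open>The squares of the homogeneous coordinates of a point of the disk; they add up to 1.\<close>

definition sq1 :: "real^2 \<Rightarrow> real" where "sq1 u = (u $ 1)\<^sup>2"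
definition sq2 :: "real^2 \<Rightarrow> real" where "sq2 u = (u $ 2)\<^sup>2"
definition sq0 :: "real^2 \<Rightarrow> real" where "sq0 u = 1 - (u $ 1)\<^sup>2 - (u $ 2)\<^sup>2"

text \<open>The assignment of the roles \<open>p\<close>, \<open>q\<close>, \<open>m\<close> to these squares: the first alternative serves
saddles, the second one nodes.\<close>

definition chart :: "(real^2 \<Rightarrow> real) \<Rightarrow> (real^2 \<Rightarrow> real) \<Rightarrow> (real^2 \<Rightarrow> real) \<Rightarrow> bool" where
  "chart P Q N \<longleftrightarrow> Q = sq2 \<and> (P = sq1 \<and> N = sq0 \<or> P = sq0 \<and> N = sq1)"

text \<open>The correspondence of triangles, lifted to the disk by keeping each point in its closed quadrant.\<close>

definition related :: "(real^2 \<Rightarrow> real) \<Rightarrow> (real^2 \<Rightarrow> real) \<Rightarrow> (real^2 \<Rightarrow> real) \<Rightarrow> real \<Rightarrow> real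
    \<Rightarrow> real^2 \<Rightarrow> real^2 \<Rightarrow> bool" where
  "related P Q N b b' u v \<longleftrightarrow> u \<in> cball 0 1 \<and> v \<in> cball 0 1 \<and> 0 \<le> u $ 1 * v $ 1 \<and> 0 \<le> u $ 2 * v $ 2 \<and>
     matched b b' (P u) (Q u) (N u) (P v) (Q v) (N v)"

lemma mem_cball_sq0: "u \<in> cball 0 1 \<longleftrightarrow> 0 \<le> sq0 u" "u \<in> sphere 0 1 \<longleftrightarrow> sq0 u = 0"
  unfolding mem_disk_iff by (auto simp: sq0_def inner2 power2_eq_square)

lemma chart_simplex: "chart P Q N \<Longrightarrow> u \<in> cball 0 1 \<Longrightarrow> simplex3 (P u) (Q u) (N u)"
  unfolding mem_cball_sq0 by (auto simp: chart_def simplex3_def) (auto simp: sq0_def sq1_def sq2_def)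

lemma related_sym: "related P Q N b b' u v \<Longrightarrow> related P Q N b' b v u"
  by (auto simp: related_def mult.commute matched_sym)

lemma related_exists:
  assumes "chart P Q N" "0 < b'" "b' < 1" "u \<in> cball 0 1"
  obtains v where "related P Q N b b' u v"
proof -
  obtain p q m where pqm: "matched b b' (P u) (Q u) (N u) p q m"
    using matched_exists[OF assms(2,3) chart_simplex[OF assms(1,4)]] by metis
  define s where "s x = (if x < 0 then -1 else 1 :: real)" for x :: real
  \<comment> \<open>\<open>x\<close> is the square of the first coordinate of the partner; the signs are copied from \<open>u\<close>.\<close>
  define x where "x = (if P = sq1 then p else m)"
  have sx: "0 \<le> x" "0 \<le> q" "simplex3 p q m" using pqm by (auto simp: matched_def simplex3_def x_def)
  define v :: "real^2" where "v = vector [s (u $ 1) * sqrt x, s (u $ 2) * sqrt q]"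
  have ne: "sq1 \<noteq> sq0"
  proof
    assume "sq1 = sq0" then have "sq1 0 = sq0 0" by simp then show False by (simp add: sq1_def sq0_def)
  qed
  have s2: "(s y)\<^sup>2 = 1" for y by (simp add: s_def)
  have "sq1 v = x" "sq2 v = q" using sx by (simp_all add: sq1_def sq2_def v_def power_mult_distrib s2)
  then have v: "P v = p" "Q v = q" "N v = m" "sq0 v \<ge> 0"
    using assms(1) sx ne by (auto simp: chart_def x_def simplex3_def sq0_def sq1_def sq2_def)
  have ss: "0 \<le> y * s y" for y by (simp add: s_def)
  have "0 \<le> u $ 1 * v $ 1" "0 \<le> u $ 2 * v $ 2"
    using sx ss[of "u $ 1"] ss[of "u $ 2"] by (simp_all add: v_def flip: mult.assoc)
  moreover have "v \<in> cball 0 1" using v(4) by (simp only: mem_cball_sq0)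
  ultimately have "related P Q N b b' u v"
    unfolding related_def v(1-3) using pqm assms(4) by blast
  then show thesis by (rule that)
qed

lemma eq_if_sq_eq:
  fixes u v w :: real
  assumes "v\<^sup>2 = w\<^sup>2" "0 \<le> u * v" "0 \<le> u * w" "u = 0 \<Longrightarrow> v = 0" shows "v = w"
  using assms by (auto simp: power2_eq_iff zero_le_mult_iff)

lemma related_zero_iff:
  fixes u v :: "real^2"
  assumes c: "chart P Q N" and b: "0 < b" "b < 1" "0 < b'" "b' < 1" and r: "related P Q N b b' u v"
  shows "u $ 1 = 0 \<longleftrightarrow> v $ 1 = 0" "u $ 2 = 0 \<longleftrightarrow> v $ 2 = 0" "u \<in> sphere 0 1 \<longleftrightarrow> v \<in> sphere 0 1"
proof -
  have "matched b b' (P u) (Q u) (N u) (P v) (Q v) (N v)" using r by (simp add: related_def)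
  note z = matched_zero_iff[OF b this]
  have "sq1 v = 0 \<longleftrightarrow> sq1 u = 0" "sq2 v = 0 \<longleftrightarrow> sq2 u = 0" "sq0 v = 0 \<longleftrightarrow> sq0 u = 0"
    using z c unfolding chart_def by auto
  then show "u $ 1 = 0 \<longleftrightarrow> v $ 1 = 0" "u $ 2 = 0 \<longleftrightarrow> v $ 2 = 0" "u \<in> sphere 0 1 \<longleftrightarrow> v \<in> sphere 0 1"
    unfolding mem_cball_sq0 sq1_def sq2_def by simp_all
qed

lemma related_unique:
  assumes c: "chart P Q N" and b: "0 < b" "b < 1" "0 < b'" "b' < 1"
    and r: "related P Q N b b' u v" "related P Q N b b' u w"
  shows "v = w"
proof -
  have "matched b b' (P u) (Q u) (N u) (P v) (Q v) (N v)" "matched b b' (P u) (Q u) (N u) (P w) (Q w) (N w)"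
    using r by (simp_all add: related_def)
  then have "P v = P w \<and> Q v = Q w \<and> N v = N w" by (rule matched_unique[OF b(3,4)])
  then have s: "(v $ 1)\<^sup>2 = (w $ 1)\<^sup>2" "(v $ 2)\<^sup>2 = (w $ 2)\<^sup>2"
    using c by (auto simp: chart_def sq1_def sq2_def sq0_def)
  have nn: "0 \<le> u $ 1 * v $ 1" "0 \<le> u $ 2 * v $ 2" "0 \<le> u $ 1 * w $ 1" "0 \<le> u $ 2 * w $ 2"
    using r by (auto simp: related_def)
  have z: "u $ 1 = 0 \<Longrightarrow> v $ 1 = 0" "u $ 2 = 0 \<Longrightarrow> v $ 2 = 0"
    using related_zero_iff(1,2)[OF c b r(1)] by simp_all
  show ?thesis
    unfolding vec2_eq_iff
    using eq_if_sq_eq[OF s(1) nn(1,3) z(1)] eq_if_sq_eq[OF s(2) nn(2,4) z(2)] by simp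
qed

text \<open>A map between compact sets with closed graph is continuous, so this replaces an estimate for the implicitly
defined map.\<close>

lemma closed_related:
  assumes c: "chart P Q N" and b: "0 < b" "b < 1" "0 < b'" "b' < 1"
  shows "closed {(u, v). related P Q N b b' u v}"
proof -
  let ?D = "cball (0::real^2) 1 \<times> cball (0::real^2) 1"
  have cl: "closed ?D" by (intro closed_Times closed_cball)
  have sqc: "continuous_on UNIV sq0" "continuous_on UNIV sq1" "continuous_on UNIV sq2"
    unfolding sq0_def sq1_def sq2_def by (intro continuous_intros)+
  then have cont: "continuous_on UNIV P" "continuous_on UNIV Q" "continuous_on UNIV N"
    using c by (auto simp: chart_def)
  have f: "continuous_on S (\<lambda>z. F (fst z))" "continuous_on S (\<lambda>z. F (snd z))"
    if "continuous_on UNIV F" for F :: "real^2 \<Rightarrow> real" and S :: "((real^2) \<times> (real^2)) set"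
    using that by (auto intro!: continuous_on_compose2[of UNIV F] continuous_intros)
  note cs = f[OF cont(1)] f[OF cont(2)] f[OF cont(3)]
  have nn: "0 \<le> P (fst z)" "0 \<le> Q (fst z)" "0 \<le> P (snd z)" "0 \<le> Q (snd z)" if "z \<in> ?D" for z
    using chart_simplex[OF c, of "fst z"] chart_simplex[OF c, of "snd z"] that
    by (auto simp: simplex3_def mem_Times_iff)
  have "closed {z \<in> ?D. 0 \<le> fst z $ 1 * snd z $ 1}" "closed {z \<in> ?D. 0 \<le> fst z $ 2 * snd z $ 2}"
    by (intro continuous_on_closed_Collect_le cl continuous_intros)+
  moreover have "closed {z \<in> ?D. Q (fst z) - P (fst z) - (Q (snd z) - P (snd z)) = 0}"
    by (intro continuous_closed_preimage_constant cl continuous_intros cs)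
  moreover have "closed {z \<in> ?D. weight b (P (fst z)) (Q (fst z)) * N (snd z) -
      weight b' (P (snd z)) (Q (snd z)) * N (fst z) = 0}"
    using nn by (intro continuous_closed_preimage_constant cl continuous_on_diff continuous_on_mult
        continuous_on_weight b cs)
  ultimately have "closed ({z \<in> ?D. 0 \<le> fst z $ 1 * snd z $ 1} \<inter> {z \<in> ?D. 0 \<le> fst z $ 2 * snd z $ 2} \<inter>
      {z \<in> ?D. Q (fst z) - P (fst z) - (Q (snd z) - P (snd z)) = 0} \<inter>
      {z \<in> ?D. weight b (P (fst z)) (Q (fst z)) * N (snd z) -
      weight b' (P (snd z)) (Q (snd z)) * N (fst z) = 0})"
    by (intro closed_Int)
  moreover have "{(u, v). related P Q N b b' u v} = ({z \<in> ?D. 0 \<le> fst z $ 1 * snd z $ 1} \<inter> {z \<in> ?D. 0 \<le> fst z $ 2 * snd z $ 2} \<inter>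
      {z \<in> ?D. Q (fst z) - P (fst z) - (Q (snd z) - P (snd z)) = 0} \<inter>
      {z \<in> ?D. weight b (P (fst z)) (Q (fst z)) * N (snd z) -
      weight b' (P (snd z)) (Q (snd z)) * N (fst z) = 0})"
    using chart_simplex[OF c] by (auto simp: related_def matched_def simp del: mem_cball)
  ultimately show ?thesis by simp
qed

definition related_map :: "(real^2 \<Rightarrow> real) \<Rightarrow> (real^2 \<Rightarrow> real) \<Rightarrow> (real^2 \<Rightarrow> real) \<Rightarrow> real \<Rightarrow> real
    \<Rightarrow> real^2 \<Rightarrow> real^2" where
  "related_map P Q N b b' u = (THE v. related P Q N b b' u v)"

lemma related_map:
  assumes c: "chart P Q N" and b: "0 < b" "b < 1" "0 < b'" "b' < 1" and u: "u \<in> cball 0 1"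
  shows "related P Q N b b' u (related_map P Q N b b' u)"
proof -
  obtain v where v: "related P Q N b b' u v" using related_exists[OF c b(3,4) u] .
  show ?thesis unfolding related_map_def
    using theI[of "related P Q N b b' u", OF v] related_unique[OF c b _ v] by blast
qed

lemma homeomorphism_related_map:
  assumes c: "chart P Q N" and b: "0 < b" "b < 1" "0 < b'" "b' < 1"
  shows "homeomorphism (cball 0 1) (cball 0 1) (related_map P Q N b b') (related_map P Q N b' b)"
    "related_map P Q N b b' ` sphere 0 1 = sphere 0 1"
proof -
  have mem: "related_map P Q N b b' u \<in> cball 0 1"
    if "0 < b" "b < 1" "0 < b'" "b' < 1" "u \<in> cball 0 1" for b b' u
    using related_map[OF c that] unfolding related_def by blast
  have cont: "continuous_on (cball 0 1) (related_map P Q N b b')"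
    if b: "0 < b" "b < 1" "0 < b'" "b' < 1" for b b'
  proof (rule continuous_from_closed_graph[OF compact_cball])
    show "related_map P Q N b b' \<in> cball 0 1 \<rightarrow> cball 0 1" using mem[OF b] by blast
    have "(\<lambda>u. (u, related_map P Q N b b' u)) ` cball 0 1 = {(u, v). related P Q N b b' u v}"
      using related_map[OF c b] related_unique[OF c b]
      by (auto simp: image_iff simp del: mem_cball) (auto simp: related_def)
    then show "closed ((\<lambda>u. (u, related_map P Q N b b' u)) ` cball 0 1)"
      using closed_related[OF c b] by simp
  qed
  have left: "related_map P Q N b' b (related_map P Q N b b' u) = u"
    if b: "0 < b" "b < 1" "0 < b'" "b' < 1" and u: "u \<in> cball 0 1" for b b' u
    by (rule related_unique[OF c b(3,4,1,2) related_map[OF c b(3,4,1,2) mem[OF b u]]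
          related_sym[OF related_map[OF c b u]]])
  show "homeomorphism (cball 0 1) (cball 0 1) (related_map P Q N b b') (related_map P Q N b' b)"
    using cont b left mem by (intro homeomorphismI) blast+
  have sub: "u \<in> sphere 0 1 \<longleftrightarrow> related_map P Q N b b' u \<in> sphere 0 1" 
    if b: "0 < b" "b < 1" "0 < b'" "b' < 1" and u: "u \<in> cball 0 1" for b b' u
    by (rule related_zero_iff(3)[OF c b related_map[OF c b u]])
  show "related_map P Q N b b' ` sphere 0 1 = sphere 0 1"
  proof
    show "related_map P Q N b b' ` sphere 0 1 \<subseteq> sphere 0 1"
      using sub[OF b] sphere_cball by blast
    show "sphere 0 1 \<subseteq> related_map P Q N b b' ` sphere 0 1"
    proof
      fix v :: "real^2" assume v: "v \<in> sphere 0 1"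
      then have v': "v \<in> cball 0 1" using sphere_cball by blast
      show "v \<in> related_map P Q N b b' ` sphere 0 1"
        using sub[OF b(3,4,1,2) v'] v left[OF b(3,4,1,2) v'] by (intro image_eqI[of _ _ "related_map P Q N b' b v"]) auto
    qed
  qed
qed

lemma diagonal_disk_solution:
  fixes x :: "real \<Rightarrow> real^2"
  assumes "disk_solution (lin2 a 0 0 d) x"
  obtains n where "\<And>t. n t > 0" "\<And>t. x t $ 1 = exp (a * t) * x 0 $ 1 / n t"
    "\<And>t. x t $ 2 = exp (d * t) * x 0 $ 2 / n t" "\<And>t. 1 - x t \<bullet> x t = (1 - x 0 \<bullet> x 0) / (n t)\<^sup>2"
proof -
  obtain y where y: "solution (lin2 a 0 0 d) y" "y 0 = x 0" "\<And>t. 1 - x 0 \<bullet> x 0 + y t \<bullet> y t > 0"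
    "\<And>t. x t = (1 / sqrt (1 - x 0 \<bullet> x 0 + y t \<bullet> y t)) *\<^sub>R y t"
    using disk_lift[OF linear_lin2 assms, of 0] by metis
  define z :: "real \<Rightarrow> real^2" where "z t = vector [exp (a * t) * x 0 $ 1, exp (d * t) * x 0 $ 2]" for t
  have "solution (lin2 a 0 0 d) z"
    unfolding solution_def has_vector_derivative_vec2_iff z_def by (auto intro!: derivative_eq_intros)
  then have "y t = z t" for t
    by (rule solution_unique[OF linear_lin2 y(1), of _ 0]) (simp add: y(2) z_def vec2_eq_iff)
  then have yt: "y t $ 1 = exp (a * t) * x 0 $ 1" "y t $ 2 = exp (d * t) * x 0 $ 2" for t
    by (simp_all add: z_def)
  define n where "n t = sqrt (1 - x 0 \<bullet> x 0 + y t \<bullet> y t)" for t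
  show thesis
  proof (rule that[of n])
    show n: "n t > 0" for t using y(3) by (simp add: n_def)
    have x: "x t = (1 / n t) *\<^sub>R y t" for t unfolding n_def by (rule y(4))
    have xt: "x t $ 1 = y t $ 1 / n t" "x t $ 2 = y t $ 2 / n t" for t
      by (simp_all add: x[of t])
    show "x t $ 1 = exp (a * t) * x 0 $ 1 / n t" "x t $ 2 = exp (d * t) * x 0 $ 2 / n t" for t
      by (simp_all only: xt[of t] yt[of t])
    have n2: "(n t)\<^sup>2 = 1 - x 0 \<bullet> x 0 + y t \<bullet> y t" for t using y(3)[of t] by (simp add: n_def)
    have "x t \<bullet> x t = (y t \<bullet> y t) / (n t)\<^sup>2" for t by (simp add: x[of t] power2_eq_square)
    then show "1 - x t \<bullet> x t = (1 - x 0 \<bullet> x 0) / (n t)\<^sup>2" for t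
      using n[of t] n2[of t] by (simp add: field_simps)
  qed
qed

text \<open>For the diagonal field with entries \<open>a\<close> and \<open>d\<close>, the squares evolve with the rates \<open>2 a\<close>, \<open>2 d\<close>
and 0 up to a common factor; \<open>l\<close>, \<open>n\<close>, \<open>h\<close> are the rates of \<open>P\<close>, \<open>N\<close>, \<open>Q\<close>.\<close>

definition adapted :: "real \<Rightarrow> real \<Rightarrow> (real^2 \<Rightarrow> real) \<Rightarrow> (real^2 \<Rightarrow> real) \<Rightarrow> (real^2 \<Rightarrow> real)
    \<Rightarrow> real \<Rightarrow> real \<Rightarrow> real \<Rightarrow> bool" where
  "adapted a d P Q N l h n \<longleftrightarrow> l < n \<and> n < h \<and> h = 2 * d \<and> Q = sq2 \<and>
     (P = sq1 \<and> N = sq0 \<and> l = 2 * a \<and> n = 0 \<or> P = sq0 \<and> N = sq1 \<and> l = 0 \<and> n = 2 * a)"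

lemma adapted_chart: "adapted a d P Q N l h n \<Longrightarrow> chart P Q N"
  by (auto simp: adapted_def chart_def)

lemma adapted_flow:
  fixes x :: "real \<Rightarrow> real^2"
  assumes ad: "adapted a d P Q N l h n" and x: "disk_solution (lin2 a 0 0 d) x"
  obtains k where "\<And>t. k t > 0" "\<And>t. P (x t) = k t * exp (l * t) * P (x 0)"
    "\<And>t. Q (x t) = k t * exp (h * t) * Q (x 0)" "\<And>t. N (x t) = k t * exp (n * t) * N (x 0)"
    "\<And>t. \<exists>r>0. x t $ 1 = r * x 0 $ 1" "\<And>t. \<exists>r>0. x t $ 2 = r * x 0 $ 2"
proof -
  obtain c where c: "\<And>t. c t > 0" "\<And>t. x t $ 1 = exp (a * t) * x 0 $ 1 / c t"
    "\<And>t. x t $ 2 = exp (d * t) * x 0 $ 2 / c t" "\<And>t. 1 - x t \<bullet> x t = (1 - x 0 \<bullet> x 0) / (c t)\<^sup>2"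
    using diagonal_disk_solution[OF x] by metis
  define k where "k t = 1 / (c t)\<^sup>2" for t
  have e2: "(exp (s::real))\<^sup>2 = exp (2 * s)" for s by (simp add: exp_double)
  have 1: "sq1 (x t) = k t * exp (2 * a * t) * sq1 (x 0)" "sq2 (x t) = k t * exp (2 * d * t) * sq2 (x 0)" for t
    unfolding sq1_def sq2_def c(2)[of t] c(3)[of t] by (simp_all add: k_def power_divide power_mult_distrib e2 mult.assoc)
  have sq0: "sq0 u = 1 - u \<bullet> u" for u by (simp add: sq0_def inner2 power2_eq_square)
  have 0: "sq0 (x t) = k t * exp (0 * t) * sq0 (x 0)" for t
    unfolding sq0 c(4)[of t] by (simp add: k_def)
  show thesis
  proof (rule that[of k])
    show "k t > 0" for t using c(1)[of t] by (simp add: k_def)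
    show "P (x t) = k t * exp (l * t) * P (x 0)" "Q (x t) = k t * exp (h * t) * Q (x 0)"
      "N (x t) = k t * exp (n * t) * N (x 0)" for t
      using ad 0[of t] 1[of t] by (auto simp: adapted_def)
    show "\<exists>r>0. x t $ 1 = r * x 0 $ 1" for t
      using c(1,2)[of t] by (intro exI[of _ "exp (a * t) / c t"]) simp
    show "\<exists>r>0. x t $ 2 = r * x 0 $ 2" for t
      using c(1,3)[of t] by (intro exI[of _ "exp (d * t) / c t"]) simp
  qed
qed

text \<open>The exponent that makes \<open>weight b P Q / N\<close> constant along orbits: \<open>b l + (1 - b) h = n\<close>.\<close>

definition adapted_exponent :: "real \<Rightarrow> real \<Rightarrow> real \<Rightarrow> real" where
  "adapted_exponent l h n = (h - n) / (h - l)"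

lemma adapted_exponent_bounds:
  assumes "adapted a d P Q N l h n" shows "0 < adapted_exponent l h n" "adapted_exponent l h n < 1"
  using assms by (auto simp: adapted_def adapted_exponent_def divide_less_eq)

lemma simplex_scale_unique:
  assumes "simplex3 p q m" "simplex3 (k * A) (k * B) (k * C)" "p = k' * A" "q = k' * B" "m = k' * C"
  shows "k = (k'::real)"
proof -
  have "k * (A + B + C) = 1" "k' * (A + B + C) = 1"
    using assms by (auto simp: simplex3_def algebra_simps)
  then show ?thesis by (metis mult_cancel_right mult_zero_right zero_neq_one)
qed

text \<open>The label is constant along orbits of both fields and the correspondence respects it, so the
partner of \<open>x t\<close> lies on the orbit of the partner of \<open>x 0\<close>.\<close>

lemma related_flow:
  assumes ad: "adapted a d P Q N l h n" "adapted a' d' P Q N l' h' n'"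
    and x: "disk_solution (lin2 a 0 0 d) x" and y: "disk_solution (lin2 a' 0 0 d') y"
    and b: "b = adapted_exponent l h n" "b' = adapted_exponent l' h' n'"
    and r: "related P Q N b b' (x 0) (y 0)"
  obtains s where "related P Q N b b' (x t) (y s)"
proof -
  note c = adapted_chart[OF ad(1)]
  note bb = adapted_exponent_bounds[OF ad(1)] adapted_exponent_bounds[OF ad(2)]
  note bb = bb[folded b]
  obtain k where k: "k t > 0" "P (x t) = k t * exp (l * t) * P (x 0)"
    "Q (x t) = k t * exp (h * t) * Q (x 0)" "N (x t) = k t * exp (n * t) * N (x 0)"
    "\<exists>r>0. x t $ 1 = r * x 0 $ 1" "\<exists>r>0. x t $ 2 = r * x 0 $ 2"
    using adapted_flow[OF ad(1) x] by metis
  obtain k' where k': "\<And>t. k' t > 0" "\<And>t. P (y t) = k' t * exp (l' * t) * P (y 0)"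
    "\<And>t. Q (y t) = k' t * exp (h' * t) * Q (y 0)" "\<And>t. N (y t) = k' t * exp (n' * t) * N (y 0)"
    "\<And>t. \<exists>r>0. y t $ 1 = r * y 0 $ 1" "\<And>t. \<exists>r>0. y t $ 2 = r * y 0 $ 2"
    using adapted_flow[OF ad(2) y] by metis
  have xt: "x t \<in> cball 0 1" by (rule disk_solution_mem[OF x])
  obtain v where v: "related P Q N b b' (x t) v" using related_exists[OF c bb(3,4) xt] .
  have m: "matched b b' (P (x 0)) (Q (x 0)) (N (x 0)) (P (y 0)) (Q (y 0)) (N (y 0))"
    "matched b b' (P (x t)) (Q (x t)) (N (x t)) (P v) (Q v) (N v)" using r v by (auto simp: related_def)
  note z = matched_zero_iff[OF bb m(1)] matched_zero_iff[OF bb m(2)]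
  have zt: "P (x t) = 0 \<longleftrightarrow> P (x 0) = 0" "Q (x t) = 0 \<longleftrightarrow> Q (x 0) = 0" "N (x t) = 0 \<longleftrightarrow> N (x 0) = 0"
    using k(1-4) by auto
  have sx: "simplex3 (P (x 0)) (Q (x 0)) (N (x 0))" "simplex3 (P (y 0)) (Q (y 0)) (N (y 0))"
    "simplex3 (P v) (Q v) (N v)" using m by (auto simp: matched_def)
  have "b * l + (1 - b) * h = n"
    using ad(1) b(1) by (intro convex_rate) (auto simp: adapted_def adapted_exponent_def)
  then have W: "weight b (P (x t)) (Q (x t)) = k t * exp (n * t) * weight b (P (x 0)) (Q (x 0))"
    using weight_flow[OF k(1), of "P (x 0)" "Q (x 0)" b l t h] sx(1) by (simp add: k simplex3_def)
  have e: "weight b (P (x 0)) (Q (x 0)) * N (y 0) = weight b' (P (y 0)) (Q (y 0)) * N (x 0)"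
    "weight b (P (x t)) (Q (x t)) * N v = weight b' (P v) (Q v) * N (x t)"
    using m by (auto simp: matched_def)
  have WW: "weight b' (P (y 0)) (Q (y 0)) * N v = weight b' (P v) (Q v) * N (y 0)"
  proof (cases "N (x 0) = 0 \<or> P (x 0) = 0 \<or> Q (x 0) = 0")
    case True
    then show ?thesis using z zt by (auto simp: weight_eq_0_iff) (auto simp: weight_def)
  next
    case False
    define W0 V0 V1 where "W0 = weight b (P (x 0)) (Q (x 0))" "V0 = weight b' (P (y 0)) (Q (y 0))"
      "V1 = weight b' (P v) (Q v)"
    have "W0 * N v = V1 * N (x 0)" using e(2) k(1) by (simp add: W k(4) W0_V0_V1_def)
    moreover have "W0 * N (y 0) = V0 * N (x 0)" using e(1) by (simp add: W0_V0_V1_def)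
    ultimately have "(V0 * N v) * N (x 0) * W0 = (V1 * N (y 0)) * N (x 0) * W0" by algebra
    moreover have "W0 \<noteq> 0" using False by (simp add: W0_V0_V1_def weight_eq_0_iff)
    ultimately show ?thesis using False by (simp add: W0_V0_V1_def)
  qed
  have r': "l' < n'" "n' < h'" "b' = (h' - n') / (h' - l')"
    using ad(2) b(2) by (auto simp: adapted_def adapted_exponent_def)
  have zv: "P v = 0 \<longleftrightarrow> P (y 0) = 0" "Q v = 0 \<longleftrightarrow> Q (y 0) = 0" "N v = 0 \<longleftrightarrow> N (y 0) = 0"
    by (simp_all only: z zt)
  obtain s \<kappa> where s: "\<kappa> > 0" "P v = \<kappa> * exp (l' * s) * P (y 0)" "Q v = \<kappa> * exp (h' * s) * Q (y 0)"
      "N v = \<kappa> * exp (n' * s) * N (y 0)"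
    using simplex_orbit[OF sx(2,3) r' zv WW] by metis
  have ys: "simplex3 (P (y s)) (Q (y s)) (N (y s))" by (rule chart_simplex[OF c disk_solution_mem[OF y]])
  have sv: "simplex3 (\<kappa> * (exp (l' * s) * P (y 0))) (\<kappa> * (exp (h' * s) * Q (y 0))) (\<kappa> * (exp (n' * s) * N (y 0)))"
    using sx(3) by (simp only: s(2-4) mult.assoc)
  have yk: "P (y s) = k' s * (exp (l' * s) * P (y 0))" "Q (y s) = k' s * (exp (h' * s) * Q (y 0))"
    "N (y s) = k' s * (exp (n' * s) * N (y 0))"
    using k'(2-4)[of s] by (simp_all only: mult.assoc)
  have "\<kappa> = k' s" by (rule simplex_scale_unique[OF ys sv yk])
  then have "P (y s) = P v" "Q (y s) = Q v" "N (y s) = N v"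
    unfolding yk s(2-4) by (simp_all only: mult.assoc)
  moreover have "0 \<le> x t $ 1 * y s $ 1"
  proof -
    obtain r1 r2 where "r1 > 0" "x t $ 1 = r1 * x 0 $ 1" "r2 > 0" "y s $ 1 = r2 * y 0 $ 1"
      using k(5) k'(5)[of s] by blast
    moreover have "0 \<le> x 0 $ 1 * y 0 $ 1" using r by (simp add: related_def)
    ultimately have "0 \<le> (r1 * r2) * (x 0 $ 1 * y 0 $ 1)" "x t $ 1 * y s $ 1 = (r1 * r2) * (x 0 $ 1 * y 0 $ 1)" by simp_all
    then show ?thesis by simp
  qed
  moreover have "0 \<le> x t $ 2 * y s $ 2"
  proof -
    obtain r1 r2 where "r1 > 0" "x t $ 2 = r1 * x 0 $ 2" "r2 > 0" "y s $ 2 = r2 * y 0 $ 2"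
      using k(6) k'(6)[of s] by blast
    moreover have "0 \<le> x 0 $ 2 * y 0 $ 2" using r by (simp add: related_def)
    ultimately have "0 \<le> (r1 * r2) * (x 0 $ 2 * y 0 $ 2)" "x t $ 2 * y s $ 2 = (r1 * r2) * (x 0 $ 2 * y 0 $ 2)" by simp_all
    then show ?thesis by simp
  qed
  ultimately have "related P Q N b b' (x t) (y s)"
    using v disk_solution_mem[OF y, of s] unfolding related_def by simp
  then show thesis by (rule that)
qed

text \<open>The vertices of the triangle are the equilibria.\<close>

definition vertex :: "(real^2 \<Rightarrow> real) \<Rightarrow> (real^2 \<Rightarrow> real) \<Rightarrow> (real^2 \<Rightarrow> real) \<Rightarrow> real^2 \<Rightarrow> bool" where
  "vertex P Q N u \<longleftrightarrow> P u = 0 \<and> Q u = 0 \<or> P u = 0 \<and> N u = 0 \<or> Q u = 0 \<and> N u = 0"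

lemma adapted_strict_mono:
  assumes ad: "adapted a d P Q N l h n" and x: "disk_solution (lin2 a 0 0 d) x" and nv: "\<not> vertex P Q N (x 0)"
  shows "strict_mono (\<lambda>t. Q (x t) - P (x t))"
proof (rule strict_monoI)
  fix s t :: real assume st: "s < t"
  obtain k where k: "\<And>t. k t > 0" "\<And>t. P (x t) = k t * exp (l * t) * P (x 0)"
    "\<And>t. Q (x t) = k t * exp (h * t) * Q (x 0)" "\<And>t. N (x t) = k t * exp (n * t) * N (x 0)"
    using adapted_flow[OF ad x] by metis
  define c where "c = k t / k s"
  have e: "exp (r * t) = exp (r * s) * exp (r * (t - s))" for r
    by (simp add: algebra_simps flip: exp_add)
  have kt: "k t = c * k s" using k(1)[of s] by (simp add: c_def)
  have F: "P (x t) = c * exp (l * (t - s)) * P (x s)" "Q (x t) = c * exp (h * (t - s)) * Q (x s)"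
    "N (x t) = c * exp (n * (t - s)) * N (x s)"
    unfolding k(2-4)[of t] k(2-4)[of s] e kt by simp_all
  have z: "P (x s) = 0 \<longleftrightarrow> P (x 0) = 0" "Q (x s) = 0 \<longleftrightarrow> Q (x 0) = 0" "N (x s) = 0 \<longleftrightarrow> N (x 0) = 0"
    using k(1)[of s] k(2-4)[of s] by auto
  note c = adapted_chart[OF ad]
  show "Q (x s) - P (x s) < Q (x t) - P (x t)"
    by (rule simplex_flow_monotone[OF chart_simplex[OF c disk_solution_mem[OF x]]
          chart_simplex[OF c disk_solution_mem[OF x]] _ _ _ _ F])
      (use k(1) st ad z nv in \<open>auto simp: c_def adapted_def vertex_def\<close>)
qed

lemma adapted_vertex:
  assumes ad: "adapted a d P Q N l h n" and x: "disk_solution (lin2 a 0 0 d) x" and nv: "vertex P Q N (x 0)"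
  shows "P (x t) = P (x 0)" "Q (x t) = Q (x 0)" "N (x t) = N (x 0)"
proof -
  obtain k where k: "k t > 0" "P (x t) = k t * exp (l * t) * P (x 0)"
    "Q (x t) = k t * exp (h * t) * Q (x 0)" "N (x t) = k t * exp (n * t) * N (x 0)"
    using adapted_flow[OF ad x] by metis
  have "simplex3 (P (x t)) (Q (x t)) (N (x t))" "simplex3 (P (x 0)) (Q (x 0)) (N (x 0))"
    by (rule chart_simplex[OF adapted_chart[OF ad] disk_solution_mem[OF x]])+
  then show "P (x t) = P (x 0)" "Q (x t) = Q (x 0)" "N (x t) = N (x 0)"
    using k nv by (auto simp: simplex3_def vertex_def)
qed

lemma nonneg_mult_rescale:
  assumes "r > 0" "s > 0" "a = r * c" "b = s * c" "0 \<le> x * b" shows "0 \<le> x * (a::real)"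
proof -
  have eq: "x * a = (r / s) * (x * b)" using assms by simp
  have "0 \<le> (r / s) * (x * b)" by (rule mult_nonneg_nonneg) (use assms(1,2,5) in auto)
  then show ?thesis by (simp only: eq)
qed

text \<open>Along an orbit that is not an equilibrium the function \<open>Q - P\<close> is strictly increasing, and the
correspondence preserves it; this makes the change of time monotone. It is surjective because the argument applies to the inverse, too.\<close>

lemma same_portrait_adapted:
  assumes ad: "adapted a d P Q N l h n" "adapted a' d' P Q N l' h' n'"
  shows "same_portrait (lin2 a 0 0 d) (lin2 a' 0 0 d')"
proof -
  define b b' where "b = adapted_exponent l h n" and "b' = adapted_exponent l' h' n'"
  note c = adapted_chart[OF ad(1)]
  note bb = adapted_exponent_bounds[OF ad(1), folded b_def] adapted_exponent_bounds[OF ad(2), folded b'_def]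
  show ?thesis
  proof (rule same_portraitI[OF homeomorphism_related_map[OF c bb], of 1])
    show "carries_orbits 1 (related_map P Q N b b') (lin2 a 0 0 d) (lin2 a' 0 0 d')"
      unfolding carries_orbits_def
    proof (intro allI impI)
      fix x assume x: "disk_solution (lin2 a 0 0 d) x"
      have x0: "x t \<in> cball 0 1" for t by (rule disk_solution_mem[OF x])
      note hx = related_map[OF c bb x0]
      have "related_map P Q N b b' (x 0) \<in> cball 0 1" using hx unfolding related_def by blast
      then obtain y where y: "disk_solution (lin2 a' 0 0 d') y" "y 0 = related_map P Q N b b' (x 0)"
        using disk_solution_exists[OF linear_lin2] by metis
      have r0: "related P Q N b b' (x 0) (y 0)" using hx[of 0] y(2) by simp
      have fwd: "\<exists>s. related P Q N b b' (x t) (y s)" for t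
        using related_flow[OF ad x y(1) b_def b'_def r0] by metis
      have bwd: "\<exists>s. related P Q N b b' (x s) (y t)" for t
        using related_flow[OF ad(2,1) y(1) x b'_def b_def related_sym[OF r0]] related_sym by metis
      have "\<exists>\<tau>. strict_mono \<tau> \<and> surj \<tau> \<and> (\<forall>t. related P Q N b b' (x t) (y (\<tau> t)))"
      proof (cases "vertex P Q N (x 0)")
        case True
        have m: "matched b b' (P (x 0)) (Q (x 0)) (N (x 0)) (P (y 0)) (Q (y 0)) (N (y 0))"
          using r0 by (auto simp: related_def)
        have vy: "vertex P Q N (y 0)" using True matched_zero_iff[OF bb m] by (auto simp: vertex_def)
        have "related P Q N b b' (x t) (y t)" for t
        proof -
          obtain s where s: "related P Q N b b' (x t) (y s)" using fwd by blast
          obtain k' where k': "\<And>t. \<exists>r>0. y t $ 1 = r * y 0 $ 1" "\<And>t. \<exists>r>0. y t $ 2 = r * y 0 $ 2"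
            using adapted_flow[OF ad(2) y(1)] by metis
          obtain r1 r2 where 1: "r1 > 0" "y t $ 1 = r1 * y 0 $ 1" "r2 > 0" "y s $ 1 = r2 * y 0 $ 1"
            using k'(1) by blast
          obtain r3 r4 where 2: "r3 > 0" "y t $ 2 = r3 * y 0 $ 2" "r4 > 0" "y s $ 2 = r4 * y 0 $ 2"
            using k'(2) by blast
          have sgn: "0 \<le> x t $ 1 * y s $ 1" "0 \<le> x t $ 2 * y s $ 2" and mm: "matched b b' (P (x t)) (Q (x t)) (N (x t)) (P (y s)) (Q (y s)) (N (y s))"
            using s by (simp_all add: related_def)
          have "0 \<le> x t $ 1 * y t $ 1" by (rule nonneg_mult_rescale[OF 1(1,3,2,4) sgn(1)])
          moreover have "0 \<le> x t $ 2 * y t $ 2" by (rule nonneg_mult_rescale[OF 2(1,3,2,4) sgn(2)])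
          moreover have "matched b b' (P (x t)) (Q (x t)) (N (x t)) (P (y t)) (Q (y t)) (N (y t))"
            using mm unfolding adapted_vertex[OF ad(2) y(1) vy, of s] adapted_vertex[OF ad(2) y(1) vy, of t] .
          ultimately show ?thesis
            unfolding related_def using disk_solution_mem[OF y(1), of t] x0[of t] by blast
        qed
        then show ?thesis by (intro exI[of _ "\<lambda>t. t"]) (auto simp: strict_mono_def)
      next
        case False
        have m: "matched b b' (P (x 0)) (Q (x 0)) (N (x 0)) (P (y 0)) (Q (y 0)) (N (y 0))"
          using r0 by (auto simp: related_def)
        have vy: "\<not> vertex P Q N (y 0)" using False matched_zero_iff[OF bb m] by (auto simp: vertex_def)
        note mx = adapted_strict_mono[OF ad(1) x False]
        note my = adapted_strict_mono[OF ad(2) y(1) vy]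
        obtain \<tau> where \<tau>: "\<And>t. related P Q N b b' (x t) (y (\<tau> t))" using fwd by metis
        have level: "Q (x t) - P (x t) = Q (y (\<tau> t)) - P (y (\<tau> t))" for t
          using \<tau>[of t] by (simp add: related_def matched_def)
        have "strict_mono \<tau>"
        proof (rule strict_monoI)
          fix s t :: real assume "s < t"
          then have "Q (y (\<tau> s)) - P (y (\<tau> s)) < Q (y (\<tau> t)) - P (y (\<tau> t))"
            using strict_monoD[OF mx] level by simp
          then show "\<tau> s < \<tau> t" using strict_mono_less[OF my] by simp
        qed
        moreover have "surj \<tau>"
        proof (rule surjI)
          fix r
          define t where "t = (SOME t. related P Q N b b' (x t) (y r))"
          have t: "related P Q N b b' (x t) (y r)" unfolding t_def by (rule someI_ex[OF bwd])
          have "y r = y (\<tau> t)" by (rule related_unique[OF c bb t \<tau>])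
          then have "Q (y r) - P (y r) = Q (y (\<tau> t)) - P (y (\<tau> t))" by simp
          then show "\<tau> (SOME t. related P Q N b b' (x t) (y r)) = r"
            using strict_mono_eq[OF my] t_def by simp
        qed
        ultimately show ?thesis using \<tau> by blast
      qed
      then obtain \<tau> where \<tau>: "strict_mono \<tau>" "surj \<tau>" "\<And>t. related P Q N b b' (x t) (y (\<tau> t))" by blast
      have "related_map P Q N b b' (x t) = y (\<tau> t)" for t
        by (rule related_unique[OF c bb hx \<tau>(3)])
      then show "\<exists>y \<tau>. disk_solution (lin2 a' 0 0 d') y \<and> strict_mono (\<lambda>t. 1 * \<tau> t) \<and> surj \<tau> \<and>
          (\<forall>t. related_map P Q N b b' (x t) = y (\<tau> t))"
        using y(1) \<tau>(1,2) by (intro exI[of _ y] exI[of _ \<tau>]) simp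
    qed
  qed auto
qed

lemma same_portrait_diagonal_saddles:
  assumes "a < 0" "0 < d" "a' < 0" "0 < d'" shows "same_portrait (lin2 a 0 0 d) (lin2 a' 0 0 d')"
  by (rule same_portrait_adapted[of _ _ sq1 sq2 sq0 "2 * a" "2 * d" 0 _ _ "2 * a'" "2 * d'" 0])
    (use assms in \<open>auto simp: adapted_def\<close>)

lemma same_portrait_diagonal_nodes:
  assumes "0 < a" "a < d" "0 < a'" "a' < d'" shows "same_portrait (lin2 a 0 0 d) (lin2 a' 0 0 d')"
  by (rule same_portrait_adapted[of _ _ sq0 sq2 sq1 0 "2 * d" "2 * a" _ _ 0 "2 * d'" "2 * a'"])
    (use assms in \<open>auto simp: adapted_def\<close>)

lemma eigenbasis_injective:
  assumes "linear f" "f v = l *\<^sub>R v" "f w = m *\<^sub>R w" "l \<noteq> m" "v \<noteq> 0" "w \<noteq> 0" "a *\<^sub>R v + b *\<^sub>R w = 0"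
  shows "a = 0 \<and> b = 0"
proof -
  have "f (a *\<^sub>R v + b *\<^sub>R w) = 0" unfolding assms(7) using assms(1) by (rule linear_0)
  then have 1: "(a * l) *\<^sub>R v + (b * m) *\<^sub>R w = 0"
    by (simp add: linear_add[OF assms(1)] linear_scale[OF assms(1)] assms(2,3))
  have "(a * (l - m)) *\<^sub>R v = ((a * l) *\<^sub>R v + (b * m) *\<^sub>R w) - m *\<^sub>R (a *\<^sub>R v + b *\<^sub>R w)"
    by (simp add: algebra_simps)
  then have "(a * (l - m)) *\<^sub>R v = 0" using 1 assms(7) by simp
  then have "a = 0" using assms by simp
  then show ?thesis using assms by simp
qed

lemma same_portrait_diagonal:
  assumes "linear f" "discriminant f > 0"
  obtains l m where "l < m" "trace_of f = l + m" "det_of f = l * m" "same_portrait (lin2 l 0 0 m) f"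
proof -
  obtain l m v w where *: "l < m" "v \<noteq> 0" "w \<noteq> 0" "f v = l *\<^sub>R v" "f w = m *\<^sub>R w"
    "trace_of f = l + m" "det_of f = l * m" using distinct_eigenvectors[OF assms] by metis
  define S :: vf where "S p = p $ 1 *\<^sub>R v + p $ 2 *\<^sub>R w" for p
  have lin: "linear S" by (rule linearI) (simp_all add: S_def algebra_simps)
  have "same_portrait (lin2 l 0 0 m) f"
  proof (rule same_portrait_conjugate[OF linear_lin2 assms(1) lin])
    show "p = 0" if "S p = 0" for p
      using eigenbasis_injective[OF assms(1) *(4,5) _ *(2,3), of "p $ 1" "p $ 2"] *(1) that
      unfolding S_def vec2_eq_iff by simp
    show "f (S p) = S (lin2 l 0 0 m p)" for p
      by (simp add: S_def linear_add[OF assms(1)] linear_scale[OF assms(1)] *(4,5) mult.commute)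
  qed
  with * show thesis by (intro that) auto
qed

lemma same_portrait_saddles:
  assumes "f \<in> saddles" "g \<in> saddles" shows "same_portrait f g"
proof -
  have model: "same_portrait (lin2 (-1) 0 0 1) f" if f: "f \<in> saddles" for f
  proof -
    have "linear f" "det_of f < 0" using f by (auto simp: saddles_iff)
    moreover have "discriminant f > 0" using \<open>det_of f < 0\<close> zero_le_power2[of "trace_of f"] unfolding discriminant_def by linarith
    ultimately obtain l m where lm: "l < m" "det_of f = l * m" "same_portrait (lin2 l 0 0 m) f"
      using same_portrait_diagonal by metis
    then have "l < 0" "0 < m" using \<open>det_of f < 0\<close> by (auto simp: mult_less_0_iff)
    then show ?thesis
      using same_portrait_trans[OF same_portrait_diagonal_saddles lm(3), of "-1" 1] by simp
  qed
  have "same_portrait f (lin2 (-1) 0 0 1)"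
    using same_portrait_sym[OF linear_lin2 _ model[OF assms(1)]] assms(1) saddles_iff by blast
  then show ?thesis using same_portrait_trans model[OF assms(2)] by blast
qed

lemma same_portrait_nodes:
  assumes "f \<in> distinct_nodes" "g \<in> distinct_nodes" shows "same_portrait f g"
proof -
  have model: "same_portrait (lin2 1 0 0 2) f" if f: "linear f" "det_of f > 0" "discriminant f > 0" "trace_of f > 0" for f
  proof -
    obtain l m where lm: "l < m" "trace_of f = l + m" "det_of f = l * m" "same_portrait (lin2 l 0 0 m) f"
      using same_portrait_diagonal[OF f(1,3)] by metis
    then have "0 < l" using f by (auto simp: zero_less_mult_iff)
    then show ?thesis
      using same_portrait_trans[OF same_portrait_diagonal_nodes lm(4), of 1 2] lm(1) by simp
  qed
  have model': "same_portrait (lin2 1 0 0 2) f" if f: "f \<in> distinct_nodes" for f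
  proof -
    have f': "linear f" "det_of f > 0" "discriminant f > 0" using f by (auto simp: distinct_nodes_iff)
    then have "trace_of f \<noteq> 0" by (auto simp: discriminant_def)
    then consider "trace_of f > 0" | "trace_of f < 0" by linarith
    then show ?thesis
    proof cases
      case 1 then show ?thesis using model f' by blast
    next
      case 2
      have "same_portrait (lin2 1 0 0 2) (\<lambda>p. - f p)"
        using 2 f' by (intro model) (auto simp: invariants_uminus linear_uminus_field)
      then show ?thesis using same_portrait_trans same_portrait_uminus[of "\<lambda>p. - f p"] by fastforce
    qed
  qed
  have "same_portrait f (lin2 1 0 0 2)"
    using same_portrait_sym[OF linear_lin2 _ model'[OF assms(1)]] assms(1) distinct_nodes_iff by blast
  then show ?thesis using same_portrait_trans model'[OF assms(2)] by blast
qed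

section \<open>Foci\<close>

text \<open>The map \<open>s \<mapsto> s'\<close> of the unit interval with \<open>s' / (1 - s') = (s / (1 - s))^k\<close>. For \<open>s = |u|^2\<close> the odds are the
squared radius of the corresponding point of the plane.\<close>

definition odds_powr :: "real \<Rightarrow> real \<Rightarrow> real" where
  "odds_powr k s = s powr k / (s powr k + (1 - s) powr k)"

lemma sum_powr_pos:
  assumes "0 \<le> a" "0 \<le> b" "0 < a + b" shows "0 < a powr k + b powr (k::real)"
  using assms by (cases "a = 0") (auto simp: add_pos_nonneg)

lemma odds_powr_ratio:
  assumes "0 \<le> a" "0 \<le> b" "0 < a + b"
  shows "odds_powr k (a / (a + b)) = a powr k / (a powr k + b powr k)"
proof -
  have e: "1 - a / (a + b) = b / (a + b)" using assms by (simp add: field_simps)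
  have p: "(a + b) powr k > 0" using assms by simp
  show ?thesis
    unfolding odds_powr_def e using assms p by (simp add: powr_divide flip: add_divide_distrib)
qed

lemma odds_powr_bounds:
  assumes "0 \<le> s" "s \<le> 1" shows "0 \<le> odds_powr k s" "odds_powr k s \<le> 1"
  using sum_powr_pos[of s "1 - s" k] assms by (auto simp: odds_powr_def divide_le_eq)

lemma odds_powr_inverse:
  assumes "0 \<le> s" "s \<le> 1" "k > 0" shows "odds_powr (1 / k) (odds_powr k s) = s"
proof -
  have "odds_powr (1 / k) (odds_powr k s) = (s powr k) powr (1 / k) / ((s powr k) powr (1 / k) + ((1 - s) powr k) powr (1 / k))"
    unfolding odds_powr_def[of k] using sum_powr_pos[of s "1 - s" k] assms
    by (intro odds_powr_ratio) auto
  then show ?thesis using assms by (simp add: powr_powr)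
qed

lemma odds_powr_0 [simp]: "k > 0 \<Longrightarrow> odds_powr k 0 = 0" and odds_powr_1 [simp]: "odds_powr k 1 = 1"
  by (simp_all add: odds_powr_def)

lemma continuous_on_odds_powr:
  assumes "k > 0" shows "continuous_on {0..1} (odds_powr k)"
proof -
  have "s powr k + (1 - s) powr k \<noteq> 0" if "s \<in> {0..1}" for s
    using sum_powr_pos[of s "1 - s" k] that by auto
  then show ?thesis unfolding odds_powr_def using assms
    by (intro continuous_intros continuous_on_powr') auto
qed

text \<open>The map \<open>r \<mapsto> r^k\<close> of plane radii at fixed angle, extended to the closed disk.\<close>

definition radial_powr :: "real \<Rightarrow> vf" where
  "radial_powr k u = sqrt (odds_powr k (u \<bullet> u)) *\<^sub>R sgn u"

lemma sgn_inner_self: "sgn u \<bullet> sgn u = (if u = 0 then 0 else 1)" for u :: "real^2"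
  by (simp add: dot_square_norm norm_sgn)

lemma inner_radial_powr:
  assumes "k > 0" "u \<in> cball 0 1" shows "radial_powr k u \<bullet> radial_powr k u = odds_powr k (u \<bullet> u)"
  using assms(1) odds_powr_bounds(1)[of "u \<bullet> u" k] assms(2)[unfolded mem_disk_iff]
  by (simp add: radial_powr_def sgn_inner_self)

lemma sgn_radial_powr:
  assumes "u \<in> cball 0 1" shows "sgn (radial_powr k u) = sgn u"
proof (cases "u = 0")
  case False
  have "odds_powr k (u \<bullet> u) > 0"
    using False sum_powr_pos[of "u \<bullet> u" "1 - u \<bullet> u" k] assms[unfolded mem_disk_iff] 
    by (auto simp: odds_powr_def)
  then show ?thesis using False by (simp add: radial_powr_def sgn_scaleR sgn_div_norm[of "sgn u"] norm_sgn)
qed (simp add: radial_powr_def)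

lemma eq_norm_sgn: "u = sqrt (u \<bullet> u) *\<^sub>R sgn u" for u :: "real^2"
  by (cases "u = 0") (simp_all add: sgn_div_norm norm_eq_sqrt_inner[symmetric])

lemma eqI_norm_sgn:
  fixes u v :: "real^2" assumes "u \<bullet> u = v \<bullet> v" "sgn u = sgn v" shows "u = v"
  using eq_norm_sgn[of u] eq_norm_sgn[of v] assms by simp

lemma homeomorphism_radial_powr:
  assumes "k > 0"
  shows "homeomorphism (cball 0 1) (cball 0 1) (radial_powr k) (radial_powr (1 / k))"
    and "radial_powr k ` sphere 0 1 = sphere 0 1"
proof -
  have mem: "radial_powr k u \<in> cball 0 1" if "u \<in> cball 0 1" "k > 0" for u k
    using inner_radial_powr[OF that(2,1)] odds_powr_bounds(2)[of "u \<bullet> u" k] that(1) unfolding mem_disk_iff by simp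
  have left: "radial_powr (1 / k) (radial_powr k u) = u" if "u \<in> cball 0 1" "k > 0" for u k
  proof (rule eqI_norm_sgn)
    have "k > 0" "1 / k > 0" using that by auto
    then show "radial_powr (1 / k) (radial_powr k u) \<bullet> radial_powr (1 / k) (radial_powr k u) = u \<bullet> u"
      using inner_radial_powr mem that odds_powr_inverse[of "u \<bullet> u" k] that(1)[unfolded mem_disk_iff] by simp
    show "sgn (radial_powr (1 / k) (radial_powr k u)) = sgn u" using mem that by (simp add: sgn_radial_powr)
  qed
  have cont: "continuous_on (cball 0 1) (radial_powr k)" if k: "k > 0" for k
    unfolding continuous_on_eq_continuous_within
  proof
    fix u :: "real^2" assume u: "u \<in> cball 0 1"
    have "u \<bullet> u \<in> {0..1}" if "u \<in> cball 0 1" for u :: "real^2"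
      using that unfolding mem_disk_iff by simp
    then have "(\<lambda>u. u \<bullet> u) ` cball (0::real^2) 1 \<subseteq> {0..1}" by blast
    then have c: "continuous_on (cball 0 1) (\<lambda>u::real^2. sqrt (odds_powr k (u \<bullet> u)))"
      by (intro continuous_on_real_sqrt continuous_on_compose2[OF continuous_on_odds_powr[OF k]] continuous_intros) auto
    then have cu: "((\<lambda>u. sqrt (odds_powr k (u \<bullet> u))) \<longlongrightarrow> sqrt (odds_powr k (u \<bullet> u))) (at u within cball 0 1)"
      using u by (simp add: continuous_on_def)
    show "continuous (at u within cball 0 1) (radial_powr k)"
    proof (cases "u = 0")
      case False
      then show ?thesis unfolding continuous_within radial_powr_def[abs_def]
        by (intro tendsto_intros cu) auto
    next
      case True
      have "(radial_powr k \<longlongrightarrow> 0) (at u within cball 0 1)"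
      proof (rule Lim_null_comparison)
        show "((\<lambda>u. sqrt (odds_powr k (u \<bullet> u))) \<longlongrightarrow> 0) (at u within cball 0 1)"
          using cu True k by simp
        show "\<forall>\<^sub>F v in at u within cball 0 1. norm (radial_powr k v) \<le> sqrt (odds_powr k (v \<bullet> v))"
          using odds_powr_bounds(1)[of _ k] mem_disk_iff(1)
          by (auto simp: eventually_at_filter radial_powr_def norm_sgn simp del: mem_cball intro!: eventuallyI)
      qed
      then show ?thesis unfolding continuous_within True by (simp add: radial_powr_def)
    qed
  qed
  have "1 / k > 0" using assms by simp
  show "homeomorphism (cball 0 1) (cball 0 1) (radial_powr k) (radial_powr (1 / k))"
    using cont[OF assms] cont[OF \<open>1 / k > 0\<close>] mem[OF _ assms] mem[OF _ \<open>1 / k > 0\<close>] left[OF _ assms]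
      left[OF _ \<open>1 / k > 0\<close>] by (intro homeomorphismI) auto
  have "radial_powr k u = u" if "u \<in> sphere 0 1" for u
    using that by (simp add: radial_powr_def dot_square_norm sgn_div_norm)
  then show "radial_powr k ` sphere 0 1 = sphere 0 1" by simp
qed

definition rotate2 :: "real \<Rightarrow> vf" where
  "rotate2 t p = vector [cos t * p $ 1 - sin t * p $ 2, sin t * p $ 1 + cos t * p $ 2]"

lemma rotate2_scaleR: "rotate2 t (r *\<^sub>R p) = r *\<^sub>R rotate2 t p"
  by (simp add: rotate2_def vec2_eq_iff algebra_simps)

lemma inner_rotate2: "rotate2 t p \<bullet> rotate2 t p = p \<bullet> p"
proof -
  have "rotate2 t p \<bullet> rotate2 t p = ((cos t)\<^sup>2 + (sin t)\<^sup>2) * (p \<bullet> p)"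
    by (simp only: rotate2_def inner2 vector_2 power2_eq_square) algebra
  then show ?thesis by simp
qed

lemma sgn_rotate2: "sgn (rotate2 t p) = rotate2 t (sgn p)"
  by (simp add: sgn_div_norm norm_eq_sqrt_inner inner_rotate2 rotate2_scaleR)

lemma solution_focus:
  "solution (lin2 a (- w) w a) (\<lambda>t. exp (a * t) *\<^sub>R rotate2 (w * t) p)"
  unfolding solution_def has_vector_derivative_vec2_iff
  by (auto intro!: derivative_eq_intros simp: rotate2_def algebra_simps)

lemma focus_disk_orbit:
  fixes v :: "real^2"
  assumes v: "v \<in> cball 0 1" and x: "disk_solution (lin2 a (- w) w a) x" "x 0 = v"
  shows "x t \<bullet> x t = exp (2 * a * t) * (v \<bullet> v) / (exp (2 * a * t) * (v \<bullet> v) + (1 - v \<bullet> v))"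
    "sgn (x t) = rotate2 (w * t) (sgn v)"
proof -
  define y where "y = (\<lambda>t. exp (a * t) *\<^sub>R rotate2 (w * t) v)"
  have y: "solution (lin2 a (- w) w a) y" "y 0 = v"
    unfolding y_def by (rule solution_focus) (simp add: rotate2_def vec2_eq_iff)
  note F = disk_solution_formula[OF linear_lin2 v y]
  have xt: "x t = (1 / sqrt (1 - v \<bullet> v + y t \<bullet> y t)) *\<^sub>R y t"
    by (rule disk_solution_unique[OF linear_lin2 x(1) F(2), of 0]) (use F(3) x(2) in simp)
  have yy: "y t \<bullet> y t = exp (2 * a * t) * (v \<bullet> v)"
    by (simp add: y_def inner_rotate2 flip: exp_add mult.assoc)
  have "x t \<bullet> x t = (y t \<bullet> y t) / (sqrt (1 - v \<bullet> v + y t \<bullet> y t))\<^sup>2"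
    by (simp add: xt power2_eq_square)
  also have "\<dots> = (y t \<bullet> y t) / (y t \<bullet> y t + (1 - v \<bullet> v))" using F(1)[of t] by (simp add: add.commute)
  finally show "x t \<bullet> x t = exp (2 * a * t) * (v \<bullet> v) / (exp (2 * a * t) * (v \<bullet> v) + (1 - v \<bullet> v))"
    by (simp add: yy)
  have "sgn (x t) = sgn (y t)" using F(1)[of t] by (simp add: xt sgn_scaleR)
  also have "\<dots> = rotate2 (w * t) (sgn v)" by (simp add: y_def sgn_scaleR sgn_rotate2)
  finally show "sgn (x t) = rotate2 (w * t) (sgn v)" .
qed

text \<open>Both spirals are of the form \<open>r = r0 exp (a \<theta> / w)\<close>, so \<open>k\<close> has to be the quotient of the two
values of \<open>a / w\<close>, and time is scaled so that both turn at the same speed.\<close>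

lemma same_portrait_normal_foci:
  assumes "a > 0" "w > 0" "a' > 0" "w' > 0"
  shows "same_portrait (lin2 a (- w) w a) (lin2 a' (- w') w' a')"
proof -
  define k where "k = (a' * w) / (a * w')"
  have k: "k > 0" using assms by (simp add: k_def)
  show ?thesis
  proof (rule same_portraitI[OF homeomorphism_radial_powr[OF k], of 1])
    show "carries_orbits 1 (radial_powr k) (lin2 a (- w) w a) (lin2 a' (- w') w' a')"
      unfolding carries_orbits_def
    proof (intro allI impI)
      fix x assume x: "disk_solution (lin2 a (- w) w a) x"
      define v where "v = x 0"
      have v: "v \<in> cball 0 1" unfolding v_def by (rule disk_solution_mem[OF x])
      then have v1: "0 \<le> v \<bullet> v" "v \<bullet> v \<le> 1" unfolding mem_disk_iff by simp_all
      define u where "u = radial_powr k v"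
      have u: "u \<in> cball 0 1"
        using inner_radial_powr[OF k v] odds_powr_bounds(2)[OF v1, of k] unfolding mem_disk_iff u_def by simp
      obtain z where z: "disk_solution (lin2 a' (- w') w' a') z" "z 0 = u"
        using disk_solution_exists[OF linear_lin2 u] by metis
      have "radial_powr k (x t) = z (w / w' * t)" for t
      proof (rule eqI_norm_sgn)
        define E where "E = exp (2 * a * t)"
        have E: "E > 0" by (simp add: E_def)
        have "E powr k = exp (2 * a' * (w / w' * t))"
          using assms by (simp add: E_def exp_powr_real k_def field_simps)
        note zt = focus_disk_orbit[OF u z, of "w / w' * t", folded this]
        note xt = focus_disk_orbit[OF v x v_def[symmetric], of t, folded E_def]
        have xm: "x t \<in> cball 0 1" by (rule disk_solution_mem[OF x])
        define A B where "A = (v \<bullet> v) powr k" and "B = (1 - v \<bullet> v) powr k"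
        have AB: "A \<ge> 0" "B \<ge> 0" "A + B > 0" using sum_powr_pos[of "v \<bullet> v" "1 - v \<bullet> v" k] v1 by (auto simp: A_def B_def)
        have pos: "0 < E * (v \<bullet> v) + (1 - v \<bullet> v)"
          using v1 E by (cases "v \<bullet> v = 0") (auto intro: add_pos_nonneg)
        have "radial_powr k (x t) \<bullet> radial_powr k (x t) = odds_powr k (x t \<bullet> x t)"
          by (rule inner_radial_powr[OF k xm])
        also have "\<dots> = E powr k * A / (E powr k * A + B)"
          unfolding xt(1) using E v1 pos by (subst odds_powr_ratio) (auto simp: A_def B_def powr_mult)
        also have "\<dots> = z (w / w' * t) \<bullet> z (w / w' * t)"
        proof -
          have uu: "u \<bullet> u = A / (A + B)" unfolding u_def A_def B_def using inner_radial_powr[OF k v] by (simp add: odds_powr_def)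
          have "1 - u \<bullet> u = B / (A + B)" using AB by (simp add: uu field_simps)
          then show ?thesis unfolding zt(1) uu using AB by (simp flip: add_divide_distrib)
        qed
        finally show "radial_powr k (x t) \<bullet> radial_powr k (x t) = z (w / w' * t) \<bullet> z (w / w' * t)" .
        have "w' * (w / w' * t) = w * t" using assms by simp
        then show "sgn (radial_powr k (x t)) = sgn (z (w / w' * t))"
          using sgn_radial_powr[OF xm, of k] sgn_radial_powr[OF v, of k] xt(2) zt(2) by (simp add: u_def)
      qed
      moreover have "strict_mono (\<lambda>t. 1 * (w / w' * t))" using assms by (auto simp: strict_mono_def divide_strict_right_mono)
      moreover have "surj (\<lambda>t. w / w' * t)" by (rule surjI[of _ "\<lambda>t. w' / w * t"]) (use assms in simp)
      ultimately show "\<exists>y \<tau>. disk_solution (lin2 a' (- w') w' a') y \<and> strict_mono (\<lambda>t. 1 * \<tau> t) \<and> surj \<tau> \<and>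
          (\<forall>t. radial_powr k (x t) = y (\<tau> t))"
        using z(1) by (intro exI[of _ z] exI[of _ "\<lambda>t. w / w' * t"]) blast
    qed
  qed auto
qed

lemma no_real_eigenvector:
  assumes "linear f" "discriminant f < 0" "f v = l *\<^sub>R v" shows "v = 0"
proof (rule ccontr)
  assume "v \<noteq> 0"
  then have "l\<^sup>2 - trace_of f * l + det_of f = 0" using eigenvalue_root assms by blast
  then have "discriminant f = (2 * l - trace_of f)\<^sup>2" by (simp add: discriminant_def power2_eq_square algebra_simps)
  then show False using assms(2) by simp
qed

lemma same_portrait_focus_normal:
  assumes "linear f" "discriminant f < 0"
  obtains a w where "a = trace_of f / 2" "w > 0" "same_portrait (lin2 a (- w) w a) f"
proof -
  define a w where "a = trace_of f / 2" and "w = sqrt (- discriminant f) / 2"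
  have w: "w > 0" "w\<^sup>2 = - discriminant f / 4" using assms(2) by (simp_all add: w_def power_divide)
  define v u :: "real^2" where "v = vector [1, 0]" and "u = (1 / w) *\<^sub>R (f v - a *\<^sub>R v)"
  have v: "v \<noteq> 0" by (simp add: v_def vec2_eq_iff)
  have fv: "f v = a *\<^sub>R v + w *\<^sub>R u" using w by (simp add: u_def)
  have ff: "f (f v - a *\<^sub>R v) = a *\<^sub>R (f v - a *\<^sub>R v) - (w * w) *\<^sub>R v"
  proof -
    have t: "trace_of f = 2 * a" and d: "det_of f = w * w + a * a"
      using w(2) by (simp_all add: a_def discriminant_def power2_eq_square field_simps)
    show ?thesis
      by (simp add: linear_diff[OF assms(1)] linear_scale[OF assms(1)] cayley_hamilton2[OF assms(1)] t d vec2_eq_iff algebra_simps)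
  qed
  have "f u = (1 / w) *\<^sub>R (a *\<^sub>R (f v - a *\<^sub>R v) - (w * w) *\<^sub>R v)"
    by (simp only: u_def linear_scale[OF assms(1)] ff)
  also have "\<dots> = a *\<^sub>R u - w *\<^sub>R v" using w(1) by (simp add: u_def vec2_eq_iff field_simps)
  finally have fu: "f u = a *\<^sub>R u - w *\<^sub>R v" .
  define S :: vf where "S p = p $ 1 *\<^sub>R v + p $ 2 *\<^sub>R u" for p
  have lin: "linear S" by (rule linearI) (simp_all add: S_def algebra_simps)
  have "same_portrait (lin2 a (- w) w a) f"
  proof (rule same_portrait_conjugate[OF linear_lin2 assms(1) lin])
    show "p = 0" if p: "S p = 0" for p
    proof -
      have "p $ 2 = 0"
      proof (rule ccontr)
        assume n: "p $ 2 \<noteq> 0"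
        have "(1 / p $ 2) *\<^sub>R S p = 0" using p by simp
        then have "u = (- (p $ 1 / p $ 2)) *\<^sub>R v"
          using n by (simp add: S_def scaleR_add_right add_eq_0_iff2)
        then have "f v = (a - w * (p $ 1 / p $ 2)) *\<^sub>R v" by (simp add: fv algebra_simps)
        then show False using no_real_eigenvector[OF assms] v by blast
      qed
      then show ?thesis using p v by (auto simp: S_def vec2_eq_iff)
    qed
    show "f (S p) = S (lin2 a (- w) w a p)" for p
      by (simp add: S_def linear_add[OF assms(1)] linear_scale[OF assms(1)] fv fu algebra_simps)
  qed
  then show thesis using w a_def by (intro that) auto
qed

lemma same_portrait_foci:
  assumes "f \<in> foci" "g \<in> foci" shows "same_portrait f g"
proof -
  have model: "same_portrait (lin2 1 (- 1) 1 1) f" if f: "linear f" "discriminant f < 0" "trace_of f > 0" for f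
  proof -
    obtain a w where aw: "a = trace_of f / 2" "w > 0" "same_portrait (lin2 a (- w) w a) f"
      using same_portrait_focus_normal[OF f(1,2)] .
    then show ?thesis
      using same_portrait_trans[OF same_portrait_normal_foci[of 1 1 a w] aw(3)] f(3) by simp
  qed
  have model': "same_portrait (lin2 1 (- 1) 1 1) f" if f: "f \<in> foci" for f
  proof -
    have f': "linear f" "discriminant f < 0" "trace_of f \<noteq> 0" using f by (auto simp: foci_iff)
    then consider "trace_of f > 0" | "trace_of f < 0" by linarith
    then show ?thesis
    proof cases
      case 1 then show ?thesis using model f' by blast
    next
      case 2
      have "same_portrait (lin2 1 (- 1) 1 1) (\<lambda>p. - f p)"
        using 2 f' by (intro model) (auto simp: invariants_uminus linear_uminus_field)
      then show ?thesis using same_portrait_trans same_portrait_uminus[of "\<lambda>p. - f p"] by fastforce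
    qed
  qed
  have "same_portrait f (lin2 1 (- 1) 1 1)"
    using same_portrait_sym[OF linear_lin2 _ model'[OF assms(1)]] assms(1) foci_iff by blast
  then show ?thesis using same_portrait_trans model'[OF assms(2)] by blast
qed

section \<open>Global attractors and repellers\<close>

lemma tendsto_exp_neg_at_top:
  assumes "k > 0" shows "((\<lambda>t::real. exp (- k * t)) \<longlongrightarrow> 0) at_top"
  by (rule filterlim_compose[OF exp_at_bot])
     (rule filterlim_tendsto_neg_mult_at_bot[OF tendsto_const _ filterlim_ident], use assms in simp)

lemma solution_image:
  assumes "linear f" "solution f x" shows "solution f (\<lambda>t. f (x t))"
  using bounded_linear.has_vector_derivative[of f x] assms
  unfolding solution_def linear_conv_bounded_linear by blast

text \<open>A Lyapunov function is \<open>V = |f x|^2 + \<Delta> |x|^2\<close>: by Cayley-Hamilton \<open>V' = 2 T |f x|^2\<close>, and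
\<open>|f x|^2\<close> dominates a multiple of \<open>V\<close> because \<open>f\<close> is injective.\<close>

lemma attractor_if:
  assumes "linear f" "trace_of f < 0" "det_of f > 0" shows "global_attractor f"
  unfolding global_attractor_def
proof (intro allI impI)
  fix x assume x: "solution f x"
  have "inj f" using det_nonzero_imp_inj[OF assms(1)] assms by (simp add: linear_injective_0)
  then obtain B where B: "B > 0" "\<And>v. B * norm v \<le> norm (f v)"
    using linear_inj_bounded_below_pos[OF assms(1)] by blast
  define V where "V t = f (x t) \<bullet> f (x t) + det_of f * (x t \<bullet> x t)" for t
  define q where "q = 1 + det_of f / B\<^sup>2"
  have q: "q > 0" using assms(3) B(1) by (simp add: q_def add_pos_nonneg)
  define k where "k = - 2 * trace_of f / q"
  have k: "k > 0" using assms(2) q by (simp add: k_def divide_less_0_iff)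
  have dV: "(V has_real_derivative 2 * trace_of f * (f (x t) \<bullet> f (x t))) (at t)" for t
  proof -
    have "(V has_real_derivative 2 * (f (x t) \<bullet> f (f (x t))) + det_of f * (2 * (x t \<bullet> f (x t)))) (at t)"
      unfolding V_def
      by (intro DERIV_add DERIV_cmult solution_inner_derivative x solution_image[OF assms(1) x])
    then show ?thesis
      by (simp add: cayley_hamilton2[OF assms(1)] inner_diff_right inner_commute algebra_simps)
  qed
  have Vq: "V t \<le> q * (f (x t) \<bullet> f (x t))" for t
  proof -
    have "(B * norm (x t))\<^sup>2 \<le> (norm (f (x t)))\<^sup>2" using B by (intro power_mono) auto
    then have "x t \<bullet> x t \<le> (f (x t) \<bullet> f (x t)) / B\<^sup>2"
      using B(1) by (simp add: dot_square_norm power_mult_distrib field_simps)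
    then have "det_of f * (x t \<bullet> x t) \<le> det_of f * ((f (x t) \<bullet> f (x t)) / B\<^sup>2)"
      using assms(3) by (intro mult_left_mono) auto
    then show ?thesis by (simp add: V_def q_def algebra_simps)
  qed
  have decay: "V t \<le> exp (- k * t) * V 0" if "0 \<le> t" for t
  proof -
    have "exp (k * t) * V t \<le> exp (k * 0) * V 0"
    proof (rule DERIV_nonpos_imp_nonincreasing[OF that])
      fix s
      have "((\<lambda>t. exp (k * t) * V t) has_real_derivative exp (k * s) * (2 * trace_of f * (f (x s) \<bullet> f (x s)) + k * V s)) (at s)"
        by (auto intro!: derivative_eq_intros dV simp: algebra_simps)
      moreover have "k * V s \<le> k * (q * (f (x s) \<bullet> f (x s)))" using Vq k by (intro mult_left_mono) auto
      then have "2 * trace_of f * (f (x s) \<bullet> f (x s)) + k * V s \<le> 0" using q by (simp add: k_def)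
      ultimately show "\<exists>y. ((\<lambda>t. exp (k * t) * V t) has_real_derivative y) (at s) \<and> y \<le> 0"
        by (intro exI[of _ "exp (k * s) * (2 * trace_of f * (f (x s) \<bullet> f (x s)) + k * V s)"] conjI)
          (auto simp: mult_le_0_iff)
    qed
    then have "exp (- k * t) * (exp (k * t) * V t) \<le> exp (- k * t) * V 0" by simp
    then show ?thesis by (simp add: mult.assoc[symmetric] exp_add[symmetric])
  qed
  show "(x \<longlongrightarrow> 0) at_top"
  proof (rule Lim_null_comparison)
    show "\<forall>\<^sub>F t in at_top. norm (x t) \<le> sqrt (exp (- k * t) * V 0 / det_of f)"
      using eventually_ge_at_top[of 0]
    proof eventually_elim
      case (elim t)
      have "det_of f * (x t \<bullet> x t) \<le> V t" by (simp add: V_def)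
      then have "x t \<bullet> x t \<le> exp (- k * t) * V 0 / det_of f"
        using decay[OF elim] assms(3) by (simp add: field_simps)
      then show ?case by (simp add: norm_eq_sqrt_inner)
    qed
    have "((\<lambda>t. sqrt (exp (- k * t) * V 0 / det_of f)) \<longlongrightarrow> sqrt (0 * V 0 / det_of f)) at_top"
      by (intro tendsto_intros tendsto_exp_neg_at_top k) (use assms in auto)
    then show "((\<lambda>t. sqrt (exp (- k * t) * V 0 / det_of f)) \<longlongrightarrow> 0) at_top" by simp
  qed
qed

lemma not_tendsto_zero:
  fixes x :: "real \<Rightarrow> 'a::real_normed_vector"
  assumes "(x \<longlongrightarrow> 0) at_top" "c > 0" "\<And>t. 0 \<le> t \<Longrightarrow> c \<le> norm (x t)" shows False
proof -
  have "\<forall>\<^sub>F t in at_top. c \<le> norm (x t)"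
    using eventually_ge_at_top[of 0] by eventually_elim (rule assms(3))
  with tendsto_norm[OF assms(1)] have "c \<le> norm (0::'a)"
    by (rule tendsto_lowerbound) simp
  then show False using assms(2) by simp
qed

text \<open>Liouville's formula for the area spanned by two solutions.\<close>

lemma liouville2:
  assumes "linear f" "solution f x" "solution f y"
  shows "x t $ 1 * y t $ 2 - x t $ 2 * y t $ 1 = exp (trace_of f * t) * (x 0 $ 1 * y 0 $ 2 - x 0 $ 2 * y 0 $ 1)"
proof -
  obtain a b c d where f: "f = lin2 a b c d" using linear_imp_lin2[OF assms(1)] .
  define w where "w t = x t $ 1 * y t $ 2 - x t $ 2 * y t $ 1" for t
  have d: "((\<lambda>t. x t $ 1) has_real_derivative a * x t $ 1 + b * x t $ 2) (at t)"
    "((\<lambda>t. x t $ 2) has_real_derivative c * x t $ 1 + d * x t $ 2) (at t)"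
    "((\<lambda>t. y t $ 1) has_real_derivative a * y t $ 1 + b * y t $ 2) (at t)"
    "((\<lambda>t. y t $ 2) has_real_derivative c * y t $ 1 + d * y t $ 2) (at t)" for t
    using assms(2,3) by (auto simp: solution_def has_vector_derivative_vec2_iff f)
  have "((\<lambda>t. exp (- trace_of f * t) * w t) has_real_derivative 0) (at t)" for t
    unfolding w_def by (auto intro!: derivative_eq_intros d simp: f algebra_simps)
  then have "exp (- trace_of f * t) * w t = exp (- trace_of f * 0) * w 0"
    by (intro DERIV_isconst_all) auto
  then have "exp (trace_of f * t) * (exp (- trace_of f * t) * w t) = exp (trace_of f * t) * w 0" by simp
  then show ?thesis by (simp add: w_def mult.assoc[symmetric] exp_add[symmetric])
qed

text \<open>If \<open>\<Delta> \<le> 0\<close>, there is a real eigenvalue \<open>l \<ge> 0\<close> and a solution along its eigenline that does not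
decay. If \<open>T \<ge> 0\<close>, the area spanned by two independent solutions does not decay.\<close>

lemma attractor_only_if:
  assumes "linear f" "global_attractor f" shows "det_of f > 0" "trace_of f < 0"
proof -
  have tends: "(x \<longlongrightarrow> 0) at_top" if "solution f x" for x
    using assms(2) that by (simp add: global_attractor_def)
  show "det_of f > 0"
  proof (rule ccontr)
    assume d: "\<not> det_of f > 0"
    then have discriminant: "discriminant f \<ge> (trace_of f)\<^sup>2" by (simp add: discriminant_def)
    then have d0: "discriminant f \<ge> 0" using zero_le_power2[of "trace_of f"] by linarith
    define l where "l = (trace_of f + sqrt (discriminant f)) / 2"
    have "sqrt (discriminant f) \<ge> \<bar>trace_of f\<bar>" using discriminant real_sqrt_le_mono[OF discriminant] by simp
    then have l: "l \<ge> 0" by (simp add: l_def)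
    have "l\<^sup>2 - trace_of f * l + det_of f = 0"
      using quadratic_real_roots(2)[of "trace_of f" "det_of f"] d0 by (simp add: l_def discriminant_def)
    then obtain v where v: "v \<noteq> 0" "f v = l *\<^sub>R v" using root_eigenvalue[OF assms(1)] by metis
    show False
    proof (rule not_tendsto_zero[OF tends[OF solution_eigenvector[OF assms(1) v(2)]]])
      show "norm v > 0" using v(1) by simp
      show "norm v \<le> norm (exp (l * t) *\<^sub>R v)" if "0 \<le> t" for t
        using l that v by simp
    qed
  qed
  show "trace_of f < 0"
  proof (rule ccontr)
    assume t: "\<not> trace_of f < 0"
    obtain x where x: "solution f x" "x 0 = vector [1, 0]" using solution_exists[OF assms(1)] by metis
    obtain y where y: "solution f y" "y 0 = vector [0, 1]" using solution_exists[OF assms(1)] by metis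
    have "((\<lambda>t. x t $ 1 * y t $ 2 - x t $ 2 * y t $ 1) \<longlongrightarrow> (0::real^2) $ 1 * (0::real^2) $ 2 - (0::real^2) $ 2 * (0::real^2) $ 1) at_top"
      by (intro tendsto_diff tendsto_mult tendsto_vec_nth tends x y)
    then have "((\<lambda>t. x t $ 1 * y t $ 2 - x t $ 2 * y t $ 1) \<longlongrightarrow> 0) at_top" by simp
    then show False
    proof (rule not_tendsto_zero)
      show "1 \<le> norm (x s $ 1 * y s $ 2 - x s $ 2 * y s $ 1)" if "0 \<le> s" for s
        unfolding liouville2[OF assms(1) x(1) y(1), of s] using t that by (simp add: x(2) y(2))
    qed simp
  qed
qed

lemma global_attractor_iff: "linear f \<Longrightarrow> global_attractor f \<longleftrightarrow> trace_of f < 0 \<and> det_of f > 0"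
  using attractor_if attractor_only_if by blast

lemma global_repeller_uminus: "global_repeller f \<longleftrightarrow> global_attractor (\<lambda>p. - f p)"
proof -
  have eq: "solution (\<lambda>p. - f p) (\<lambda>t. x (- t)) \<longleftrightarrow> solution f x" for x
    using solution_uminus[of f x] solution_uminus[of "\<lambda>p. - f p" "\<lambda>t. x (- t)"] by auto
  have "global_attractor (\<lambda>p. - f p) \<longleftrightarrow> (\<forall>x. solution (\<lambda>p. - f p) (\<lambda>t. x (- t)) \<longrightarrow> ((\<lambda>t. x (- t)) \<longlongrightarrow> 0) at_top)"
    unfolding global_attractor_def
  proof (intro iffI allI impI)
    fix x :: "real \<Rightarrow> real^2"
    assume *: "\<forall>x. solution (\<lambda>p. - f p) (\<lambda>t. x (- t)) \<longrightarrow> ((\<lambda>t. x (- t)) \<longlongrightarrow> 0) at_top"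
      and x: "solution (\<lambda>p. - f p) x"
    show "(x \<longlongrightarrow> 0) at_top" using *[rule_format, of "\<lambda>t. x (- t)"] x by simp
  qed blast
  then show ?thesis by (simp add: eq global_repeller_def filterlim_at_bot_mirror)
qed

lemma global_repeller_iff: "linear f \<Longrightarrow> global_repeller f \<longleftrightarrow> trace_of f > 0 \<and> det_of f > 0"
  by (simp add: global_repeller_uminus global_attractor_iff linear_uminus_field invariants_uminus)

section \<open>Invariants of phase portraits\<close>

definition equilibria :: "vf \<Rightarrow> (real^2) set" where
  "equilibria f = {u \<in> cball 0 1. disk_field f u = 0}"

lemma equilibria_iff: "u \<in> equilibria f \<longleftrightarrow> disk_solution f (\<lambda>t. u)"
proof -
  have "solution (disk_field f) (\<lambda>t. u) \<longleftrightarrow> disk_field f u = 0"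
  proof
    assume "solution (disk_field f) (\<lambda>t. u)"
    then have "((\<lambda>t. u) has_vector_derivative disk_field f u) (at 0)" by (simp add: solution_def)
    from vector_derivative_unique_at[OF this has_vector_derivative_const] show "disk_field f u = 0" .
  qed (simp add: solution_def)
  then show ?thesis by (auto simp: equilibria_def disk_solution_def)
qed

lemma carries_orbits_equilibria:
  assumes "carries_orbits e h f g" "u \<in> equilibria f" shows "h u \<in> equilibria g"
proof -
  have "disk_solution f (\<lambda>t. u)" using assms(2) by (simp add: equilibria_iff)
  then obtain y \<tau> where y: "disk_solution g y" "surj \<tau>" "\<And>t::real. h u = y (\<tau> t)"
    using assms(1) unfolding carries_orbits_def by metis
  have "y = (\<lambda>t. h u)"
  proof
    fix s obtain t where "s = \<tau> t" using y(2) by (metis surjD)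
    then show "y s = h u" using y(3) by simp
  qed
  then show ?thesis using y(1) by (simp add: equilibria_iff)
qed

lemma same_portrait_equilibria:
  assumes "linear f" "linear g" "same_portrait f g"
  obtains h where "bij_betw h (equilibria f \<inter> sphere 0 1) (equilibria g \<inter> sphere 0 1)"
    "bij_betw h (equilibria f \<inter> ball 0 1) (equilibria g \<inter> ball 0 1)"
proof -
  obtain h k e where h: "homeomorphism (cball 0 1) (cball 0 1) h k" "h ` sphere 0 1 = sphere 0 1"
     "e = 1 \<or> e = -1" "carries_orbits e h f g" using assms(3) unfolding same_portrait_iff by metis
  have k: "carries_orbits e k g f" "k ` sphere 0 1 = sphere 0 1"
    using carries_orbits_inverse[OF assms(1,2) h(1,3,4)] homeomorphism_sphere_inverse[OF h(1,2)] by auto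
  have kh: "k (h u) = u" "h (k u) = u" "h u \<in> cball 0 1" "k u \<in> cball 0 1" if "u \<in> cball 0 1" for u
    using h(1) that unfolding homeomorphism_def by blast+
  have sph_if: "p u \<in> sphere 0 1 \<longleftrightarrow> u \<in> sphere 0 1"
    if "q (p u) = u" "p ` sphere 0 1 = sphere 0 1" "q ` sphere 0 1 = sphere 0 1" for p q :: vf and u
  proof
    assume "p u \<in> sphere 0 1"
    then have "q (p u) \<in> q ` sphere 0 1" by (rule imageI)
    then show "u \<in> sphere 0 1" by (simp only: that)
  next
    assume "u \<in> sphere 0 1"
    then have "p u \<in> p ` sphere 0 1" by (rule imageI)
    then show "p u \<in> sphere 0 1" by (simp only: that)
  qed
  have sph: "h u \<in> sphere 0 1 \<longleftrightarrow> u \<in> sphere 0 1" "k u \<in> sphere 0 1 \<longleftrightarrow> u \<in> sphere 0 1" if "u \<in> cball 0 1" for u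
    using sph_if[of k h u] sph_if[of h k u] kh(1,2)[OF that] h(2) k(2) by blast+
  have ball: "u \<in> ball 0 1 \<longleftrightarrow> u \<in> cball 0 1 \<and> u \<notin> sphere 0 1" for u :: "real^2" by auto
  have E: "u \<in> cball 0 1" if "u \<in> equilibria f" for u f using that by (simp add: equilibria_def)
  note c = carries_orbits_equilibria[OF h(4)] carries_orbits_equilibria[OF k(1)]
  have fE: "h u \<in> equilibria g" "k (h u) = u" "h u \<in> sphere 0 1 \<longleftrightarrow> u \<in> sphere 0 1" if "u \<in> equilibria f" for u
    by (rule c(1)[OF that], rule kh(1)[OF E[OF that]], rule sph(1)[OF E[OF that]])
  have gE: "k u \<in> equilibria f" "h (k u) = u" "k u \<in> sphere 0 1 \<longleftrightarrow> u \<in> sphere 0 1" if "u \<in> equilibria g" for u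
    by (rule c(2)[OF that], rule kh(2)[OF E[OF that]], rule sph(2)[OF E[OF that]])
  have eb: "equilibria f \<inter> ball 0 1 = equilibria f - sphere 0 1" for f
    using ball E by (intro set_eqI) (simp only: Int_iff Diff_iff, metis)
  show thesis
  proof (rule that[of h])
    show "bij_betw h (equilibria f \<inter> sphere 0 1) (equilibria g \<inter> sphere 0 1)"
      by (rule bij_betwI[of _ _ _ k]) (auto simp: fE gE simp del: mem_sphere mem_sphere_0)
    show "bij_betw h (equilibria f \<inter> ball 0 1) (equilibria g \<inter> ball 0 1)"
      unfolding eb
      by (rule bij_betwI[of _ _ _ k]) (auto simp: fE gE simp del: mem_sphere mem_sphere_0)
  qed
qed

lemma equilibria_ball:
  assumes "linear f" shows "equilibria f \<inter> ball 0 1 = {u \<in> ball 0 1. f u = 0}"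
proof -
  have "f u = 0" if u: "u \<in> ball 0 1" "disk_field f u = 0" for u
  proof -
    have fu: "f u = (u \<bullet> f u) *\<^sub>R u" using u(2) by (simp add: disk_field_def)
    then have "u \<bullet> f u = (u \<bullet> f u) * (u \<bullet> u)" by (metis inner_scaleR_right)
    then have "(u \<bullet> f u) * (1 - u \<bullet> u) = 0" by (simp add: algebra_simps)
    moreover have "u \<bullet> u < 1" using u(1) unfolding mem_disk_iff .
    ultimately have "u \<bullet> f u = 0" by simp
    then show ?thesis using fu by simp
  qed
  moreover have "disk_field f u = 0" if "f u = 0" for u using that by (simp add: disk_field_def)
  moreover have "u \<in> cball 0 1" if "u \<in> ball 0 1" for u :: "real^2" using that by simp
  ultimately show ?thesis unfolding equilibria_def by blast
qed

text \<open>At infinity the equilibria are the directions of the eigenlines.\<close>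

lemma equilibria_sphere: "equilibria f \<inter> sphere 0 1 = {u \<in> sphere 0 1. \<exists>l. f u = l *\<^sub>R u}"
proof -
  have "disk_field f u = 0 \<longleftrightarrow> (\<exists>l. f u = l *\<^sub>R u)" if "u \<in> sphere 0 1" for u
  proof -
    have "u \<bullet> u = 1" using that unfolding mem_disk_iff .
    then show ?thesis by (auto simp: disk_field_def)
  qed
  moreover have "u \<in> cball 0 1" if "u \<in> sphere 0 1" for u :: "real^2" using that by simp
  ultimately show ?thesis unfolding equilibria_def by blast
qed

lemma det_nonzero_iff_equilibria:
  assumes "linear f" shows "det_of f \<noteq> 0 \<longleftrightarrow> equilibria f \<inter> ball 0 1 = {0}"
proof
  assume "det_of f \<noteq> 0"
  then show "equilibria f \<inter> ball 0 1 = {0}"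
    unfolding equilibria_ball[OF assms] using det_nonzero_imp_inj[OF assms] linear_0[OF assms] by auto
next
  assume E: "equilibria f \<inter> ball 0 1 = {0}"
  show "det_of f \<noteq> 0"
  proof
    assume "det_of f = 0"
    then obtain v where v: "v \<noteq> 0" "f v = 0" using kernel2[OF assms] by metis
    have "(1 / 2) *\<^sub>R sgn v \<in> equilibria f \<inter> ball 0 1"
      unfolding equilibria_ball[OF assms] using v
      by (simp add: linear_scale[OF assms] sgn_div_norm)
    then show False using E v by (simp add: sgn_zero_iff)
  qed
qed

definition cross2 :: "real^2 \<Rightarrow> real^2 \<Rightarrow> real" where
  "cross2 u v = u $ 1 * v $ 2 - u $ 2 * v $ 1"

lemma cross2_eq_0:
  assumes "cross2 u v = 0" "v \<noteq> 0" obtains r where "u = r *\<^sub>R v"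
proof (cases "v $ 1 = 0")
  case True
  then have "v $ 2 \<noteq> 0" using assms(2) by (auto simp: vec2_eq_iff)
  then show thesis using assms True by (intro that[of "u $ 2 / v $ 2"]) (auto simp: cross2_def vec2_eq_iff)
next
  case False
  then show thesis using assms by (intro that[of "u $ 1 / v $ 1"]) (auto simp: cross2_def vec2_eq_iff field_simps)
qed

lemma eigenspace_all:
  fixes f :: vf
  assumes "linear f" "f u = l *\<^sub>R u" "f v = l *\<^sub>R v" "cross2 u v \<noteq> 0" shows "f p = l *\<^sub>R p"
proof -
  have p: "p = (cross2 p v / cross2 u v) *\<^sub>R u + (cross2 u p / cross2 u v) *\<^sub>R v"
  proof -
    have "p $ 1 * cross2 u v = cross2 p v * u $ 1 + cross2 u p * v $ 1"
      "p $ 2 * cross2 u v = cross2 p v * u $ 2 + cross2 u p * v $ 2"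
      by (simp_all add: cross2_def algebra_simps)
    then show ?thesis using assms(4) by (simp add: vec2_eq_iff add_divide_distrib[symmetric] eq_divide_eq)
  qed
  have "f ((cross2 p v / cross2 u v) *\<^sub>R u + (cross2 u p / cross2 u v) *\<^sub>R v)
    = l *\<^sub>R ((cross2 p v / cross2 u v) *\<^sub>R u + (cross2 u p / cross2 u v) *\<^sub>R v)"
    by (simp add: linear_add[OF assms(1)] linear_scale[OF assms(1)] assms(2,3) algebra_simps)
  then show ?thesis using p by metis
qed

lemma eigenvector_multiple:
  fixes f :: vf
  assumes f: "linear f" and "l \<noteq> m" "f v = l *\<^sub>R v" "f w = m *\<^sub>R w" "v \<noteq> 0" "w \<noteq> 0" "f u = k *\<^sub>R u" "u \<noteq> 0"
  obtains r where "r \<noteq> 0" "u = r *\<^sub>R v" | r where "r \<noteq> 0" "u = r *\<^sub>R w"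
proof -
  have roots: "l\<^sup>2 - trace_of f * l + det_of f = 0" "m\<^sup>2 - trace_of f * m + det_of f = 0" "k\<^sup>2 - trace_of f * k + det_of f = 0"
    using eigenvalue_root[OF f] assms by blast+
  have km: "k = l \<or> k = m"
  proof (rule ccontr)
    assume "\<not> (k = l \<or> k = m)"
    then have "trace_of f = l + m" "trace_of f = l + k" using real_roots(1)[OF roots(1,2)] real_roots(1)[OF roots(1,3)] assms(2) by auto
    then show False using \<open>\<not> (k = l \<or> k = m)\<close> by simp
  qed
  \<comment> \<open>Two independent eigenvectors for one eigenvalue would make \<open>f\<close> scalar, against \<open>l \<noteq> m\<close>.\<close>
  have par: "cross2 u v = 0" if "f u = l *\<^sub>R u" "f v = l *\<^sub>R v" "f w = m *\<^sub>R w" "w \<noteq> 0" "l \<noteq> m" for u v w l m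
  proof (rule ccontr)
    assume "cross2 u v \<noteq> 0"
    then have "f w = l *\<^sub>R w" using eigenspace_all[OF f] that by blast
    then show False using that by simp
  qed
  from km show thesis
  proof
    assume "k = l"
    then have "cross2 u v = 0" using par[of u l v w m] assms by simp
    then obtain r where "u = r *\<^sub>R v" using cross2_eq_0 assms by metis
    then show thesis using that(1)[of r] assms(8) by auto
  next
    assume "k = m"
    then have "cross2 u w = 0" using par[of u m w v l] assms by simp
    then obtain r where "u = r *\<^sub>R w" using cross2_eq_0 assms by metis
    then show thesis using that(2)[of r] assms(8) by auto
  qed
qed

lemma unit_multiple:
  assumes "u = r *\<^sub>R v" "norm u = 1" "norm v = 1" shows "u = v \<or> u = - (v::real^2)"
proof -
  have "\<bar>r\<bar> = 1" using assms by simp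
  then have "r = 1 \<or> r = -1" by linarith
  then show ?thesis using assms(1) by auto
qed

lemma card_equilibria_sphere:
  assumes "linear f" "discriminant f > 0" shows "card (equilibria f \<inter> sphere 0 1) = 4"
proof -
  obtain l m v0 w0 where *: "l < m" "v0 \<noteq> 0" "w0 \<noteq> 0" "f v0 = l *\<^sub>R v0" "f w0 = m *\<^sub>R w0"
    using distinct_eigenvectors[OF assms] by metis
  define v w where "v = sgn v0" and "w = sgn w0"
  have vw: "norm v = 1" "norm w = 1" "f v = l *\<^sub>R v" "f w = m *\<^sub>R w" "v \<noteq> 0" "w \<noteq> 0"
    using * by (simp_all add: v_def w_def norm_sgn sgn_div_norm linear_scale[OF assms(1)])
  have "equilibria f \<inter> sphere 0 1 = {v, - v, w, - w}"
  proof (intro set_eqI iffI)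
    fix u assume "u \<in> equilibria f \<inter> sphere 0 1"
    then obtain k where u: "norm u = 1" "f u = k *\<^sub>R u" by (auto simp: equilibria_sphere)
    then have "u \<noteq> 0" by auto
    show "u \<in> {v, - v, w, - w}"
      by (rule eigenvector_multiple[OF assms(1) less_imp_neq[OF *(1)] vw(3,4,5,6) u(2) \<open>u \<noteq> 0\<close>])
        (use unit_multiple[of u _ v] unit_multiple[of u _ w] u vw in blast)+
  next
    fix u assume "u \<in> {v, - v, w, - w}"
    then show "u \<in> equilibria f \<inter> sphere 0 1"
      unfolding equilibria_sphere using vw by (auto simp: linear_neg[OF assms(1)])
  qed
  moreover have "v \<noteq> - v" "w \<noteq> - w" using vw(5,6) by (auto simp: vec2_eq_iff)
  moreover have "v \<noteq> w" "v \<noteq> - w"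
  proof -
    have "l *\<^sub>R v = m *\<^sub>R v \<Longrightarrow> False" using *(1) vw(5) by simp
    moreover have "f v = m *\<^sub>R v" if "v = w \<or> v = - w" using that vw(4) by (auto simp: linear_neg[OF assms(1)])
    ultimately show "v \<noteq> w" "v \<noteq> - w" using vw(3) by metis+
  qed
  ultimately show ?thesis using minus_equation_iff[of v w] by (auto simp: card_insert_if)
qed

lemma disc_neg_iff_equilibria:
  assumes "linear f" shows "discriminant f < 0 \<longleftrightarrow> equilibria f \<inter> sphere 0 1 = {}"
proof
  assume "discriminant f < 0"
  then show "equilibria f \<inter> sphere 0 1 = {}"
    unfolding equilibria_sphere using no_real_eigenvector[OF assms] by fastforce
next
  assume E: "equilibria f \<inter> sphere 0 1 = {}"
  show "discriminant f < 0"
  proof (rule ccontr)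
    assume "\<not> discriminant f < 0"
    then have "((trace_of f + sqrt (discriminant f)) / 2)\<^sup>2 - trace_of f * ((trace_of f + sqrt (discriminant f)) / 2) + det_of f = 0"
      using quadratic_real_roots(2)[of "trace_of f" "det_of f"] by (simp add: discriminant_def)
    then obtain l v where v: "v \<noteq> 0" "f v = l *\<^sub>R v" using root_eigenvalue[OF assms] by metis
    then have "sgn v \<in> equilibria f \<inter> sphere 0 1"
      unfolding equilibria_sphere by (auto simp: norm_sgn sgn_div_norm linear_scale[OF assms])
    then show False using E by simp
  qed
qed

text \<open>If the discriminant vanishes, all eigenvalues are equal; then either \<open>f\<close> is scalar and the whole circle
consists of equilibria, or there is only one eigenline and at most two of them.\<close>

lemma disc_pos_iff_equilibria:
  assumes "linear f" shows "discriminant f > 0 \<longleftrightarrow> card (equilibria f \<inter> sphere 0 1) = 4"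
proof
  assume c: "card (equilibria f \<inter> sphere 0 1) = 4"
  then have fin: "finite (equilibria f \<inter> sphere 0 1)" by (intro card_ge_0_finite) simp
  show "discriminant f > 0"
  proof (rule ccontr)
    assume "\<not> discriminant f > 0"
    moreover have "\<not> discriminant f < 0" using c disc_neg_iff_equilibria[OF assms] by auto
    ultimately have d: "discriminant f = 0" by simp
    have root: "l = trace_of f / 2" if "f u = l *\<^sub>R u" "u \<noteq> 0" for l u
    proof -
      have "l\<^sup>2 - trace_of f * l + det_of f = 0" by (rule eigenvalue_root[OF assms that])
      then have "(2 * l - trace_of f)\<^sup>2 = 0" using d by (simp add: discriminant_def power2_eq_square algebra_simps)
      then show ?thesis by simp
    qed
    have mem: "norm u = 1 \<and> f u = (trace_of f / 2) *\<^sub>R u" if u: "u \<in> equilibria f \<inter> sphere 0 1" for u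
    proof -
      obtain l where l: "f u = l *\<^sub>R u" "norm u = 1" using u unfolding equilibria_sphere by auto
      then have "u \<noteq> 0" by auto
      then show ?thesis using root[OF l(1)] l by simp
    qed
    obtain v where v: "v \<in> equilibria f \<inter> sphere 0 1" using c by (metis card.empty ex_in_conv zero_neq_numeral)
    have "equilibria f \<inter> sphere 0 1 \<subseteq> {v, - v}"
    proof
      fix u assume u: "u \<in> equilibria f \<inter> sphere 0 1"
      show "u \<in> {v, - v}"
      proof (cases "cross2 u v = 0")
        case True
        moreover have "v \<noteq> 0" using mem[OF v] by auto
        ultimately obtain r where "u = r *\<^sub>R v" using cross2_eq_0 by metis
        then show ?thesis using unit_multiple mem[OF u] mem[OF v] by blast
      next
        case False
        then have "f p = (trace_of f / 2) *\<^sub>R p" for p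
          using eigenspace_all[OF assms, of u "trace_of f / 2" v p] mem[OF u] mem[OF v] by blast
        then have "equilibria f \<inter> sphere 0 1 = sphere 0 1"
          unfolding equilibria_sphere by (auto intro!: exI[of _ "trace_of f / 2"])
        \<comment> \<open>Any five points of the circle contradict the cardinality 4.\<close>
        moreover define A :: "(real^2) set"
          where "A = {vector [1, 0], vector [-1, 0], vector [0, 1], vector [0, -1], vector [3/5, 4/5]}"
        have "A \<subseteq> sphere 0 1" by (auto simp: A_def norm_eq_sqrt_inner inner2)
        ultimately have "card A \<le> 4" using card_mono[OF fin, of A] c by simp
        moreover have "card A = 5" by (simp add: A_def vec2_eq_iff)
        ultimately show ?thesis by simp
      qed
    qed
    then have "card (equilibria f \<inter> sphere 0 1) \<le> card {v, - v}" by (intro card_mono) auto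
    also have "\<dots> \<le> 2" by (simp add: card_insert_if)
    finally show False using c by simp
  qed
qed (rule card_equilibria_sphere[OF assms])

definition settling :: "vf \<Rightarrow> bool" where
  "settling f \<longleftrightarrow> global_attractor f \<or> global_repeller f"

lemma settling_iff: "linear f \<Longrightarrow> settling f \<longleftrightarrow> trace_of f \<noteq> 0 \<and> det_of f > 0"
  by (auto simp: settling_def global_attractor_iff global_repeller_iff)

lemma filterlim_strict_mono_surj:
  fixes \<tau> :: "real \<Rightarrow> real"
  assumes "strict_mono \<tau>" "surj \<tau>"
  shows "filterlim \<tau> at_top at_top" "filterlim \<tau> at_bot at_bot"
proof -
  show "filterlim \<tau> at_top at_top"
    unfolding filterlim_at_top
  proof
    fix Z obtain t where t: "Z = \<tau> t" using assms(2) by (metis surjD)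
    show "\<forall>\<^sub>F s in at_top. Z \<le> \<tau> s"
      using eventually_ge_at_top[of t] by eventually_elim (simp add: t strict_mono_less_eq[OF assms(1)])
  qed
  show "filterlim \<tau> at_bot at_bot"
    unfolding filterlim_at_bot
  proof
    fix Z obtain t where t: "Z = \<tau> t" using assms(2) by (metis surjD)
    show "\<forall>\<^sub>F s in at_bot. \<tau> s \<le> Z"
      using eventually_le_at_bot[of t] by eventually_elim (simp add: t strict_mono_less_eq[OF assms(1)])
  qed
qed

lemma filterlim_time_change:
  fixes e :: real
  assumes "e = 1 \<or> e = -1" "F = at_top \<or> F = (at_bot :: real filter)"
  obtains F' :: "real filter" where "F' = at_top \<or> F' = at_bot"
    "\<And>\<tau>. strict_mono (\<lambda>t. e * \<tau> t) \<Longrightarrow> surj \<tau> \<Longrightarrow> filterlim \<tau> F F'"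
proof (cases "e = 1")
  case True
  show thesis by (rule that[of F]) (use assms True filterlim_strict_mono_surj in auto)
next
  case False
  then have e: "e = -1" using assms(1) by simp
  have "filterlim \<tau> at_bot at_top \<and> filterlim \<tau> at_top at_bot"
    if "strict_mono (\<lambda>t. e * \<tau> t)" "surj \<tau>" for \<tau> :: "real \<Rightarrow> real"
  proof -
    have "surj (\<lambda>t. - \<tau> t)"
    proof (rule surjI)
      show "- \<tau> (inv \<tau> (- s)) = s" for s by (simp add: surj_f_inv_f[OF that(2)])
    qed
    moreover have "strict_mono (\<lambda>t. - \<tau> t)" using that(1) e by simp
    ultimately show ?thesis
      unfolding filterlim_uminus_at_bot[of \<tau>] filterlim_uminus_at_top[of \<tau>]
      using filterlim_strict_mono_surj by blast
  qed
  then show thesis using assms(2) by (intro that[of "if F = at_top then at_bot else at_top"]) auto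
qed

lemma interior_disk_solution_tendsto:
  assumes "linear g" "disk_solution g y" "y s \<in> ball 0 1"
    and F: "\<And>Y. solution g Y \<Longrightarrow> (Y \<longlongrightarrow> 0) F"
  shows "(y \<longlongrightarrow> 0) F"
proof -
  obtain Y where Y: "solution g Y" "\<And>t. 1 - y s \<bullet> y s + Y t \<bullet> Y t > 0"
    "\<And>t. y t = (1 / sqrt (1 - y s \<bullet> y s + Y t \<bullet> Y t)) *\<^sub>R Y t"
    using disk_lift[OF assms(1,2), of s] by metis
  define c where "c = 1 - y s \<bullet> y s"
  have c: "c > 0" using assms(3) unfolding mem_disk_iff c_def by simp
  have "((\<lambda>t. (1 / sqrt (c + Y t \<bullet> Y t)) *\<^sub>R Y t) \<longlongrightarrow> (1 / sqrt (c + 0 \<bullet> (0::real^2))) *\<^sub>R 0) F"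
    using c by (intro tendsto_intros F Y(1)) auto
  moreover have "y = (\<lambda>t. (1 / sqrt (c + Y t \<bullet> Y t)) *\<^sub>R Y t)"
    unfolding c_def by (rule ext) (rule Y(3))
  ultimately show ?thesis by simp
qed

text \<open>All interior orbits of \<open>g\<close> tend to 0 in one time direction; so those of \<open>f\<close> tend to the preimage of 0
in one time direction. This preimage is 0, as the orbit of the equilibrium 0 of \<open>f\<close> shows.\<close>

lemma settling_transfer:
  assumes "linear f" "linear g" "same_portrait f g" "settling g" shows "settling f"
proof -
  obtain h k e where h: "homeomorphism (cball 0 1) (cball 0 1) h k" "h ` sphere 0 1 = sphere 0 1"
     "e = 1 \<or> e = -1" "carries_orbits e h f g" using assms(3) unfolding same_portrait_iff by metis
  have kh: "k (h u) = u" "h u \<in> cball 0 1" if "u \<in> cball 0 1" for u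
    using h(1) that unfolding homeomorphism_def by blast+
  have ks: "k ` sphere 0 1 = sphere 0 1" by (rule homeomorphism_sphere_inverse[OF h(1,2)])
  have inner: "h u \<in> ball 0 1" if "u \<in> ball 0 1" for u
  proof -
    have u: "u \<in> cball 0 1" "u \<notin> sphere 0 1" using that by auto
    then have "h u \<notin> sphere 0 1" using ks kh(1) by (metis imageI)
    then show ?thesis using kh(2)[OF u(1)] by auto
  qed
  obtain F :: "real filter" where F: "F = at_top \<or> F = at_bot" "\<And>Y. solution g Y \<Longrightarrow> (Y \<longlongrightarrow> 0) F"
    using assms(4) unfolding settling_def global_attractor_def global_repeller_def by metis
  obtain F' :: "real filter" where F': "F' = at_top \<or> F' = at_bot"
    "\<And>\<tau>. strict_mono (\<lambda>t. e * \<tau> t) \<Longrightarrow> surj \<tau> \<Longrightarrow> filterlim \<tau> F F'"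
    using filterlim_time_change[OF h(3) F(1)] by metis
  have "F' \<noteq> bot" using F'(1) trivial_limit_at_top_linorder trivial_limit_at_bot_linorder by metis
  \<comment> \<open>\<open>F'\<close> depends on the orientation only, not on the orbit, so all orbits settle in the same direction of time.\<close>
  have lim: "(x \<longlongrightarrow> k 0) F'" if x: "disk_solution f x" "x 0 \<in> ball 0 1" for x
  proof -
    obtain y \<tau> where y: "disk_solution g y" "strict_mono (\<lambda>t. e * \<tau> t)" "surj \<tau>" "\<And>t. h (x t) = y (\<tau> t)"
      using h(4) x(1) unfolding carries_orbits_def by metis
    have "y (\<tau> 0) \<in> ball 0 1" using inner[OF x(2)] y(4)[of 0] by simp
    then have "(y \<longlongrightarrow> 0) F" by (rule interior_disk_solution_tendsto[OF assms(2) y(1) _ F(2)])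
    then have "((\<lambda>t. y (\<tau> t)) \<longlongrightarrow> 0) F'" by (rule filterlim_compose) (rule F'(2)[OF y(2,3)])
    then have "((\<lambda>t. k (y (\<tau> t))) \<longlongrightarrow> k 0) F'"
      using h(1) disk_solution_mem[OF y(1)]
      by (intro continuous_on_tendsto_compose[of "cball 0 1" k]) (auto simp: homeomorphism_def)
    moreover have "k (y (\<tau> t)) = x t" for t
      using kh(1)[OF disk_solution_mem[OF x(1), of t]] y(4)[of t] by simp
    ultimately show ?thesis by simp
  qed
  have "disk_solution f (\<lambda>t. 0)"
    by (simp add: disk_solution_def solution_def disk_field_def linear_0[OF assms(1)])
  from lim[OF this] have k0: "k 0 = 0" using \<open>F' \<noteq> bot\<close> by (simp add: tendsto_const_iff)
  have "(x \<longlongrightarrow> 0) F'" if x: "solution f x" for x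
  proof -
    define X where "X t = (1 / sqrt (1 + x t \<bullet> x t)) *\<^sub>R x t" for t
    have pos: "1 + x t \<bullet> x t > 0" for t by (simp add: add_pos_nonneg)
    have "disk_solution f X" unfolding X_def by (rule disk_solution_of_linear[OF assms(1) x _ pos]) simp
    moreover have XX: "X t \<bullet> X t = (x t \<bullet> x t) / (1 + x t \<bullet> x t)" for t
      using pos[of t] by (simp add: X_def power2_eq_square flip: real_sqrt_mult)
    then have "X 0 \<bullet> X 0 < 1" using pos[of 0] by simp
    then have "X 0 \<in> ball 0 1" unfolding mem_disk_iff .
    ultimately have "(X \<longlongrightarrow> 0) F'" using lim k0 by metis
    then have "((\<lambda>t. (1 / sqrt (1 - X t \<bullet> X t)) *\<^sub>R X t) \<longlongrightarrow> (1 / sqrt (1 - 0 \<bullet> (0::real^2))) *\<^sub>R 0) F'"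
      by (intro tendsto_intros) auto
    moreover have "(1 / sqrt (1 - X t \<bullet> X t)) *\<^sub>R X t = x t" for t
    proof -
      have "1 - X t \<bullet> X t = 1 / (1 + x t \<bullet> x t)" using pos[of t] by (simp add: XX field_simps)
      then show ?thesis using pos[of t] by (simp add: X_def real_sqrt_divide)
    qed
    ultimately show ?thesis by simp
  qed
  then show ?thesis
    using F'(1) unfolding settling_def global_attractor_def global_repeller_def by metis
qed

lemma same_portrait_invariants:
  assumes "linear f" "linear g" "same_portrait f g"
  shows "det_of f \<noteq> 0 \<Longrightarrow> det_of g \<noteq> 0" "discriminant f > 0 \<Longrightarrow> discriminant g > 0" "discriminant f < 0 \<Longrightarrow> discriminant g < 0"
    "settling f \<longleftrightarrow> settling g"
proof -
  obtain h where h: "bij_betw h (equilibria f \<inter> sphere 0 1) (equilibria g \<inter> sphere 0 1)"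
    "bij_betw h (equilibria f \<inter> ball 0 1) (equilibria g \<inter> ball 0 1)"
    using same_portrait_equilibria[OF assms] .
  show "discriminant f > 0 \<Longrightarrow> discriminant g > 0"
    using disc_pos_iff_equilibria[OF assms(1)] disc_pos_iff_equilibria[OF assms(2)] bij_betw_same_card[OF h(1)] by simp
  show "discriminant f < 0 \<Longrightarrow> discriminant g < 0"
    using disc_neg_iff_equilibria[OF assms(1)] disc_neg_iff_equilibria[OF assms(2)] h(1) by (simp add: bij_betw_def)
  show "settling f \<longleftrightarrow> settling g"
    using settling_transfer[OF assms] settling_transfer[OF assms(2,1) same_portrait_sym[OF assms]] by blast
  show "det_of g \<noteq> 0" if "det_of f \<noteq> 0"
  proof -
    have "equilibria f \<inter> ball 0 1 = {0}" using that det_nonzero_iff_equilibria[OF assms(1)] by simp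
    then have "equilibria g \<inter> ball 0 1 = {h 0}" using h(2) by (simp add: bij_betw_def)
    moreover have "0 \<in> equilibria g \<inter> ball 0 1"
      unfolding equilibria_ball[OF assms(2)] by (simp add: linear_0[OF assms(2)])
    ultimately show ?thesis using det_nonzero_iff_equilibria[OF assms(2)] by simp
  qed
qed

section \<open>The phase portraits of saddles, nodes and foci\<close>

lemma disc_pos_of_det_neg: "det_of f < 0 \<Longrightarrow> discriminant f > 0"
  using zero_le_power2[of "trace_of f"] unfolding discriminant_def by linarith

lemma trace_nonzero_of_disc_pos: "det_of f > 0 \<Longrightarrow> discriminant f > 0 \<Longrightarrow> trace_of f \<noteq> 0"
  by (auto simp: discriminant_def)

lemma det_pos_of_disc_neg: "discriminant f < 0 \<Longrightarrow> det_of f > 0"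
  using zero_le_power2[of "trace_of f"] unfolding discriminant_def by linarith

lemma saddles_closed:
  assumes "f \<in> saddles" "linear g" "same_portrait f g" shows "g \<in> saddles"
proof -
  have f: "linear f" "det_of f < 0" "discriminant f > 0" using assms(1) disc_pos_of_det_neg by (auto simp: saddles_iff)
  note i = same_portrait_invariants[OF f(1) assms(2,3)]
  have "det_of g \<noteq> 0" "discriminant g > 0" "\<not> settling g"
    using i f settling_iff[OF f(1)] by auto
  then show ?thesis
    using settling_iff[OF assms(2)] trace_nonzero_of_disc_pos[of g] assms(2) by (auto simp: saddles_iff)
qed

lemma distinct_nodes_closed:
  assumes "f \<in> distinct_nodes" "linear g" "same_portrait f g" shows "g \<in> distinct_nodes"
proof -
  have f: "linear f" "det_of f > 0" "discriminant f > 0" using assms(1) by (auto simp: distinct_nodes_iff)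
  note i = same_portrait_invariants[OF f(1) assms(2,3)]
  have "discriminant g > 0" "settling g"
    using i f settling_iff[OF f(1)] trace_nonzero_of_disc_pos[of f] by auto
  then show ?thesis
    using settling_iff[OF assms(2)] assms(2) by (auto simp: distinct_nodes_iff)
qed

lemma foci_closed:
  assumes "f \<in> foci" "linear g" "same_portrait f g" shows "g \<in> foci"
proof -
  have f: "linear f" "discriminant f < 0" "trace_of f \<noteq> 0" using assms(1) by (auto simp: foci_iff)
  note i = same_portrait_invariants[OF f(1) assms(2,3)]
  have "discriminant g < 0" "settling g"
    using i f settling_iff[OF f(1)] det_pos_of_disc_neg[of f] by auto
  then show ?thesis
    using settling_iff[OF assms(2)] assms(2) by (auto simp: foci_iff)
qed

lemma phase_portrait_saddles: "f \<in> saddles \<Longrightarrow> phase_portrait f = saddles"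
  unfolding phase_portrait_def using same_portrait_saddles saddles_closed saddles_iff by blast

lemma phase_portrait_distinct_nodes: "f \<in> distinct_nodes \<Longrightarrow> phase_portrait f = distinct_nodes"
  unfolding phase_portrait_def using same_portrait_nodes distinct_nodes_closed distinct_nodes_iff by blast

lemma phase_portrait_foci: "f \<in> foci \<Longrightarrow> phase_portrait f = foci"
  unfolding phase_portrait_def using same_portrait_foci foci_closed foci_iff by blast

lemma mem_phase_portrait: "linear f \<Longrightarrow> f \<in> phase_portrait f"
  unfolding phase_portrait_def using same_portrait_refl by blast

section \<open>Invariant lines\<close>

text \<open>The solution through \<open>v\<close> stays on the line of \<open>v\<close> only if its initial velocity \<open>f v\<close> lies
on that line.\<close>

lemma mem_invariant_lines_iff:
  assumes "linear f"
  shows "L \<in> invariant_lines f \<longleftrightarrow> (\<exists>v l. v \<noteq> 0 \<and> L = span {v} \<and> f v = l *\<^sub>R v)"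
proof
  assume L: "L \<in> invariant_lines f"
  then obtain v where v: "v \<noteq> 0" "L = span {v}"
    and inv: "\<And>x t. solution f x \<Longrightarrow> x 0 \<in> L \<Longrightarrow> x t \<in> L"
    unfolding invariant_lines_def by blast
  obtain x where x: "solution f x" "x 0 = v" using solution_exists[OF assms] by metis
  have "v \<in> L" unfolding v(2) by (simp add: span_base)
  then have "x t \<in> span {v}" for t using inv[OF x(1)] x(2) v(2) by metis
  then have zero: "cross2 (x t) v = 0" for t
  proof -
    obtain r where "x t = r *\<^sub>R v" using \<open>x t \<in> span {v}\<close> by (auto simp: span_singleton)
    then show ?thesis by (simp add: cross2_def)
  qed
  have "(x has_vector_derivative f (x 0)) (at 0)" using x(1) by (simp add: solution_def)
  then have "((\<lambda>t. x t $ 1 * v $ 2 - x t $ 2 * v $ 1) has_real_derivative f v $ 1 * v $ 2 - f v $ 2 * v $ 1) (at 0)"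
    unfolding has_vector_derivative_vec2_iff x(2) by (auto intro!: derivative_eq_intros)
  then have "((\<lambda>t. cross2 (x t) v) has_real_derivative cross2 (f v) v) (at 0)" by (simp add: cross2_def)
  then have "((\<lambda>t::real. 0) has_real_derivative cross2 (f v) v) (at 0)" by (simp add: zero)
  then have "cross2 (f v) v = 0" using DERIV_unique DERIV_const by blast
  then obtain l where "f v = l *\<^sub>R v" using cross2_eq_0 v(1) by metis
  then show "\<exists>v l. v \<noteq> 0 \<and> L = span {v} \<and> f v = l *\<^sub>R v" using v by blast
next
  assume "\<exists>v l. v \<noteq> 0 \<and> L = span {v} \<and> f v = l *\<^sub>R v"
  then obtain v l where v: "v \<noteq> 0" "L = span {v}" "f v = l *\<^sub>R v" by blast
  have "x t \<in> L" if x: "solution f x" "x 0 \<in> L" for x t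
  proof -
    obtain r where r: "x 0 = r *\<^sub>R v" using x(2) v(2) by (auto simp: span_singleton)
    have "solution f (\<lambda>t. r *\<^sub>R (exp (l * t) *\<^sub>R v))"
      by (rule solution_scaleR[OF assms solution_eigenvector[OF assms v(3)]])
    then have "x t = r *\<^sub>R (exp (l * t) *\<^sub>R v)"
      by (rule solution_unique[OF assms x(1), of _ 0]) (simp add: r)
    then show ?thesis by (auto simp: v(2) span_singleton)
  qed
  then show "L \<in> invariant_lines f" using v unfolding invariant_lines_def by blast
qed

lemma span_scaleR_singleton: "r \<noteq> 0 \<Longrightarrow> span {r *\<^sub>R v} = span {v :: real^2}"
proof -
  assume r: "r \<noteq> 0"
  show ?thesis
    unfolding span_singleton
  proof (intro subset_antisym image_subsetI)
    show "k *\<^sub>R (r *\<^sub>R v) \<in> range (\<lambda>k. k *\<^sub>R v)" for k by (rule range_eqI[of _ _ "k * r"]) simp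
    show "k *\<^sub>R v \<in> range (\<lambda>k. k *\<^sub>R (r *\<^sub>R v))" for k by (rule range_eqI[of _ _ "k / r"]) (use r in simp)
  qed
qed

lemma invariant_lines_disc_pos:
  assumes "linear f" "discriminant f > 0" shows "finite (invariant_lines f)" "card (invariant_lines f) = 2"
proof -
  obtain l m v w where *: "l < m" "v \<noteq> 0" "w \<noteq> 0" "f v = l *\<^sub>R v" "f w = m *\<^sub>R w"
    using distinct_eigenvectors[OF assms] by metis
  have "invariant_lines f = {span {v}, span {w}}"
  proof (intro set_eqI iffI)
    fix L assume "L \<in> invariant_lines f"
    then obtain u k where u: "u \<noteq> 0" "L = span {u}" "f u = k *\<^sub>R u" using mem_invariant_lines_iff[OF assms(1)] by blast
    show "L \<in> {span {v}, span {w}}"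
      by (rule eigenvector_multiple[OF assms(1) less_imp_neq[OF *(1)] *(4,5,2,3) u(3,1)])
         (auto simp: u(2) span_scaleR_singleton)
  next
    fix L assume "L \<in> {span {v}, span {w}}"
    then show "L \<in> invariant_lines f" using * mem_invariant_lines_iff[OF assms(1)] by blast
  qed
  moreover have "span {v} \<noteq> span {w}"
  proof
    assume "span {v} = span {w}"
    then have "v \<in> span {w}" using span_base[of v "{v}"] by simp
    then obtain r where r: "v = r *\<^sub>R w" by (auto simp: span_singleton)
    have "f v = m *\<^sub>R v" using *(5) by (simp add: r linear_scale[OF assms(1)] mult.commute)
    then have "l *\<^sub>R v = m *\<^sub>R v" using *(4) by simp
    then show False using *(1,2) by simp
  qed
  ultimately show "finite (invariant_lines f)" "card (invariant_lines f) = 2" by simp_all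
qed

lemma invariant_lines_disc_neg:
  assumes "linear f" "discriminant f < 0" shows "invariant_lines f = {}"
  using mem_invariant_lines_iff[OF assms(1)] no_real_eigenvector[OF assms] by blast

section \<open>The index at the origin\<close>

lemma winding_number_power_loop:
  assumes "p \<noteq> 0"
  shows "winding_number (\<lambda>t. p * exp (of_int k * (2 * of_real pi * \<i>) * of_real t)) 0 = of_int k"
proof -
  define c where "c = of_int k * (2 * of_real pi * \<i>)"
  define g where "g = (\<lambda>t. p * exp (c * of_real t))"
  have d: "(g has_vector_derivative c * g t) (at t)" for t
    unfolding g_def by (auto intro!: derivative_eq_intros has_vector_derivative_real_field simp: algebra_simps)
  have "g C1_differentiable_on {0..1}"
    unfolding C1_differentiable_on_def using d
    by (intro exI[of _ "\<lambda>t. c * g t"]) (auto simp: g_def intro!: continuous_intros)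
  then have vp: "valid_path g" by (simp add: valid_path_def C1_differentiable_imp_piecewise)
  have nz: "g t \<noteq> 0" for t using assms by (simp add: g_def)
  have "((\<lambda>w. 1 / w) has_contour_integral c) g"
    unfolding has_contour_integral_def
  proof (rule has_integral_eq)
    show "((\<lambda>t::real. c) has_integral c) {0..1}" using has_integral_const_real[of c 0 1] by simp
    show "c = 1 / g t * vector_derivative g (at t within {0..1})" if "t \<in> {0..1}" for t
    proof -
      have "vector_derivative g (at t within {0..1}) = c * g t"
        using that by (intro vector_derivative_at_within_ivl[OF d]) auto
      then show ?thesis using nz[of t] by simp
    qed
  qed
  then have "contour_integral g (\<lambda>w. 1 / w) = c" by (rule contour_integral_unique)
  moreover have "winding_number g 0 = 1 / (2 * pi * \<i>) * contour_integral g (\<lambda>w. 1 / (w - 0))"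
    using vp nz by (intro winding_number_valid_path) (auto simp: path_image_def)
  ultimately show ?thesis by (simp add: c_def g_def)
qed

text \<open>The values of \<open>m E + n cnj E\<close> and of its dominant term \<open>m E\<close> always lie in a common open half
plane, so the segment between them avoids 0 and the two loops are homotopic.\<close>

lemma winding_number_dominant:
  fixes m n :: complex and k :: int
  assumes "norm n < norm m"
  defines "E \<equiv> \<lambda>t::real. exp (of_int k * (2 * of_real pi * \<i>) * of_real t)"
  shows "winding_number (\<lambda>t. sgn (m * E t + n * cnj (E t))) 0 = of_int k"
proof -
  have m: "m \<noteq> 0" using assms(1) by auto
  have E1: "norm (E t) = 1" for t by (simp add: E_def norm_exp_eq_Re)
  have E01: "E 1 = E 0"
    using exp_integer_2pi[of "of_int k"] by (simp add: E_def mult.assoc mult.commute mult.left_commute)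
  have cE: "continuous_on S E" for S unfolding E_def by (intro continuous_intros)
  define g where "g = (\<lambda>t. m * E t + n * cnj (E t))"
  have zz: "cnj z * z = of_real ((norm z)\<^sup>2)" for z by (simp only: complex_norm_square mult.commute)
  have pos: "0 < Re (cnj (m * E t) * g t)" for t
  proof -
    have "cnj (m * E t) * g t = of_real ((norm (m * E t))\<^sup>2) + cnj (m * E t) * (n * cnj (E t))"
      unfolding g_def distrib_left zz ..
    moreover have "Re (cnj (m * E t) * (n * cnj (E t))) \<ge> - norm (cnj (m * E t) * (n * cnj (E t)))"
      using abs_Re_le_cmod[of "cnj (m * E t) * (n * cnj (E t))"] by linarith
    moreover have "norm (cnj (m * E t) * (n * cnj (E t))) = norm m * norm n" by (simp add: norm_mult E1)
    moreover have "norm m * norm n < (norm (m * E t))\<^sup>2"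
      using assms(1) m by (simp add: norm_mult E1 power2_eq_square)
    ultimately show ?thesis by simp
  qed
  have g0: "g t \<noteq> 0" for t using pos[of t] by auto
  have seg: "closed_segment (sgn (g t)) (m * E t) \<subseteq> - {0}" for t
  proof
    fix z assume "z \<in> closed_segment (sgn (g t)) (m * E t)"
    then obtain s where s: "0 \<le> s" "s \<le> 1" "z = (1 - s) *\<^sub>R sgn (g t) + s *\<^sub>R (m * E t)"
      by (auto simp: closed_segment_def)
    have a: "0 < Re (cnj (m * E t) * sgn (g t))"
      using pos[of t] g0[of t] by (simp add: sgn_div_norm field_simps)
    have b: "0 < Re (cnj (m * E t) * (m * E t))"
      unfolding zz using m E1[of t] by (simp add: norm_mult)
    have "Re (cnj (m * E t) * z) = (1 - s) * Re (cnj (m * E t) * sgn (g t)) + s * Re (cnj (m * E t) * (m * E t))"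
      unfolding s(3) by (simp add: distrib_left mult_scaleR_right)
    also have "\<dots> > 0"
    proof (cases "s = 0")
      case False
      then show ?thesis using s a b by (intro add_nonneg_pos) auto
    qed (use a in simp)
    finally show "z \<in> - {0}" by auto
  qed
  have "homotopic_loops (- {0}) (\<lambda>t. sgn (g t)) (\<lambda>t. m * E t)"
  proof (rule homotopic_loops_linear)
    show "path (\<lambda>t. sgn (g t))" "path (\<lambda>t. m * E t)"
      unfolding path_def using g0 by (auto simp: g_def intro!: continuous_intros cE)
    show "pathfinish (\<lambda>t. sgn (g t)) = pathstart (\<lambda>t. sgn (g t))" "pathfinish (\<lambda>t. m * E t) = pathstart (\<lambda>t. m * E t)"
      by (simp_all add: pathfinish_def pathstart_def g_def E01)
  qed (rule seg)
  then have "winding_number (\<lambda>t. sgn (g t)) 0 = winding_number (\<lambda>t. m * E t) 0"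
    by (rule winding_number_homotopic_loops)
  also have "\<dots> = of_int k" unfolding E_def by (rule winding_number_power_loop[OF m])
  finally show ?thesis by (simp add: g_def)
qed

lemma to_complex_scaleR: "to_complex (r *\<^sub>R v) = r *\<^sub>R to_complex v"
  by (simp add: to_complex_def complex_eq_iff)

lemma to_complex_sgn: "to_complex (sgn v) = sgn (to_complex v)"
proof -
  have "norm v = norm (to_complex v)"
    by (simp add: norm_eq_sqrt_inner[of v] inner2 to_complex_def complex_norm power2_eq_square)
  then show ?thesis by (simp add: sgn_div_norm to_complex_scaleR)
qed

text \<open>Every real linear map of the complex plane is the sum of a complex linear and an antilinear one.\<close>

lemma to_complex_lin2:
  "to_complex (lin2 a b c d v) =
     Complex ((a + d) / 2) ((c - b) / 2) * to_complex v + Complex ((a - d) / 2) ((c + b) / 2) * cnj (to_complex v)"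
  by (simp add: to_complex_def complex_eq_iff field_simps)

lemma to_complex_circle_point: "to_complex (circle_point t) = exp (of_int 1 * (2 * of_real pi * \<i>) * of_real t)"
  by (simp add: to_complex_def circle_point_def complex_eq_iff Re_exp Im_exp)

lemma has_index_linear:
  assumes "linear f" "det_of f \<noteq> 0"
  shows "has_index f 0 (if det_of f > 0 then 1 else -1)"
proof -
  obtain a b c d where f: "f = lin2 a b c d" using linear_imp_lin2[OF assms(1)] .
  define p q where "p = Complex ((a + d) / 2) ((c - b) / 2)" and "q = Complex ((a - d) / 2) ((c + b) / 2)"
  define E where "E k t = exp (of_int k * (2 * of_real pi * \<i>) * of_real t)" for k :: int and t :: real
  have pq: "(norm p)\<^sup>2 - (norm q)\<^sup>2 = det_of f"
    unfolding p_def q_def f cmod_power2 by (simp add: field_simps power2_eq_square)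
  have cE: "cnj (E k t) = E (- k) t" for k t by (simp add: E_def exp_cnj)
  have path: "to_complex (sgn (f (0 + r *\<^sub>R circle_point t))) = sgn (p * E 1 t + q * cnj (E 1 t))" if "r > 0" for r t
  proof -
    have s: "sgn (f (0 + r *\<^sub>R circle_point t)) = sgn (f (circle_point t))"
      using that by (simp add: linear_scale[OF assms(1)] sgn_scaleR)
    show ?thesis
      unfolding s to_complex_sgn by (simp only: f to_complex_lin2 to_complex_circle_point p_def q_def E_def)
  qed
  have wind: "winding_number (\<lambda>t. to_complex (sgn (f (0 + r *\<^sub>R circle_point t)))) 0 =
      of_int (if det_of f > 0 then 1 else -1)" if r: "r > 0" for r
  proof (cases "det_of f > 0")
    case True
    then have "(norm q)\<^sup>2 < (norm p)\<^sup>2" using pq by linarith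
    then have "norm q < norm p" by (rule power2_less_imp_less) simp
    then have "winding_number (\<lambda>t. sgn (p * E 1 t + q * cnj (E 1 t))) 0 = of_int 1"
      unfolding E_def by (rule winding_number_dominant)
    then show ?thesis unfolding path[OF r] using True by (simp only: if_True)
  next
    case False
    then have "(norm p)\<^sup>2 < (norm q)\<^sup>2" using pq assms(2) by linarith
    then have "norm p < norm q" by (rule power2_less_imp_less) simp
    then have "winding_number (\<lambda>t. sgn (q * E (-1) t + p * cnj (E (-1) t))) 0 = of_int (-1)"
      unfolding E_def by (rule winding_number_dominant)
    moreover have "p * E 1 t + q * cnj (E 1 t) = q * E (-1) t + p * cnj (E (-1) t)" for t
      by (simp add: cE)
    ultimately show ?thesis unfolding path[OF r] using False by (simp only: if_False)
  qed
  have "continuous_on (cball 0 1) f" using assms(1) linear_continuous_on linear_conv_bounded_linear by blast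
  moreover have "f z \<noteq> 0" if "z \<in> cball 0 1 - {0}" for z
    using det_nonzero_imp_inj[OF assms, of z] that by auto
  ultimately show ?thesis
    unfolding has_index_def using wind linear_0[OF assms(1)] by (intro conjI exI[of _ 1]) auto
qed

lemma has_index_unique:
  assumes "has_index f p k" "has_index f p k'" shows "k = k'"
proof -
  let ?w = "\<lambda>r. winding_number (\<lambda>t. to_complex (sgn (f (p + r *\<^sub>R circle_point t)))) 0"
  obtain e where e: "e > 0" "\<And>r. 0 < r \<Longrightarrow> r \<le> e \<Longrightarrow> ?w r = of_int k" using assms(1) unfolding has_index_def by blast
  obtain e' where e': "e' > 0" "\<And>r. 0 < r \<Longrightarrow> r \<le> e' \<Longrightarrow> ?w r = of_int k'" using assms(2) unfolding has_index_def by blast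
  have "?w (min e e') = of_int k" by (rule e(2)) (use e(1) e'(1) in auto)
  moreover have "?w (min e e') = of_int k'" by (rule e'(2)) (use e(1) e'(1) in auto)
  ultimately have "complex_of_int k = of_int k'" by simp
  then show ?thesis by simp
qed

lemma saddles_index_lines: "f \<in> saddles \<Longrightarrow> has_index_and_lines f (-1) 2"
  using has_index_linear[of f] invariant_lines_disc_pos[of f] disc_pos_of_det_neg[of f]
  by (auto simp: saddles_iff has_index_and_lines_def)

lemma distinct_nodes_index_lines: "f \<in> distinct_nodes \<Longrightarrow> has_index_and_lines f 1 2"
  using has_index_linear[of f] invariant_lines_disc_pos[of f]
  by (auto simp: distinct_nodes_iff has_index_and_lines_def)

lemma foci_index_lines: "f \<in> foci \<Longrightarrow> has_index_and_lines f 1 0"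
  using has_index_linear[of f] invariant_lines_disc_neg[of f] det_pos_of_disc_neg[of f]
  by (auto simp: foci_iff has_index_and_lines_def)

lemma classes_disjoint:
  "saddles \<inter> distinct_nodes = {}" "saddles \<inter> foci = {}" "distinct_nodes \<inter> foci = {}"
  using det_pos_of_disc_neg by (force simp: saddles_iff distinct_nodes_iff foci_iff)+

lemma classes_distinct:
  "saddles \<noteq> distinct_nodes" "saddles \<noteq> foci" "distinct_nodes \<noteq> foci"
proof -
  have "lin2 1 0 0 (-1) \<in> saddles" "lin2 1 0 0 2 \<in> distinct_nodes" by (simp_all add: saddles_iff distinct_nodes_iff)
  then show "saddles \<noteq> distinct_nodes" "saddles \<noteq> foci" "distinct_nodes \<noteq> foci"
    using classes_disjoint by blast+
qed

lemma phase_portrait_determined_by_index_lines: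
  assumes "f \<in> saddles \<union> distinct_nodes \<union> foci"
  shows "(phase_portrait f = saddles \<longleftrightarrow> has_index_and_lines f (-1) 2) \<and>
    (phase_portrait f = distinct_nodes \<longleftrightarrow> has_index_and_lines f 1 2) \<and>
    (phase_portrait f = foci \<longleftrightarrow> has_index_and_lines f 1 0)"
proof -
  have u: "i = j \<and> l = l'" if "has_index_and_lines f i l" "has_index_and_lines f j l'" for i j l l'
    using that has_index_unique unfolding has_index_and_lines_def by blast
  have "\<not> has_index_and_lines f j l'" if "has_index_and_lines f i l" "(i, l) \<noteq> (j, l')" for i j l l'
    using u[OF that(1), of j l'] that(2) by blast
  note n = this
  from assms consider "f \<in> saddles" | "f \<in> distinct_nodes" | "f \<in> foci" by blast
  then show ?thesis
  proof cases
    case 1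
    from n[OF saddles_index_lines[OF 1]] show ?thesis
      using saddles_index_lines[OF 1] phase_portrait_saddles[OF 1] classes_distinct by simp
  next
    case 2
    from n[OF distinct_nodes_index_lines[OF 2]] show ?thesis
      using distinct_nodes_index_lines[OF 2] phase_portrait_distinct_nodes[OF 2] classes_distinct by simp
  next
    case 3
    from n[OF foci_index_lines[OF 3]] show ?thesis
      using foci_index_lines[OF 3] phase_portrait_foci[OF 3] classes_distinct by simp
  qed
qed

section \<open>Four independent standard normal variables\<close>

definition gauss :: "real measure" where
  "gauss = density lborel (\<lambda>x. ennreal (normal_density 0 1 x))"

lemma sets_gauss [simp, measurable_cong]: "sets gauss = sets borel"
  by (simp add: gauss_def)

lemma space_gauss [simp]: "space gauss = UNIV"
  by (simp add: gauss_def)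

global_interpretation gauss: prob_space gauss
  unfolding gauss_def by (rule prob_space_normal_density) simp

lemma nn_integral_gauss:
  assumes [measurable]: "f \<in> borel_measurable borel"
  shows "(\<integral>\<^sup>+x. f x \<partial>gauss) = (\<integral>\<^sup>+x. ennreal (normal_density 0 1 x) * f x \<partial>lborel)"
  unfolding gauss_def by (subst nn_integral_density) simp_all

lemma nn_integral_gauss_uminus:
  assumes [measurable]: "f \<in> borel_measurable borel"
  shows "(\<integral>\<^sup>+x. f (- x) \<partial>gauss) = (\<integral>\<^sup>+x. f x \<partial>gauss)"
proof -
  have "(\<integral>\<^sup>+x. f x \<partial>gauss) = (\<integral>\<^sup>+x. ennreal (normal_density 0 1 x) * f x \<partial>lborel)"
    by (rule nn_integral_gauss) fact
  also have "\<dots> = (\<integral>\<^sup>+x. ennreal (normal_density 0 1 (- x)) * f (- x) \<partial>lborel)"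
    by (subst nn_integral_real_affine[where c = "-1" and t = 0]) simp_all
  also have "\<dots> = (\<integral>\<^sup>+x. ennreal (normal_density 0 1 x) * f (- x) \<partial>lborel)"
    by (simp add: std_normal_density_def)
  also have "\<dots> = (\<integral>\<^sup>+x. f (- x) \<partial>gauss)" by (rule nn_integral_gauss[symmetric]) simp
  finally show ?thesis ..
qed

lemma AE_gauss_neq: "AE x in gauss. x \<noteq> c"
  unfolding gauss_def using AE_lborel_singleton[of c] by (subst AE_density) auto

lemma emeasure_gauss_finite:
  assumes "finite S" shows "emeasure gauss S = 0"
proof -
  have "AE x in gauss. x \<notin> S"
    using assms
  proof (induction S)
    case (insert c S)
    then show ?case using AE_gauss_neq[of c] by (auto elim: AE_mp)
  qed simp
  moreover have "S \<in> sets gauss" using assms by (simp add: finite_imp_closed)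
  ultimately show ?thesis by (subst (asm) AE_iff_measurable[of S]) auto
qed

text \<open>The expectation of a function of the four entries of the matrix with rows \<open>(a, b)\<close> and \<open>(c, d)\<close>. The order of
integration keeps the pairs \<open>(a, d)\<close> and \<open>(b, c)\<close> together, which are the ones to be rotated.\<close>

definition gauss4 :: "(real \<times> real \<times> real \<times> real \<Rightarrow> ennreal) \<Rightarrow> ennreal" where
  "gauss4 f = (\<integral>\<^sup>+c. \<integral>\<^sup>+b. \<integral>\<^sup>+d. \<integral>\<^sup>+a. f (a, b, c, d) \<partial>gauss \<partial>gauss \<partial>gauss \<partial>gauss)"

abbreviation borel4 :: "(real \<times> real \<times> real \<times> real) measure" where
  "borel4 \<equiv> borel \<Otimes>\<^sub>M borel \<Otimes>\<^sub>M borel \<Otimes>\<^sub>M borel"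

lemma gauss4_neg_row:
  assumes [measurable]: "f \<in> borel_measurable borel4"
  shows "gauss4 (\<lambda>(a, b, c, d). f (- a, - b, c, d)) = gauss4 f"
proof -
  have "(\<integral>\<^sup>+b. \<integral>\<^sup>+d. \<integral>\<^sup>+a. f (- a, - b, c, d) \<partial>gauss \<partial>gauss \<partial>gauss) =
      (\<integral>\<^sup>+b. \<integral>\<^sup>+d. \<integral>\<^sup>+a. f (a, b, c, d) \<partial>gauss \<partial>gauss \<partial>gauss)" for c
  proof -
    have "(\<integral>\<^sup>+a. f (- a, b, c, d) \<partial>gauss) = (\<integral>\<^sup>+a. f (a, b, c, d) \<partial>gauss)" for b d
      by (rule nn_integral_gauss_uminus) measurable
    then have "(\<integral>\<^sup>+b. \<integral>\<^sup>+d. \<integral>\<^sup>+a. f (- a, - b, c, d) \<partial>gauss \<partial>gauss \<partial>gauss) =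
      (\<integral>\<^sup>+b. \<integral>\<^sup>+d. \<integral>\<^sup>+a. f (a, - b, c, d) \<partial>gauss \<partial>gauss \<partial>gauss)" by simp
    also have "\<dots> = (\<integral>\<^sup>+b. \<integral>\<^sup>+d. \<integral>\<^sup>+a. f (a, b, c, d) \<partial>gauss \<partial>gauss \<partial>gauss)"
      by (rule nn_integral_gauss_uminus) measurable
    finally show ?thesis .
  qed
  then show ?thesis by (simp add: gauss4_def)
qed

lemma gauss4_neg:
  assumes [measurable]: "f \<in> borel_measurable borel4"
  shows "gauss4 (\<lambda>(a, b, c, d). f (- a, - b, - c, - d)) = gauss4 f"
proof -
  have "gauss4 (\<lambda>(a, b, c, d). f (- a, - b, - c, - d)) = gauss4 (\<lambda>(a, b, c, d). f (a, b, - c, - d))"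
    using gauss4_neg_row[of "\<lambda>(a, b, c, d). f (a, b, - c, - d)"] by simp
  also have "\<dots> = (\<integral>\<^sup>+c. \<integral>\<^sup>+b. \<integral>\<^sup>+d. \<integral>\<^sup>+a. f (a, b, - c, d) \<partial>gauss \<partial>gauss \<partial>gauss \<partial>gauss)"
  proof -
    have "(\<integral>\<^sup>+d. \<integral>\<^sup>+a. f (a, b, - c, - d) \<partial>gauss \<partial>gauss) = (\<integral>\<^sup>+d. \<integral>\<^sup>+a. f (a, b, - c, d) \<partial>gauss \<partial>gauss)" for b c
      by (rule nn_integral_gauss_uminus) measurable
    then show ?thesis by (simp add: gauss4_def)
  qed
  also have "\<dots> = gauss4 f"
    unfolding gauss4_def by (rule nn_integral_gauss_uminus) measurable
  finally show ?thesis .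
qed

text \<open>A set is negligible if for almost every choice of the other entries only finitely many values of
\<open>a\<close> are left.\<close>

lemma gauss4_null:
  assumes "\<And>b c d. d \<noteq> 0 \<Longrightarrow> finite {a. (a, b, c, d) \<in> S}"
  shows "gauss4 (indicator S) = 0"
proof -
  have "(\<integral>\<^sup>+a. indicator S (a, b, c, d) \<partial>gauss) = 0" if "d \<noteq> 0" for b c d
  proof -
    let ?T = "{a. (a, b, c, d) \<in> S}"
    have "(\<integral>\<^sup>+a. indicator S (a, b, c, d) \<partial>gauss) = (\<integral>\<^sup>+a. indicator ?T a \<partial>gauss)"
      by (intro nn_integral_cong) (auto simp: indicator_def)
    also have "\<dots> = emeasure gauss ?T" using assms[OF that] by (simp add: finite_imp_closed)
    finally show ?thesis using emeasure_gauss_finite[OF assms[OF that]] by simp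
  qed
  then have "(\<integral>\<^sup>+d. \<integral>\<^sup>+a. indicator S (a, b, c, d) \<partial>gauss \<partial>gauss) = (\<integral>\<^sup>+d. 0 \<partial>gauss)" for b c
    using AE_gauss_neq[of 0] by (intro nn_integral_cong_AE) auto
  then show ?thesis by (simp add: gauss4_def)
qed

lemma emeasure_gauss4:
  fixes X :: "nat \<Rightarrow> 'w \<Rightarrow> real"
  assumes "prob_space M" "\<And>i. i \<in> {..<4} \<Longrightarrow> distributed M lborel (X i) (\<lambda>x. ennreal (normal_density 0 1 x))"
    and indep: "prob_space.indep_vars M (\<lambda>_. borel) X {..<4}"
    and [measurable]: "S \<in> sets borel4"
  shows "emeasure M {\<omega> \<in> space M. (X 0 \<omega>, X 1 \<omega>, X 2 \<omega>, X 3 \<omega>) \<in> S} = gauss4 (indicator S)"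
proof -
  interpret prob_space M by fact
  have X: "X i \<in> borel_measurable M" if "i \<in> {..<4}" for i
    using distributed_measurable[OF assms(2)[OF that]] by simp
  have [measurable]: "X 0 \<in> borel_measurable M" "X 1 \<in> borel_measurable M" "X 2 \<in> borel_measurable M" "X 3 \<in> borel_measurable M"
    by (rule X; simp)+
  have marginal: "distr M borel (X i) = gauss" if "i \<in> {..<4}" for i
  proof -
    have "distr M borel (X i) = distr M lborel (X i)" by (rule distr_cong) simp_all
    then show ?thesis using distributed_distr_eq_density[OF assms(2)[OF that]] by (simp add: gauss_def)
  qed
  have law: "distr M (\<Pi>\<^sub>M i\<in>{..<4}. borel) (\<lambda>\<omega>. \<lambda>i\<in>{..<4}. X i \<omega>) = (\<Pi>\<^sub>M i\<in>{..<4::nat}. gauss)"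
  proof -
    have "{..<4::nat} \<noteq> {}" by (simp add: lessThan_empty_iff)
    from iffD1[OF indep_vars_iff_distr_eq_PiM'[OF this X] indep]
    have "distr M (\<Pi>\<^sub>M i\<in>{..<4}. borel) (\<lambda>\<omega>. \<lambda>i\<in>{..<4}. X i \<omega>) = (\<Pi>\<^sub>M i\<in>{..<4::nat}. distr M borel (X i))"
      by simp
    also have "\<dots> = (\<Pi>\<^sub>M i\<in>{..<4::nat}. gauss)" by (rule PiM_cong) (use marginal in auto)
    finally show ?thesis .
  qed
  \<comment> \<open>The order of insertion fixes the order of integration, the entry \<open>a\<close> with index 0 being innermost.\<close>
  have I: "{..<4} = {2, 1, 3, 0::nat}" by auto
  interpret P: product_sigma_finite "\<lambda>i::nat. gauss" by standard
  have "emeasure M {\<omega> \<in> space M. (X 0 \<omega>, X 1 \<omega>, X 2 \<omega>, X 3 \<omega>) \<in> S} =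
      (\<integral>\<^sup>+\<omega>. indicator S (X 0 \<omega>, X 1 \<omega>, X 2 \<omega>, X 3 \<omega>) \<partial>M)"
  proof -
    let ?A = "{\<omega> \<in> space M. (X 0 \<omega>, X 1 \<omega>, X 2 \<omega>, X 3 \<omega>) \<in> S}"
    have "?A \<in> sets M" by measurable
    then have "emeasure M ?A = (\<integral>\<^sup>+\<omega>. indicator ?A \<omega> \<partial>M)" by (rule nn_integral_indicator[symmetric])
    also have "\<dots> = (\<integral>\<^sup>+\<omega>. indicator S (X 0 \<omega>, X 1 \<omega>, X 2 \<omega>, X 3 \<omega>) \<partial>M)"
      by (intro nn_integral_cong) (simp add: indicator_def)
    finally show ?thesis .
  qed
  also have "\<dots> = (\<integral>\<^sup>+x. indicator S (x 0, x 1, x 2, x 3)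
      \<partial>distr M (\<Pi>\<^sub>M i\<in>{..<4}. borel) (\<lambda>\<omega>. \<lambda>i\<in>{..<4}. X i \<omega>))"
    using X by (subst nn_integral_distr) (auto intro!: measurable_restrict)
  also have "\<dots> = (\<integral>\<^sup>+x. indicator S (x 0, x 1, x 2, x 3) \<partial>(\<Pi>\<^sub>M i\<in>{2, 1, 3, 0::nat}. gauss))"
    unfolding law unfolding I ..
  also have "\<dots> = gauss4 (indicator S)"
    unfolding gauss4_def
    by (simp add: P.product_nn_integral_insert_rev PiM_empty)
  finally show ?thesis .
qed

section \<open>Rotation invariance and the probability of a cone\<close>

lemma mult_pairs: "k * x * (k * y) = k * k * (x * (y::real))"
  by (simp add: mult_ac)

text \<open>The rotation by 45 degrees is carried out by one affine substitution in each variable; the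
standard normal density of the plane depends on the radius only.\<close>

lemma gauss_rotate:
  assumes [measurable]: "case_prod f \<in> borel_measurable (borel \<Otimes>\<^sub>M borel)"
  shows "(\<integral>\<^sup>+y. \<integral>\<^sup>+x. f x y \<partial>gauss \<partial>gauss) =
    (\<integral>\<^sup>+t. \<integral>\<^sup>+s. f ((s + t) / sqrt 2) ((s - t) / sqrt 2) \<partial>gauss \<partial>gauss)"
proof -
  let ?n = "normal_density 0 1"
  define g where "g x y = ennreal (?n x * ?n y) * f x y" for x y
  have [measurable]: "case_prod g \<in> borel_measurable (borel \<Otimes>\<^sub>M borel)"
    unfolding g_def by measurable
  have gauss2: "(\<integral>\<^sup>+y. \<integral>\<^sup>+x. h x y \<partial>gauss \<partial>gauss) = (\<integral>\<^sup>+y. \<integral>\<^sup>+x. ennreal (?n x * ?n y) * h x y \<partial>lborel \<partial>lborel)"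
    if [measurable]: "case_prod h \<in> borel_measurable (borel \<Otimes>\<^sub>M borel)" for h
  proof -
    have "(\<integral>\<^sup>+y. \<integral>\<^sup>+x. h x y \<partial>gauss \<partial>gauss) = (\<integral>\<^sup>+y. ennreal (?n y) * (\<integral>\<^sup>+x. h x y \<partial>gauss) \<partial>lborel)"
      by (rule nn_integral_gauss) measurable
    also have "\<dots> = (\<integral>\<^sup>+y. ennreal (?n y) * (\<integral>\<^sup>+x. ennreal (?n x) * h x y \<partial>lborel) \<partial>lborel)"
      by (subst nn_integral_gauss) simp_all
    also have "\<dots> = (\<integral>\<^sup>+y. \<integral>\<^sup>+x. ennreal (?n x * ?n y) * h x y \<partial>lborel \<partial>lborel)"
      by (subst nn_integral_cmult[symmetric]) (simp_all add: ennreal_mult mult_ac)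
    finally show ?thesis .
  qed
  have "(\<integral>\<^sup>+y. \<integral>\<^sup>+x. f x y \<partial>gauss \<partial>gauss) = (\<integral>\<^sup>+y. \<integral>\<^sup>+x. g x y \<partial>lborel \<partial>lborel)"
    unfolding g_def by (rule gauss2) measurable
  also have "\<dots> = (\<integral>\<^sup>+y. ennreal (sqrt 2) * (\<integral>\<^sup>+s. g (- y + sqrt 2 * s) y \<partial>lborel) \<partial>lborel)"
    by (intro nn_integral_cong) (subst nn_integral_real_affine[where c = "sqrt 2" and t = "- y" for y], simp_all)
  also have "\<dots> = ennreal (sqrt 2) * (\<integral>\<^sup>+y. \<integral>\<^sup>+s. g (- y + sqrt 2 * s) y \<partial>lborel \<partial>lborel)"
    by (rule nn_integral_cmult) measurable
  also have "(\<integral>\<^sup>+y. \<integral>\<^sup>+s. g (- y + sqrt 2 * s) y \<partial>lborel \<partial>lborel) = (\<integral>\<^sup>+s. \<integral>\<^sup>+y. g (- y + sqrt 2 * s) y \<partial>lborel \<partial>lborel)"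
    by (rule lborel_pair.Fubini') measurable
  also have "\<dots> = (\<integral>\<^sup>+s. ennreal (1 / sqrt 2) * (\<integral>\<^sup>+t. g ((s + t) / sqrt 2) ((s - t) / sqrt 2) \<partial>lborel) \<partial>lborel)"
  proof (intro nn_integral_cong)
    fix s :: real
    have e: "s / sqrt 2 + - (1 / sqrt 2) * t = (s - t) / sqrt 2" for t
      by (simp add: diff_divide_distrib)
    have e': "- ((s - t) / sqrt 2) + sqrt 2 * s = (s + t) / sqrt 2" for t
    proof -
      have "sqrt 2 * s = 2 * s / sqrt 2" by (simp add: real_div_sqrt field_simps)
      then show ?thesis by (simp add: diff_divide_distrib add_divide_distrib)
    qed
    have abs: "\<bar>- (1 / sqrt 2)\<bar> = 1 / sqrt (2::real)" by simp
    have "(\<integral>\<^sup>+y. g (- y + sqrt 2 * s) y \<partial>lborel) =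
      ennreal \<bar>- (1 / sqrt 2)\<bar> * (\<integral>\<^sup>+t. g (- (s / sqrt 2 + - (1 / sqrt 2) * t) + sqrt 2 * s) (s / sqrt 2 + - (1 / sqrt 2) * t) \<partial>lborel)"
      by (rule nn_integral_real_affine) simp_all
    then show "(\<integral>\<^sup>+y. g (- y + sqrt 2 * s) y \<partial>lborel) =
      ennreal (1 / sqrt 2) * (\<integral>\<^sup>+t. g ((s + t) / sqrt 2) ((s - t) / sqrt 2) \<partial>lborel)"
      unfolding e e' abs .
  qed
  also have "\<dots> = ennreal (1 / sqrt 2) * (\<integral>\<^sup>+s. \<integral>\<^sup>+t. g ((s + t) / sqrt 2) ((s - t) / sqrt 2) \<partial>lborel \<partial>lborel)"
    by (rule nn_integral_cmult) measurable
  also have "(\<integral>\<^sup>+s. \<integral>\<^sup>+t. g ((s + t) / sqrt 2) ((s - t) / sqrt 2) \<partial>lborel \<partial>lborel) =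
      (\<integral>\<^sup>+t. \<integral>\<^sup>+s. g ((s + t) / sqrt 2) ((s - t) / sqrt 2) \<partial>lborel \<partial>lborel)"
    by (rule lborel_pair.Fubini'[symmetric]) measurable
  also have "ennreal (sqrt 2) * (ennreal (1 / sqrt 2) * (\<integral>\<^sup>+t. \<integral>\<^sup>+s. g ((s + t) / sqrt 2) ((s - t) / sqrt 2) \<partial>lborel \<partial>lborel)) =
      (\<integral>\<^sup>+t. \<integral>\<^sup>+s. g ((s + t) / sqrt 2) ((s - t) / sqrt 2) \<partial>lborel \<partial>lborel)"
    by (simp flip: mult.assoc ennreal_mult)
  also have "\<dots> = (\<integral>\<^sup>+t. \<integral>\<^sup>+s. ennreal (?n s * ?n t) * f ((s + t) / sqrt 2) ((s - t) / sqrt 2) \<partial>lborel \<partial>lborel)"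
  proof -
    have "?n ((s + t) / sqrt 2) * ?n ((s - t) / sqrt 2) = ?n s * ?n t" for s t
    proof -
      have "((s + t) / sqrt 2)\<^sup>2 + ((s - t) / sqrt 2)\<^sup>2 = s\<^sup>2 + t\<^sup>2"
        by (simp add: power_divide power2_eq_square field_simps)
      then have "- ((s + t) / sqrt 2)\<^sup>2 / 2 + - ((s - t) / sqrt 2)\<^sup>2 / 2 = - s\<^sup>2 / 2 + - t\<^sup>2 / 2" by simp
      then have "exp (- ((s + t) / sqrt 2)\<^sup>2 / 2) * exp (- ((s - t) / sqrt 2)\<^sup>2 / 2) = exp (- s\<^sup>2 / 2) * exp (- t\<^sup>2 / 2)"
        by (simp only: exp_add[symmetric])
      then show ?thesis unfolding std_normal_density_def mult_pairs by (simp only:)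
    qed
    then show ?thesis by (simp add: g_def)
  qed
  also have "\<dots> = (\<integral>\<^sup>+t. \<integral>\<^sup>+s. f ((s + t) / sqrt 2) ((s - t) / sqrt 2) \<partial>gauss \<partial>gauss)"
    by (rule gauss2[symmetric]) measurable
  finally show ?thesis .
qed

lemma nn_integral_even:
  fixes f :: "real \<Rightarrow> ennreal"
  assumes [measurable]: "f \<in> borel_measurable borel" and even: "\<And>x. f (- x) = f x"
  shows "(\<integral>\<^sup>+x. f x \<partial>lborel) = 2 * (\<integral>\<^sup>+x. f x * indicator {0..} x \<partial>lborel)"
proof -
  have "(\<integral>\<^sup>+x. f x \<partial>lborel) = (\<integral>\<^sup>+x. f x * indicator {0..} x + f x * indicator {..<0} x \<partial>lborel)"
    by (intro nn_integral_cong) (auto simp: indicator_def)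
  also have "\<dots> = (\<integral>\<^sup>+x. f x * indicator {0..} x \<partial>lborel) + (\<integral>\<^sup>+x. f x * indicator {..<0} x \<partial>lborel)"
    by (rule nn_integral_add) measurable
  also have "(\<integral>\<^sup>+x. f x * indicator {..<0} x \<partial>lborel) = (\<integral>\<^sup>+x. f (- x) * indicator {..<0} (- x) \<partial>lborel)"
    by (subst nn_integral_real_affine[where c = "-1" and t = 0]) simp_all
  also have "\<dots> = (\<integral>\<^sup>+x. f x * indicator {0..} x \<partial>lborel)"
    using AE_lborel_singleton[of "0::real"]
    by (intro nn_integral_cong_AE) (auto simp: even indicator_def)
  finally show ?thesis by (simp add: mult_2)
qed

lemma nn_integral_cauchy: "(\<integral>\<^sup>+w. ennreal (1 / (1 + w\<^sup>2)) \<partial>lborel) = ennreal pi"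
proof -
  have "(\<integral>\<^sup>+w. ennreal (1 / (1 + w\<^sup>2)) * indicator {0..} w \<partial>lborel) = ennreal (pi / 2 - arctan 0)"
  proof (rule nn_integral_FTC_atLeast)
    show "DERIV arctan x :> 1 / (1 + x\<^sup>2)" for x using DERIV_arctan[of x] by (simp add: inverse_eq_divide)
    show "(arctan \<longlongrightarrow> pi / 2) at_top" by (rule tendsto_arctan_at_top)
  qed (auto intro: add_nonneg_nonneg)
  then show ?thesis by (subst nn_integral_even) (simp_all flip: ennreal_numeral ennreal_mult)
qed

text \<open>The radial integral of polar coordinates, written over the whole line.\<close>

lemma nn_integral_abs_gauss_disk:
  assumes k: "k > 0" and T: "T \<ge> 0"
  shows "(\<integral>\<^sup>+u. ennreal (\<bar>u\<bar> * exp (- (k * u\<^sup>2) / 2)) * indicator {u. k * u\<^sup>2 \<le> T\<^sup>2} u \<partial>lborel) =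
    ennreal (2 / k * (1 - exp (- T\<^sup>2 / 2)))"
proof -
  define R where "R = T / sqrt k"
  have R: "R \<ge> 0" "k * R\<^sup>2 = T\<^sup>2" using k T by (simp_all add: R_def power_divide)
  have in_iff: "k * u\<^sup>2 \<le> T\<^sup>2 \<longleftrightarrow> \<bar>u\<bar> \<le> R" for u
    using k R abs_le_square_iff[of u R] by (simp flip: R(2))
  define F where "F u = - exp (- (k * u\<^sup>2) / 2) / k" for u
  have "(\<integral>\<^sup>+u. ennreal (\<bar>u\<bar> * exp (- (k * u\<^sup>2) / 2)) * indicator {u. k * u\<^sup>2 \<le> T\<^sup>2} u \<partial>lborel) =
    2 * (\<integral>\<^sup>+u. (ennreal (\<bar>u\<bar> * exp (- (k * u\<^sup>2) / 2)) * indicator {u. k * u\<^sup>2 \<le> T\<^sup>2} u) * indicator {0..} u \<partial>lborel)"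
    by (rule nn_integral_even) (simp_all add: indicator_def)
  also have "(\<integral>\<^sup>+u. (ennreal (\<bar>u\<bar> * exp (- (k * u\<^sup>2) / 2)) * indicator {u. k * u\<^sup>2 \<le> T\<^sup>2} u) * indicator {0..} u \<partial>lborel)
    = (\<integral>\<^sup>+u. ennreal (u * exp (- (k * u\<^sup>2) / 2)) * indicator {0..R} u \<partial>lborel)"
    by (intro nn_integral_cong) (auto simp: indicator_def in_iff)
  also have "\<dots> = ennreal (F R - F 0)"
  proof (rule nn_integral_FTC_Icc)
    show "DERIV F x :> x * exp (- (k * x\<^sup>2) / 2)" if "x \<in> {0..R}" for x
      unfolding F_def using k by (auto intro!: derivative_eq_intros)
  qed (use R in auto)
  also have "F R - F 0 = 1 / k * (1 - exp (- T\<^sup>2 / 2))"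
    using k by (simp add: F_def R(2) field_simps)
  also have "2 * ennreal (1 / k * (1 - exp (- T\<^sup>2 / 2))) = ennreal (2 / k * (1 - exp (- T\<^sup>2 / 2)))"
    using k by (simp flip: ennreal_numeral ennreal_mult)
  finally show ?thesis .
qed

text \<open>The substitution \<open>s = u w\<close> replaces polar coordinates: \<open>w\<close> is the slope, the integral over \<open>u\<close> is
elementary, and the one over \<open>w\<close> is the total mass of the Cauchy density.\<close>

lemma gauss_disk:
  "(\<integral>\<^sup>+u. \<integral>\<^sup>+s. indicator {s. u\<^sup>2 + s\<^sup>2 \<le> t\<^sup>2} s \<partial>gauss \<partial>gauss) = ennreal (1 - exp (- t\<^sup>2 / 2))"
proof -
  let ?n = "normal_density 0 1"
  define C where "C = ennreal (1 - exp (- t\<^sup>2 / 2))"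
  define h :: "real \<Rightarrow> real \<Rightarrow> ennreal" where "h u w = ennreal (1 / (2 * pi)) * (ennreal (\<bar>u\<bar> * exp (- ((1 + w\<^sup>2) * u\<^sup>2) / 2)) *
      indicator {u. (1 + w\<^sup>2) * u\<^sup>2 \<le> \<bar>t\<bar>\<^sup>2} u)" for u w
  have [measurable]: "case_prod h \<in> borel_measurable (borel \<Otimes>\<^sub>M borel)" unfolding h_def by measurable
  have inner: "ennreal (?n u) * (\<integral>\<^sup>+s. ennreal (?n s) * indicator {s. u\<^sup>2 + s\<^sup>2 \<le> t\<^sup>2} s \<partial>lborel) = (\<integral>\<^sup>+w. h u w \<partial>lborel)"
    if u: "u \<noteq> 0" for u
  proof -
    have "ennreal (?n u) * (\<integral>\<^sup>+s. ennreal (?n s) * indicator {s. u\<^sup>2 + s\<^sup>2 \<le> t\<^sup>2} s \<partial>lborel) =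
      ennreal (?n u) * (ennreal \<bar>u\<bar> * (\<integral>\<^sup>+w. ennreal (?n (u * w)) * indicator {s. u\<^sup>2 + s\<^sup>2 \<le> t\<^sup>2} (u * w) \<partial>lborel))"
      using u by (subst nn_integral_real_affine[where c = u and t = 0]) simp_all
    also have "\<dots> = (\<integral>\<^sup>+w. ennreal (?n u) * (ennreal \<bar>u\<bar> * (ennreal (?n (u * w)) * indicator {s. u\<^sup>2 + s\<^sup>2 \<le> t\<^sup>2} (u * w))) \<partial>lborel)"
      by (simp add: nn_integral_cmult)
    also have "\<dots> = (\<integral>\<^sup>+w. h u w \<partial>lborel)"
    proof (intro nn_integral_cong)
      fix w
      have "?n u * ?n (u * w) = 1 / (2 * pi) * exp (- ((1 + w\<^sup>2) * u\<^sup>2) / 2)"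
      proof -
        have "- u\<^sup>2 / 2 + - (u * w)\<^sup>2 / 2 = - ((1 + w\<^sup>2) * u\<^sup>2) / 2" by (simp add: power_mult_distrib field_simps)
        then have "exp (- u\<^sup>2 / 2) * exp (- (u * w)\<^sup>2 / 2) = exp (- ((1 + w\<^sup>2) * u\<^sup>2) / 2)" by (simp only: exp_add[symmetric])
        moreover have "1 / sqrt (2 * pi) * (1 / sqrt (2 * pi)) = 1 / (2 * pi)" by simp
        ultimately show ?thesis unfolding std_normal_density_def mult_pairs by (simp only:)
      qed
      then have "ennreal (?n u) * (ennreal \<bar>u\<bar> * ennreal (?n (u * w))) = ennreal (1 / (2 * pi)) * ennreal (\<bar>u\<bar> * exp (- ((1 + w\<^sup>2) * u\<^sup>2) / 2))"
        by (simp add: mult_ac flip: ennreal_mult)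
      moreover have "u\<^sup>2 + (u * w)\<^sup>2 = (1 + w\<^sup>2) * u\<^sup>2" by (simp add: power_mult_distrib algebra_simps)
      ultimately show "ennreal (?n u) * (ennreal \<bar>u\<bar> * (ennreal (?n (u * w)) * indicator {s. u\<^sup>2 + s\<^sup>2 \<le> t\<^sup>2} (u * w))) = h u w"
        by (simp add: h_def indicator_def)
    qed
    finally show ?thesis .
  qed
  have "(\<integral>\<^sup>+u. \<integral>\<^sup>+s. indicator {s. u\<^sup>2 + s\<^sup>2 \<le> t\<^sup>2} s \<partial>gauss \<partial>gauss) =
      (\<integral>\<^sup>+u. ennreal (?n u) * (\<integral>\<^sup>+s. indicator {s. u\<^sup>2 + s\<^sup>2 \<le> t\<^sup>2} s \<partial>gauss) \<partial>lborel)"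
    by (rule nn_integral_gauss) measurable
  also have "\<dots> = (\<integral>\<^sup>+u. ennreal (?n u) * (\<integral>\<^sup>+s. ennreal (?n s) * indicator {s. u\<^sup>2 + s\<^sup>2 \<le> t\<^sup>2} s \<partial>lborel) \<partial>lborel)"
    by (subst nn_integral_gauss) simp_all
  also have "\<dots> = (\<integral>\<^sup>+u. \<integral>\<^sup>+w. h u w \<partial>lborel \<partial>lborel)"
    using AE_lborel_singleton[of "0::real"] by (intro nn_integral_cong_AE) (auto simp: inner)
  also have "\<dots> = (\<integral>\<^sup>+w. \<integral>\<^sup>+u. h u w \<partial>lborel \<partial>lborel)"
    by (rule lborel_pair.Fubini'[symmetric]) measurable
  also have "\<dots> = (\<integral>\<^sup>+w. (C * ennreal (1 / pi)) * ennreal (1 / (1 + w\<^sup>2)) \<partial>lborel)"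
  proof (intro nn_integral_cong)
    fix w :: real
    have w: "1 + w\<^sup>2 > 0" by (simp add: add_pos_nonneg)
    have "(\<integral>\<^sup>+u. h u w \<partial>lborel) = ennreal (1 / (2 * pi)) * ennreal (2 / (1 + w\<^sup>2) * (1 - exp (- \<bar>t\<bar>\<^sup>2 / 2)))"
      unfolding h_def by (subst nn_integral_cmult) (simp_all only: nn_integral_abs_gauss_disk[OF w abs_ge_zero], measurable)
    also have "\<dots> = (C * ennreal (1 / pi)) * ennreal (1 / (1 + w\<^sup>2))"
    proof -
      have r: "1 / (2 * pi) * (2 / k * (1 - x)) = (1 - x) * (1 / pi) * (1 / k)" if "k > 0" for k x :: real
        using that by (simp add: field_simps)
      have "ennreal (1 / (2 * pi)) * ennreal (2 / (1 + w\<^sup>2) * (1 - exp (- \<bar>t\<bar>\<^sup>2 / 2))) =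
          ennreal (1 / (2 * pi) * (2 / (1 + w\<^sup>2) * (1 - exp (- \<bar>t\<bar>\<^sup>2 / 2))))"
        by (rule ennreal_mult[symmetric]) (use w in simp_all)
      also have "\<dots> = ennreal ((1 - exp (- t\<^sup>2 / 2)) * (1 / pi) * (1 / (1 + w\<^sup>2)))"
        unfolding r[OF w] power2_abs ..
      also have "\<dots> = ennreal ((1 - exp (- t\<^sup>2 / 2)) * (1 / pi)) * ennreal (1 / (1 + w\<^sup>2))"
        by (rule ennreal_mult) (use w in simp_all)
      also have "ennreal ((1 - exp (- t\<^sup>2 / 2)) * (1 / pi)) = C * ennreal (1 / pi)"
        unfolding C_def by (rule ennreal_mult) simp_all
      finally show ?thesis .
    qed
    finally show "(\<integral>\<^sup>+u. h u w \<partial>lborel) = (C * ennreal (1 / pi)) * ennreal (1 / (1 + w\<^sup>2))" .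
  qed
  also have "\<dots> = (C * ennreal (1 / pi)) * ennreal pi"
    by (subst nn_integral_cmult) (simp_all add: nn_integral_cauchy)
  also have "\<dots> = C" by (simp add: mult.assoc flip: ennreal_mult)
  finally show ?thesis by (simp add: C_def)
qed

text \<open>Multiplying the standard normal density by \<open>exp (- t^2 / 2)\<close> gives a normal density with variance
\<open>1/2\<close>, up to the factor \<open>sqrt 2 / 2\<close>.\<close>

lemma gauss_cone:
  "(\<integral>\<^sup>+t. ennreal (1 - exp (- t\<^sup>2 / 2)) \<partial>gauss) = ennreal (1 - sqrt 2 / 2)"
proof -
  have e: "(\<integral>\<^sup>+t. ennreal (exp (- t\<^sup>2 / 2)) \<partial>gauss) = ennreal (sqrt 2 / 2)"
  proof -
    have eq: "normal_density 0 1 t * exp (- t\<^sup>2 / 2) = sqrt 2 / 2 * normal_density 0 (sqrt 2 / 2) t" for t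
    proof -
      have "exp (- t\<^sup>2 / 2) * exp (- t\<^sup>2 / 2) = exp (- t\<^sup>2)" by (simp flip: exp_add)
      then show ?thesis by (simp add: normal_density_def power_divide real_sqrt_mult field_simps)
    qed
    interpret N: prob_space "density lborel (\<lambda>x. ennreal (normal_density 0 (sqrt 2 / 2) x))"
      by (rule prob_space_normal_density) simp
    have one: "(\<integral>\<^sup>+t. ennreal (normal_density 0 (sqrt 2 / 2) t) \<partial>lborel) = 1"
      using N.emeasure_space_1 by (simp add: emeasure_density)
    have "(\<integral>\<^sup>+t. ennreal (exp (- t\<^sup>2 / 2)) \<partial>gauss) =
        (\<integral>\<^sup>+t. ennreal (sqrt 2 / 2) * ennreal (normal_density 0 (sqrt 2 / 2) t) \<partial>lborel)"
    proof -
      have "ennreal (normal_density 0 1 t) * ennreal (exp (- t\<^sup>2 / 2)) =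
          ennreal (sqrt 2 / 2) * ennreal (normal_density 0 (sqrt 2 / 2) t)" for t
      proof -
        have "ennreal (normal_density 0 1 t) * ennreal (exp (- t\<^sup>2 / 2)) =
            ennreal (normal_density 0 1 t * exp (- t\<^sup>2 / 2))"
          by (rule ennreal_mult[symmetric]) simp_all
        also have "\<dots> = ennreal (sqrt 2 / 2) * ennreal (normal_density 0 (sqrt 2 / 2) t)"
          unfolding eq by (rule ennreal_mult) simp_all
        finally show ?thesis .
      qed
      moreover have "(\<lambda>t. ennreal (exp (- t\<^sup>2 / 2))) \<in> borel_measurable borel" by measurable
      ultimately show ?thesis by (simp only: nn_integral_gauss)
    qed
    also have "\<dots> = ennreal (sqrt 2 / 2)" by (simp add: nn_integral_cmult one)
    finally show ?thesis .
  qed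
  have "(\<integral>\<^sup>+t. ennreal (1 - exp (- t\<^sup>2 / 2)) \<partial>gauss) + (\<integral>\<^sup>+t. ennreal (exp (- t\<^sup>2 / 2)) \<partial>gauss)
     = (\<integral>\<^sup>+t. ennreal (1 - exp (- t\<^sup>2 / 2)) + ennreal (exp (- t\<^sup>2 / 2)) \<partial>gauss)"
    by (rule nn_integral_add[symmetric]) measurable
  also have "\<dots> = (\<integral>\<^sup>+t. 1 \<partial>gauss)"
    by (intro nn_integral_cong) (simp flip: ennreal_plus)
  also have "\<dots> = 1" using gauss.emeasure_space_1 by simp
  finally have s: "(\<integral>\<^sup>+t. ennreal (1 - exp (- t\<^sup>2 / 2)) \<partial>gauss) + ennreal (sqrt 2 / 2) = 1" unfolding e .
  have "ennreal (1 - sqrt 2 / 2) + ennreal (sqrt 2 / 2) = 1"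
    using sqrt2_less_2 by (simp flip: ennreal_plus)
  with s show ?thesis by (metis ennreal_add_diff_cancel_right ennreal_neq_top)
qed

text \<open>With \<open>u = (a - d) / sqrt 2\<close>, \<open>s = (b + c) / sqrt 2\<close>, \<open>t = (b - c) / sqrt 2\<close> the
discriminant is \<open>2 (u^2 + s^2 - t^2)\<close>.\<close>

lemma gauss4_cone:
  "gauss4 (indicator {(a, b, c, d). (a - d)\<^sup>2 + 4 * b * c \<le> 0}) = ennreal (1 - sqrt 2 / 2)"
proof -
  let ?I = "\<lambda>P. if P then 1 else 0 :: ennreal"
  have 1: "(\<integral>\<^sup>+d. \<integral>\<^sup>+a. ?I ((a - d)\<^sup>2 + 4 * b * c \<le> 0) \<partial>gauss \<partial>gauss) = (\<integral>\<^sup>+u. ?I (2 * u\<^sup>2 + 4 * b * c \<le> 0) \<partial>gauss)" for b c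
  proof -
    have "(\<integral>\<^sup>+d. \<integral>\<^sup>+a. ?I ((a - d)\<^sup>2 + 4 * b * c \<le> 0) \<partial>gauss \<partial>gauss) =
       (\<integral>\<^sup>+t. \<integral>\<^sup>+s. ?I (((s + t) / sqrt 2 - (s - t) / sqrt 2)\<^sup>2 + 4 * b * c \<le> 0) \<partial>gauss \<partial>gauss)"
      by (rule gauss_rotate) measurable
    also have "\<dots> = (\<integral>\<^sup>+t. \<integral>\<^sup>+s. ?I (2 * t\<^sup>2 + 4 * b * c \<le> 0) \<partial>gauss \<partial>gauss)"
    proof -
      have "((s + t) / sqrt 2 - (s - t) / sqrt 2)\<^sup>2 = 2 * t\<^sup>2" for s t :: real
        by (simp add: power2_eq_square field_simps)
      then show ?thesis by simp
    qed
    also have "\<dots> = (\<integral>\<^sup>+t. ?I (2 * t\<^sup>2 + 4 * b * c \<le> 0) \<partial>gauss)"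
      using gauss.emeasure_space_1 by simp
    finally show ?thesis .
  qed
  have "gauss4 (indicator {(a, b, c, d). (a - d)\<^sup>2 + 4 * b * c \<le> 0}) =
     (\<integral>\<^sup>+c. \<integral>\<^sup>+b. \<integral>\<^sup>+d. \<integral>\<^sup>+a. ?I ((a - d)\<^sup>2 + 4 * b * c \<le> 0) \<partial>gauss \<partial>gauss \<partial>gauss \<partial>gauss)"
    by (simp add: gauss4_def indicator_def of_bool_def)
  also have "\<dots> = (\<integral>\<^sup>+c. \<integral>\<^sup>+b. \<integral>\<^sup>+u. ?I (2 * u\<^sup>2 + 4 * b * c \<le> 0) \<partial>gauss \<partial>gauss \<partial>gauss)"
    by (simp only: 1)
  also have "\<dots> = (\<integral>\<^sup>+t. \<integral>\<^sup>+s. \<integral>\<^sup>+u. ?I (2 * u\<^sup>2 + 4 * ((s + t) / sqrt 2) * ((s - t) / sqrt 2) \<le> 0) \<partial>gauss \<partial>gauss \<partial>gauss)"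
    by (rule gauss_rotate) measurable
  also have "\<dots> = (\<integral>\<^sup>+t. \<integral>\<^sup>+s. \<integral>\<^sup>+u. indicator {u. s\<^sup>2 + u\<^sup>2 \<le> t\<^sup>2} u \<partial>gauss \<partial>gauss \<partial>gauss)"
  proof -
    have q: "2 * u\<^sup>2 + 4 * ((s + t) / sqrt 2) * ((s - t) / sqrt 2) = 2 * (u\<^sup>2 + s\<^sup>2 - t\<^sup>2)" for s t u :: real
      by (simp add: power2_eq_square field_simps)
    have "?I (2 * u\<^sup>2 + 4 * ((s + t) / sqrt 2) * ((s - t) / sqrt 2) \<le> 0) = indicator {u. s\<^sup>2 + u\<^sup>2 \<le> t\<^sup>2} u" for s t u :: real
      unfolding q by (auto simp: indicator_def)
    then show ?thesis by (simp only:)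
  qed
  also have "\<dots> = ennreal (1 - sqrt 2 / 2)" by (simp only: gauss_disk gauss_cone)
  finally show ?thesis .
qed

section \<open>The random linear field\<close>

lemma phase_portrait_eq_class_iff:
  assumes "linear f"
  shows "phase_portrait f = saddles \<longleftrightarrow> f \<in> saddles" "phase_portrait f = distinct_nodes \<longleftrightarrow> f \<in> distinct_nodes"
    "phase_portrait f = foci \<longleftrightarrow> f \<in> foci"
  using mem_phase_portrait[OF assms] phase_portrait_saddles phase_portrait_distinct_nodes phase_portrait_foci
  by metis+

lemma class_if_generic:
  assumes "linear f" "det_of f \<noteq> 0" "trace_of f \<noteq> 0" "discriminant f \<noteq> 0" shows "f \<in> saddles \<union> distinct_nodes \<union> foci"
  using assms by (auto simp: saddles_iff distinct_nodes_iff foci_iff)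

lemma borel4_Collect:
  assumes "Measurable.pred borel4 P" shows "Collect P \<in> sets borel4"
  using predE[OF assms] by (simp add: space_pair_measure)

lemma finite_roots:
  "d \<noteq> 0 \<Longrightarrow> finite {a::real. a * d - b * c = 0}" "finite {a::real. a + d = 0}"
  "finite {a::real. (a - d)\<^sup>2 + 4 * b * c = 0}"
proof -
  show "finite {a::real. a * d - b * c = 0}" if "d \<noteq> 0"
    by (rule finite_subset[of _ "{b * c / d}"]) (use that in \<open>auto simp: field_simps\<close>)
  show "finite {a::real. a + d = 0}"
    by (rule finite_subset[of _ "{- d}"]) auto
  show "finite {a::real. (a - d)\<^sup>2 + 4 * b * c = 0}"
  proof (rule finite_subset)
    let ?r = "sqrt (- (4 * b * c))"
    show "{a::real. (a - d)\<^sup>2 + 4 * b * c = 0} \<subseteq> {d + ?r, d - ?r}"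
    proof
      fix a assume "a \<in> {a. (a - d)\<^sup>2 + 4 * b * c = 0}"
      then have "- (4 * b * c) = (a - d)\<^sup>2" by simp
      then have "?r = \<bar>a - d\<bar>" by simp
      then show "a \<in> {d + ?r, d - ?r}" by auto
    qed
  qed simp
qed

locale random_linear_field = prob_space M for M :: "'w measure" +
  fixes A10 A01 B10 B01 :: "'w \<Rightarrow> real"
  assumes dist: "distributed M lborel A10 (\<lambda>x. ennreal (normal_density 0 1 x))"
    "distributed M lborel A01 (\<lambda>x. ennreal (normal_density 0 1 x))"
    "distributed M lborel B10 (\<lambda>x. ennreal (normal_density 0 1 x))"
    "distributed M lborel B01 (\<lambda>x. ennreal (normal_density 0 1 x))"
    and indep: "indep_vars (\<lambda>_. borel) (\<lambda>i::nat. [A10, A01, B10, B01] ! i) {..<4}"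
begin

definition F :: "'w \<Rightarrow> vf" where "F \<omega> = lin2 (A10 \<omega>) (A01 \<omega>) (B10 \<omega>) (B01 \<omega>)"

lemma linear_F [simp]: "linear (F \<omega>)" by (simp add: F_def)

lemma measurable_entries [measurable]:
  "A10 \<in> borel_measurable M" "A01 \<in> borel_measurable M" "B10 \<in> borel_measurable M" "B01 \<in> borel_measurable M"
  using dist[THEN distributed_measurable] by simp_all

lemma measurable_invariants [measurable]:
  "(\<lambda>\<omega>. det_of (F \<omega>)) \<in> borel_measurable M" "(\<lambda>\<omega>. trace_of (F \<omega>)) \<in> borel_measurable M" "(\<lambda>\<omega>. discriminant (F \<omega>)) \<in> borel_measurable M"
  unfolding F_def invariants_lin2 by measurable

lemma emeasure_entries:
  assumes "S \<in> sets borel4"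
  shows "emeasure M {\<omega> \<in> space M. (A10 \<omega>, A01 \<omega>, B10 \<omega>, B01 \<omega>) \<in> S} = gauss4 (indicator S)"
proof -
  let ?X = "\<lambda>i::nat. [A10, A01, B10, B01] ! i"
  have "distributed M lborel (?X i) (\<lambda>x. ennreal (normal_density 0 1 x))" if "i \<in> {..<4}" for i
  proof -
    have "i = 0 \<or> i = 1 \<or> i = 2 \<or> i = 3" using that by auto
    then show ?thesis using dist by (auto simp: numeral_2_eq_2 numeral_3_eq_3)
  qed
  from emeasure_gauss4[OF prob_space_axioms this indep assms] show ?thesis
    by (simp add: numeral_2_eq_2 numeral_3_eq_3)
qed

lemma AE_generic: "AE \<omega> in M. det_of (F \<omega>) \<noteq> 0 \<and> trace_of (F \<omega>) \<noteq> 0 \<and> discriminant (F \<omega>) \<noteq> 0"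
proof -
  \<comment> \<open>For given other entries, each of the three conditions is a polynomial equation for \<open>a\<close>.\<close>
  have null: "AE \<omega> in M. (A10 \<omega>, A01 \<omega>, B10 \<omega>, B01 \<omega>) \<notin> S"
    if [measurable]: "S \<in> sets borel4" and "\<And>b c d. d \<noteq> 0 \<Longrightarrow> finite {a. (a, b, c, d) \<in> S}" for S
  proof (rule AE_I)
    show "emeasure M {\<omega> \<in> space M. (A10 \<omega>, A01 \<omega>, B10 \<omega>, B01 \<omega>) \<in> S} = 0"
      using emeasure_entries[OF that(1)] gauss4_null[OF that(2)] by simp
  qed auto
  have "AE \<omega> in M. (A10 \<omega>, A01 \<omega>, B10 \<omega>, B01 \<omega>) \<notin> {(a, b, c, d). a * d - b * c = 0}"
  proof (rule null)
    show "{(a, b, c, d). a * d - b * c = 0} \<in> sets borel4"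
      unfolding order.eq_iff[of _ "0::real"] by (intro borel4_Collect) measurable
  qed (use finite_roots(1) in auto)
  moreover have "AE \<omega> in M. (A10 \<omega>, A01 \<omega>, B10 \<omega>, B01 \<omega>) \<notin> {(a, b, c, d). a + d = 0}"
  proof (rule null)
    show "{(a, b, c, d). a + d = 0} \<in> sets borel4"
      unfolding order.eq_iff[of _ "0::real"] by (intro borel4_Collect) measurable
  qed (use finite_roots(2) in auto)
  moreover have "AE \<omega> in M. (A10 \<omega>, A01 \<omega>, B10 \<omega>, B01 \<omega>) \<notin> {(a, b, c, d). (a - d)\<^sup>2 + 4 * b * c = 0}"
  proof (rule null)
    show "{(a, b, c, d). (a - d)\<^sup>2 + 4 * b * c = 0} \<in> sets borel4"
      unfolding order.eq_iff[of _ "0::real"] by (intro borel4_Collect) measurable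
  qed (use finite_roots(3) in auto)
  ultimately show ?thesis by eventually_elim (simp add: F_def)
qed

lemma prob_det_sign: "prob {\<omega> \<in> space M. det_of (F \<omega>) < 0} = 1 / 2" "prob {\<omega> \<in> space M. det_of (F \<omega>) > 0} = 1 / 2"
proof -
  let ?N = "{(a, b, c, d). a * d - b * c < 0} :: (real \<times> real \<times> real \<times> real) set"
  let ?P = "{(a, b, c, d). a * d - b * c > 0} :: (real \<times> real \<times> real \<times> real) set"
  have N [measurable]: "?N \<in> sets borel4" and P [measurable]: "?P \<in> sets borel4"
    by (intro borel4_Collect; measurable)+
  have "(\<lambda>(a, b, c, d). indicator ?P (- a, - b, c, d)) = (indicator ?N :: _ \<Rightarrow> ennreal)"
    by (auto simp: fun_eq_iff indicator_def)
  then have "gauss4 (indicator ?N) = gauss4 (indicator ?P)"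
    using gauss4_neg_row[of "indicator ?P"] by simp
  then have "emeasure M {\<omega> \<in> space M. det_of (F \<omega>) < 0} = emeasure M {\<omega> \<in> space M. det_of (F \<omega>) > 0}"
    using emeasure_entries[OF N] emeasure_entries[OF P] by (simp add: F_def)
  then have eq: "prob {\<omega> \<in> space M. det_of (F \<omega>) < 0} = prob {\<omega> \<in> space M. det_of (F \<omega>) > 0}"
    by (simp add: measure_def)
  have "prob {\<omega> \<in> space M. det_of (F \<omega>) > 0} = prob {\<omega> \<in> space M. \<not> det_of (F \<omega>) < 0}"
    using AE_generic by (intro prob_eq_AE) (auto elim!: eventually_mono)
  also have "\<dots> = 1 - prob {\<omega> \<in> space M. det_of (F \<omega>) < 0}" by (rule prob_neg) measurable
  finally show "prob {\<omega> \<in> space M. det_of (F \<omega>) < 0} = 1 / 2" "prob {\<omega> \<in> space M. det_of (F \<omega>) > 0} = 1 / 2"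
    using eq by simp_all
qed

lemma prob_attractor_conditions:
  "prob {\<omega> \<in> space M. trace_of (F \<omega>) < 0 \<and> det_of (F \<omega>) > 0} = 1 / 4"
  "prob {\<omega> \<in> space M. trace_of (F \<omega>) > 0 \<and> det_of (F \<omega>) > 0} = 1 / 4"
proof -
  let ?N = "{(a, b, c, d). a + d < 0 \<and> a * d - b * c > 0} :: (real \<times> real \<times> real \<times> real) set"
  let ?P = "{(a, b, c, d). a + d > 0 \<and> a * d - b * c > 0} :: (real \<times> real \<times> real \<times> real) set"
  have N [measurable]: "?N \<in> sets borel4" and P [measurable]: "?P \<in> sets borel4"
    by (intro borel4_Collect; measurable)+
  have "(\<lambda>(a, b, c, d). indicator ?P (- a, - b, - c, - d)) = (indicator ?N :: _ \<Rightarrow> ennreal)"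
    by (auto simp: fun_eq_iff indicator_def)
  then have "gauss4 (indicator ?N) = gauss4 (indicator ?P)"
    using gauss4_neg[of "indicator ?P"] by simp
  then have "emeasure M {\<omega> \<in> space M. trace_of (F \<omega>) < 0 \<and> det_of (F \<omega>) > 0} = emeasure M {\<omega> \<in> space M. trace_of (F \<omega>) > 0 \<and> det_of (F \<omega>) > 0}"
    using emeasure_entries[OF N] emeasure_entries[OF P] by (simp add: F_def)
  then have eq: "prob {\<omega> \<in> space M. trace_of (F \<omega>) < 0 \<and> det_of (F \<omega>) > 0} = prob {\<omega> \<in> space M. trace_of (F \<omega>) > 0 \<and> det_of (F \<omega>) > 0}"
    by (simp add: measure_def)
  have "prob {\<omega> \<in> space M. det_of (F \<omega>) > 0} =
      prob ({\<omega> \<in> space M. trace_of (F \<omega>) < 0 \<and> det_of (F \<omega>) > 0} \<union> {\<omega> \<in> space M. trace_of (F \<omega>) > 0 \<and> det_of (F \<omega>) > 0})"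
  proof (rule finite_measure_eq_AE)
    show "AE \<omega> in M. (\<omega> \<in> {\<omega> \<in> space M. det_of (F \<omega>) > 0}) = (\<omega> \<in> {\<omega> \<in> space M. trace_of (F \<omega>) < 0 \<and> det_of (F \<omega>) > 0} \<union>
        {\<omega> \<in> space M. trace_of (F \<omega>) > 0 \<and> det_of (F \<omega>) > 0})"
      using AE_generic by eventually_elim auto
  qed measurable
  also have "\<dots> = prob {\<omega> \<in> space M. trace_of (F \<omega>) < 0 \<and> det_of (F \<omega>) > 0} + prob {\<omega> \<in> space M. trace_of (F \<omega>) > 0 \<and> det_of (F \<omega>) > 0}"
    by (rule finite_measure_Union) auto
  finally show "prob {\<omega> \<in> space M. trace_of (F \<omega>) < 0 \<and> det_of (F \<omega>) > 0} = 1 / 4"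
    "prob {\<omega> \<in> space M. trace_of (F \<omega>) > 0 \<and> det_of (F \<omega>) > 0} = 1 / 4"
    using eq prob_det_sign(2) by simp_all
qed

lemma prob_disc_nonpos: "prob {\<omega> \<in> space M. discriminant (F \<omega>) \<le> 0} = 1 - sqrt 2 / 2"
proof -
  let ?C = "{(a, b, c, d). (a - d)\<^sup>2 + 4 * b * c \<le> 0} :: (real \<times> real \<times> real \<times> real) set"
  have C [measurable]: "?C \<in> sets borel4" by (intro borel4_Collect) measurable
  have "emeasure M {\<omega> \<in> space M. discriminant (F \<omega>) \<le> 0} = ennreal (1 - sqrt 2 / 2)"
    using emeasure_entries[OF C] gauss4_cone by (simp add: F_def)
  then show ?thesis using sqrt2_less_2 by (simp add: measure_def)
qed

lemma prob_focus: "prob {\<omega> \<in> space M. discriminant (F \<omega>) < 0 \<and> trace_of (F \<omega>) \<noteq> 0} = 1 - sqrt 2 / 2"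
proof -
  have "prob {\<omega> \<in> space M. discriminant (F \<omega>) < 0 \<and> trace_of (F \<omega>) \<noteq> 0} = prob {\<omega> \<in> space M. discriminant (F \<omega>) \<le> 0}"
  proof (rule prob_eq_AE)
    show "AE \<omega> in M. (discriminant (F \<omega>) < 0 \<and> trace_of (F \<omega>) \<noteq> 0) = (discriminant (F \<omega>) \<le> 0)"
      using AE_generic by eventually_elim auto
  qed measurable
  then show ?thesis using prob_disc_nonpos by simp
qed

text \<open>The discriminant is positive for nodes and for saddles and, up to a null set, only for them.\<close>

lemma prob_node: "prob {\<omega> \<in> space M. det_of (F \<omega>) > 0 \<and> discriminant (F \<omega>) > 0} = sqrt 2 / 2 - 1 / 2"
proof -
  have "prob {\<omega> \<in> space M. \<not> discriminant (F \<omega>) \<le> 0} = 1 - prob {\<omega> \<in> space M. discriminant (F \<omega>) \<le> 0}"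
    by (rule prob_neg) measurable
  then have "sqrt 2 / 2 = prob {\<omega> \<in> space M. \<not> discriminant (F \<omega>) \<le> 0}" using prob_disc_nonpos by simp
  also have "\<dots> = prob ({\<omega> \<in> space M. det_of (F \<omega>) < 0} \<union> {\<omega> \<in> space M. det_of (F \<omega>) > 0 \<and> discriminant (F \<omega>) > 0})"
    using AE_generic by (intro finite_measure_eq_AE) (auto elim!: eventually_mono dest: disc_pos_of_det_neg)
  also have "\<dots> = prob {\<omega> \<in> space M. det_of (F \<omega>) < 0} + prob {\<omega> \<in> space M. det_of (F \<omega>) > 0 \<and> discriminant (F \<omega>) > 0}"
    by (rule finite_measure_Union) auto
  finally show ?thesis using prob_det_sign(1) by linarith
qed

lemma portrait_events:
  "portrait_event M F saddles = {\<omega> \<in> space M. det_of (F \<omega>) < 0}"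
  "portrait_event M F distinct_nodes = {\<omega> \<in> space M. det_of (F \<omega>) > 0 \<and> discriminant (F \<omega>) > 0}"
  "portrait_event M F foci = {\<omega> \<in> space M. discriminant (F \<omega>) < 0 \<and> trace_of (F \<omega>) \<noteq> 0}"
  by (auto simp: portrait_event_def phase_portrait_eq_class_iff saddles_iff distinct_nodes_iff foci_iff)

lemma portrait_probs:
  "portrait_prob M F saddles = 1 / 2" "portrait_prob M F distinct_nodes = sqrt 2 / 2 - 1 / 2"
  "portrait_prob M F foci = 1 - sqrt 2 / 2"
  unfolding portrait_prob_def portrait_events by (rule prob_det_sign(1) prob_node prob_focus)+

text \<open>Any other portrait can occur only on the null set where trace, determinant or discriminant vanishes.\<close>

lemma positive_portraits: "{W. portrait_prob M F W > 0} = {saddles, distinct_nodes, foci}"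
proof (intro set_eqI iffI)
  fix W assume "W \<in> {saddles, distinct_nodes, foci}"
  moreover have "1 < sqrt 2" "sqrt 2 < 2" by (simp_all add: sqrt2_less_2)
  ultimately show "W \<in> {W. portrait_prob M F W > 0}" using portrait_probs by auto
next
  fix W assume W: "W \<in> {W. portrait_prob M F W > 0}"
  show "W \<in> {saddles, distinct_nodes, foci}"
  proof (rule ccontr)
    assume not: "W \<notin> {saddles, distinct_nodes, foci}"
    let ?N = "{\<omega> \<in> space M. \<not> (det_of (F \<omega>) \<noteq> 0 \<and> trace_of (F \<omega>) \<noteq> 0 \<and> discriminant (F \<omega>) \<noteq> 0)}"
    have "emeasure M ?N = 0"
      using AE_generic by (subst (asm) AE_iff_measurable[OF _ refl]) measurable
    moreover have "portrait_event M F W \<subseteq> ?N"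
      using not class_if_generic[OF linear_F] phase_portrait_saddles phase_portrait_distinct_nodes phase_portrait_foci
      unfolding portrait_event_def by blast
    then have "emeasure M (portrait_event M F W) \<le> emeasure M ?N" by (rule emeasure_mono) measurable
    ultimately have "portrait_prob M F W = 0" by (simp add: portrait_prob_def measure_def)
    then show False using W by simp
  qed
qed

end

lemma sqrt2_numeric: "\<bar>(sqrt 2 / 2 - 1 / 2) - 0.20711\<bar> \<le> 0.000005" "\<bar>(1 - sqrt 2 / 2) - 0.29289\<bar> \<le> (0.000005::real)"
proof -
  have "sqrt 2 \<le> 1.414214" by (rule real_le_lsqrt) (simp_all add: power2_eq_square)
  moreover have "1.414213 \<le> sqrt 2" by (rule real_le_rsqrt) (simp add: power2_eq_square)
  ultimately show "\<bar>(sqrt 2 / 2 - 1 / 2) - 0.20711\<bar> \<le> 0.000005" "\<bar>(1 - sqrt 2 / 2) - 0.29289\<bar> \<le> (0.000005::real)"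
    by (auto simp: abs_le_iff)
qed

theorem theorem1:
  fixes M :: "'w measure" and A10 A01 B10 B01 :: "'w \<Rightarrow> real" and F :: "'w \<Rightarrow> real^2 \<Rightarrow> real^2"
  assumes "prob_space M"
    and "distributed M lborel A10 (normal_density 0 1)"
    and "distributed M lborel A01 (normal_density 0 1)"
    and "distributed M lborel B10 (normal_density 0 1)"
    and "distributed M lborel B01 (normal_density 0 1)"
    and "prob_space.indep_vars M (\<lambda>_. borel) (\<lambda>i::nat. [A10, A01, B10, B01] ! i) {..<4}"
    and "\<And>\<omega> p. F \<omega> p = vector [A10 \<omega> * p $ 1 + A01 \<omega> * p $ 2, B10 \<omega> * p $ 1 + B01 \<omega> * p $ 2]"
  shows
    "{W. portrait_prob M F W > 0} = {saddles, distinct_nodes, foci} \<and>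
     card {saddles, distinct_nodes, foci} = 3 \<and>
     (\<forall>f. linear f \<and> portrait_prob M F (phase_portrait f) > 0 \<longrightarrow>
        (phase_portrait f = saddles \<longleftrightarrow> has_index_and_lines f (-1) 2) \<and>
        (phase_portrait f = distinct_nodes \<longleftrightarrow> has_index_and_lines f 1 2) \<and>
        (phase_portrait f = foci \<longleftrightarrow> has_index_and_lines f 1 0)) \<and>
     portrait_event M F saddles \<in> sets M \<and>
     portrait_event M F distinct_nodes \<in> sets M \<and>
     portrait_event M F foci \<in> sets M \<and>
     portrait_prob M F saddles = 1 / 2 \<and>
     portrait_prob M F distinct_nodes = sqrt 2 / 2 - 1 / 2 \<and>
     \<bar>(sqrt 2 / 2 - 1 / 2) - 0.20711\<bar> \<le> 0.000005 \<and>
     portrait_prob M F foci = 1 - sqrt 2 / 2 \<and>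
     \<bar>(1 - sqrt 2 / 2) - 0.29289\<bar> \<le> 0.000005 \<and>
     {\<omega> \<in> space M. global_attractor (F \<omega>)} \<in> sets M \<and>
     measure M {\<omega> \<in> space M. global_attractor (F \<omega>)} = 1 / 4 \<and>
     {\<omega> \<in> space M. global_repeller (F \<omega>)} \<in> sets M \<and>
     measure M {\<omega> \<in> space M. global_repeller (F \<omega>)} = 1 / 4"
proof -
  interpret R: random_linear_field M A10 A01 B10 B01
    using assms(1-6) by (intro random_linear_field.intro random_linear_field_axioms.intro)
  have F: "F = R.F"
    by (intro ext) (simp add: assms(7) R.F_def lin2_def)
  have att: "{\<omega> \<in> space M. global_attractor (R.F \<omega>)} = {\<omega> \<in> space M. trace_of (R.F \<omega>) < 0 \<and> det_of (R.F \<omega>) > 0}"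
    "{\<omega> \<in> space M. global_repeller (R.F \<omega>)} = {\<omega> \<in> space M. trace_of (R.F \<omega>) > 0 \<and> det_of (R.F \<omega>) > 0}"
    by (simp_all add: global_attractor_iff global_repeller_iff)
  have card: "card {saddles, distinct_nodes, foci} = 3" using classes_distinct by simp
  have lines1: "(phase_portrait f = saddles \<longleftrightarrow> has_index_and_lines f (-1) 2) \<and>
        (phase_portrait f = distinct_nodes \<longleftrightarrow> has_index_and_lines f 1 2) \<and>
        (phase_portrait f = foci \<longleftrightarrow> has_index_and_lines f 1 0)"
    if "linear f \<and> portrait_prob M R.F (phase_portrait f) > 0" for f
  proof (rule phase_portrait_determined_by_index_lines)
    have "phase_portrait f \<in> {saddles, distinct_nodes, foci}" using that R.positive_portraits by blast
    then show "f \<in> saddles \<union> distinct_nodes \<union> foci" using mem_phase_portrait[of f] that by auto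
  qed
  have lines: "\<forall>f. linear f \<and> portrait_prob M R.F (phase_portrait f) > 0 \<longrightarrow>
        (phase_portrait f = saddles \<longleftrightarrow> has_index_and_lines f (-1) 2) \<and>
        (phase_portrait f = distinct_nodes \<longleftrightarrow> has_index_and_lines f 1 2) \<and>
        (phase_portrait f = foci \<longleftrightarrow> has_index_and_lines f 1 0)"
    using lines1 by blast
  have events: "portrait_event M R.F saddles \<in> sets M" "portrait_event M R.F distinct_nodes \<in> sets M"
    "portrait_event M R.F foci \<in> sets M"
    unfolding R.portrait_events by measurable
  have att_events: "{\<omega> \<in> space M. trace_of (R.F \<omega>) < 0 \<and> det_of (R.F \<omega>) > 0} \<in> sets M"
    "{\<omega> \<in> space M. trace_of (R.F \<omega>) > 0 \<and> det_of (R.F \<omega>) > 0} \<in> sets M"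
    by measurable
  show ?thesis
    unfolding F att
    by (intro conjI R.positive_portraits card lines events R.portrait_probs sqrt2_numeric
        att_events R.prob_attractor_conditions)
qed

end
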